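(* Let $\mathrm{Area}_{\min}:=\inf_{G\in\mathcal{PC}_{\ge1}}\mathrm{Area}^{\mathrm{cri}}(G)$. Then $$8.3755\times10^{-2}\le \mathrm{Area}_{\min}\le 2.0961\times 10^{-1}.$$
   Context: Planar graphs. "Planar graph" means a planar tessellation: $(V,E)$ is an undirected simple graph topologically embedded into the sphere or the plane, $F$ is the set of faces (connected components of the complement of the image), and (i) every face is homeomorphic to a disk whose boundary consists of finitely many edges; (ii) every edge is contained in exactly two different faces; (iii) if the closures of two faces intersect, the intersection is either a vertex or an edge. Every vertex $x$ and face $\sigma$ is assumed to satisfy $\deg(x)\ge 3$ and $\deg(\sigma)\ge 3$, where $\deg(x)$ is the number of neighbours of $x$ and $\deg(\sigma)$ is the number of edges incident to $\sigma$. Spherical polyhedral surfaces. A regular spherical polygon is a domain in the unit sphere $\mathbb S^2(1)$ that is an intersection of finitely many hemispheres, with all side lengths equal and all interior angles equal; only polygons with at least three sides are considered. For $n\ge 3$ and $0<a\le \frac{2\pi}{n}$, $\Delta_n(a)$ denotes the regular spherical $n$-gon of side length $a$ contained in a hemisphere (unique up to isometry). Its interior angle is $\beta_{n,a}=2\arcsin\frac{\cos(\pi/n)}{\cos(a/2)}$ and its area is $n\beta_{n,a}-(n-2)\pi$. For a finite planar graph $G=(V,E,F)$ and $0<a\le \inf_{\sigma\in F}\frac{2\pi}{\deg(\sigma)}$, $S_a(G)$ is the metric surface obtained by replacing each face $\sigma$ by $\Delta_{\deg(\sigma)}(a)$ and gluing along common edges; $\mathrm{Area}_a(G)$ is its area.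 For a vertex $x$ whose incident faces $\sigma_1,\dots,\sigma_N$ ($N=\deg(x)$) are ordered by $\deg(\sigma_1)\le\dots\le\deg(\sigma_N)$, and $0\le a\le 2\pi/\deg(\sigma_N)$, the total angle is $\theta_a(x)=\sum_{i=1}^N 2\arcsin\frac{\cos(\pi/\deg(\sigma_i))}{\cos(a/2)}$ and the angle defect is $K_a(x)=2\pi-\theta_a(x)$. $\mathcal{PC}_{\ge1}$ is the class of finite planar graphs $G$ for which there is $a>0$ (with $a\le \inf_{\sigma\in F}\frac{2\pi}{\deg(\sigma)}$, where $F$ is the set of faces of $G$) such that $S_a(G)$ has curvature bounded below by $1$ in the sense of Alexandrov; equivalently (well known) $K_a(x)\ge 0$ for all $x\in V$. Critical quantities. For $G\in\mathcal{PC}_{\ge1}$ and a vertex $x$ of $G$, $a_c(x)=\max\{a\in[0,2\pi/\deg(\sigma_N)]: K_a(x)\ge 0\}$, $a_c(G)=\min_{x\in V}a_c(x)$, and $\mathrm{Area}^{\mathrm{cri}}(G)=\mathrm{Area}_{a_c(G)}(G)$. *)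

theory Defs
  imports "HOL-Analysis.Analysis"
begin

text \<open>
  A graph is given as drawn on a surface in 3-space: vertices are points, an edge is (the point
  set of) an arc, faces are subsets of the surface.  The vertex set cuts out the two ends
  \<open>e \<inter> verts G\<close> of an edge \<open>e\<close>.
\<close>

record pgraph =
  verts :: "(real ^ 3) set"
  edges :: "(real ^ 3) set set"
  faces :: "(real ^ 3) set set"

definition plane :: "(real ^ 3) set" where
  "plane = {p. p $ 3 = 0}"

definition simple_graph_on :: "(real ^ 3) set \<Rightarrow> pgraph \<Rightarrow> bool" where
  "simple_graph_on M G \<longleftrightarrow>
     verts G \<subseteq> M \<and>
     (\<forall>e \<in> edges G. e \<subseteq> M \<and>
        (\<exists>g. arc g \<and> path_image g = e \<and> e \<inter> verts G = {pathstart g, pathfinish g})) \<and>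
     (\<forall>e \<in> edges G. \<forall>e' \<in> edges G. e \<noteq> e' \<longrightarrow> e \<inter> e' \<subseteq> verts G) \<and>
     inj_on (\<lambda>e. e \<inter> verts G) (edges G)"

definition vdeg :: "pgraph \<Rightarrow> real ^ 3 \<Rightarrow> nat" where
  "vdeg G x = card {y \<in> verts G. y \<noteq> x \<and> (\<exists>e \<in> edges G. e \<inter> verts G = {x, y})}"

definition fdeg :: "pgraph \<Rightarrow> (real ^ 3) set \<Rightarrow> nat" where
  "fdeg G \<sigma> = card {e \<in> edges G. e \<subseteq> closure \<sigma>}"

text \<open>
  Faces are open subsets of the surface.  That a face is a disk whose boundary consists of edges is
  meant including the boundary: some homeomorphism of the closed unit disk onto the closed face
  takes the open disk to the face (and hence the unit circle to the face boundary
  \<open>closure \<sigma> - \<sigma>\<close>; \<open>frontier\<close> would be taken in 3-space).  Thus no vertex occurs twice on the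
  boundary of a face, and a vertex of degree \<open>N\<close> has exactly \<open>N\<close> incident faces.
\<close>

definition tessellation :: "(real ^ 3) set \<Rightarrow> pgraph \<Rightarrow> bool" where
  "tessellation M G \<longleftrightarrow>
     simple_graph_on M G \<and>
     faces G = components (M - (verts G \<union> \<Union>(edges G))) \<and>
     (\<forall>\<sigma> \<in> faces G.
        (\<exists>h k. homeomorphism (cball (0::complex) 1) (closure \<sigma>) h k \<and> h ` ball 0 1 = \<sigma>) \<and>
        (\<exists>B. finite B \<and> B \<subseteq> edges G \<and> closure \<sigma> - \<sigma> = \<Union>B)) \<and>
     (\<forall>e \<in> edges G. card {\<sigma> \<in> faces G. e \<subseteq> closure \<sigma>} = 2) \<and>
     (\<forall>\<sigma> \<in> faces G. \<forall>\<tau> \<in> faces G. \<sigma> \<noteq> \<tau> \<longrightarrow> closure \<sigma> \<inter> closure \<tau> \<noteq> {} \<longrightarrow>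
        (\<exists>v \<in> verts G. closure \<sigma> \<inter> closure \<tau> = {v}) \<or> closure \<sigma> \<inter> closure \<tau> \<in> edges G) \<and>
     (\<forall>x \<in> verts G. vdeg G x \<ge> 3) \<and>
     (\<forall>\<sigma> \<in> faces G. fdeg G \<sigma> \<ge> 3)"

definition planar_graph :: "pgraph \<Rightarrow> bool" where
  "planar_graph G \<longleftrightarrow> tessellation (sphere 0 1) G \<or> tessellation plane G"

text \<open>Interior angle and area of the regular spherical \<open>n\<close>-gon \<open>\<Delta>\<^sub>n(a)\<close> of side length \<open>a\<close>,
  \<open>0 < a \<le> 2\<pi>/n\<close>; the area is the angular excess.\<close>

definition polygon_angle :: "nat \<Rightarrow> real \<Rightarrow> real" where
  "polygon_angle n a = 2 * arcsin (cos (pi / real n) / cos (a / 2))"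

definition polygon_area :: "nat \<Rightarrow> real \<Rightarrow> real" where
  "polygon_area n a = real n * polygon_angle n a - (real n - 2) * pi"

definition Area :: "real \<Rightarrow> pgraph \<Rightarrow> real" where
  "Area a G = (\<Sum>\<sigma> \<in> faces G. polygon_area (fdeg G \<sigma>) a)"

definition faces_at :: "pgraph \<Rightarrow> real ^ 3 \<Rightarrow> (real ^ 3) set set" where
  "faces_at G x = {\<sigma> \<in> faces G. x \<in> closure \<sigma>}"

definition total_angle :: "pgraph \<Rightarrow> real \<Rightarrow> real ^ 3 \<Rightarrow> real" where
  "total_angle G a x = (\<Sum>\<sigma> \<in> faces_at G x. polygon_angle (fdeg G \<sigma>) a)"

definition angle_defect :: "pgraph \<Rightarrow> real \<Rightarrow> real ^ 3 \<Rightarrow> real" where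
  "angle_defect G a x = 2 * pi - total_angle G a x"

text \<open>
  For a surface glued from spherical polygons, curvature bounded below by 1 in the sense of
  Alexandrov amounts to the total angle at every vertex being at most \<open>2\<pi>\<close>; this
  angle condition is used as the definition.
\<close>

definition curvature_ge_1 :: "real \<Rightarrow> pgraph \<Rightarrow> bool" where
  "curvature_ge_1 a G \<longleftrightarrow> (\<forall>x \<in> verts G. angle_defect G a x \<ge> 0)"

definition PC_ge_1 :: "pgraph set" where
  "PC_ge_1 = {G. planar_graph G \<and> finite (verts G) \<and>
     (\<exists>a > 0. a \<le> (INF \<sigma> \<in> faces G. 2 * pi / real (fdeg G \<sigma>)) \<and> curvature_ge_1 a G)}"

definition a_crit_at :: "pgraph \<Rightarrow> real ^ 3 \<Rightarrow> real" where
  "a_crit_at G x = (GREATEST a.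
     a \<in> {0 .. 2 * pi / real (Max (fdeg G ` faces_at G x))} \<and> angle_defect G a x \<ge> 0)"

definition a_crit :: "pgraph \<Rightarrow> real" where
  "a_crit G = Min (a_crit_at G ` verts G)"

definition Area_cri :: "pgraph \<Rightarrow> real" where
  "Area_cri G = Area (a_crit G) G"

definition Area_min :: real where
  "Area_min = (INF G \<in> PC_ge_1. Area_cri G)"

end

theory Submission
  imports Defs
begin

text \<open>
  The interior angle of the regular spherical \<open>n\<close>-gon of side \<open>a\<close> exceeds the flat angle \<open>\<pi> - 2\<pi>/n\<close> by a
  corner excess \<open>s\<^sub>n(a)\<close>, and the area of the polygon is \<open>n s\<^sub>n(a)\<close>.

  Lower bound.  Let \<open>x\<close> be a vertex whose critical side equals the critical side \<open>a\<close> of the graph, with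
  incident faces of degrees \<open>d\<^sub>1, \<dots>, d\<^sub>N\<close>.  Either \<open>a\<close> is the largest side possible for one of these faces,
  and then this face is a hemisphere of area \<open>2\<pi>\<close>; or the total angle at \<open>x\<close> is exactly \<open>2\<pi>\<close>, which
  means \<open>\<Sum> s\<^bsub>d\<^sub>i\<^esub>(a) = 2\<pi>K\<close> for the combinatorial curvature \<open>K = 1 - N/2 + \<Sum> 1/d\<^sub>i\<close>
  (\<open>a_crit_at_properties\<close>, \<open>sum_list_corner_excess\<close>).  As \<open>s\<^sub>n(a)\<close> increases with \<open>n\<close>, Chebyshev's
  inequality bounds the area around \<open>x\<close> from below by \<open>2\<pi>K (\<Sum> d\<^sub>i) / N\<close>.  Running through the degree
  sequences with \<open>K > 0\<close> shows that this is large enough except for \<open>(3, 11, 13)\<close> and \<open>(3, 7, 41)\<close>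
  (\<open>comb_curvature_cases\<close>).  In these two cases the excesses are compared through the common value
  \<open>1 / cos (a/2)\<close> (\<open>corner_excess_cos\<close>), and \<open>(3, 11, 13)\<close> gives the number \<open>0.083755\<close>.

  Upper bound.  One graph of small critical area suffices.  A vertex of type \<open>(3, 11, 13)\<close> forces a very
  short side, so it pays to surround such a vertex with as few further faces as possible.  In the wedge
  used here, a 13-gon and an 11-gon share an edge like the covers of an opened book, and the gap between
  them is closed by a strip of two triangles, eight squares and again two triangles.  It has 22 vertices
  and 14 faces, and its critical area is below \<open>0.12\<close>.

  That the wedge is a tessellation of the sphere is seen by drawing it as the normal fan of a convex
  polytope with integral vertices: the face belonging to a vertex \<open>n\<close> of the polytope is the set of
  directions in which the linear form of \<open>n\<close> has the strict maximum.  Such sets are disjoint, convex and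
  exhaust the sphere up to their boundaries; all incidences reduce to finitely many integer
  inequalities (\<open>convex_fan\<close>, \<open>tessellation_graph\<close>).
\<close>

section \<open>Regular spherical polygons\<close>

text \<open>
  The angular excess of \<open>\<Delta>\<^sub>n(a)\<close>, shared out equally among its corners: the amount by which
  a corner is wider than the corner of a flat regular \<open>n\<close>-gon.
\<close>

definition corner_excess :: "nat \<Rightarrow> real \<Rightarrow> real" where
  "corner_excess n a = polygon_angle n a - (pi - 2 * pi / real n)"

lemma polygon_area_eq_corner_excess:
  assumes "n \<noteq> 0"
  shows "polygon_area n a = real n * corner_excess n a"
  using assms by (simp add: polygon_area_def corner_excess_def field_simps)

lemma half_side_bounds:
  fixes a :: real
  assumes "3 \<le> n" "0 \<le> a" "a \<le> 2 * pi / real n"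
  shows "0 \<le> a / 2" "a / 2 \<le> pi / real n" "pi / real n \<le> pi / 3" "0 < pi / real n"
    "0 < cos (a / 2)" "cos (a / 2) \<le> 1" "0 < cos (pi / real n)" "cos (pi / real n) \<le> cos (a / 2)"
proof -
  show 1: "0 \<le> a / 2" and 2: "a / 2 \<le> pi / real n" using assms by (auto simp: field_simps)
  show 3: "pi / real n \<le> pi / 3" using assms(1) by (intro divide_left_mono) auto
  show 4: "0 < pi / real n" using assms by simp
  show "0 < cos (a / 2)" using 1 2 3 pi_gt_zero by (intro cos_gt_zero_pi) linarith+
  show "cos (a / 2) \<le> 1" by simp
  show "0 < cos (pi / real n)" using 3 4 pi_gt_zero by (intro cos_gt_zero_pi) linarith+
  show "cos (pi / real n) \<le> cos (a / 2)" using 1 2 3 pi_gt_zero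
    by (intro cos_monotone_0_pi_le) linarith+
qed

lemma angle_ratio_bounds:
  assumes "3 \<le> n" "0 \<le> a" "a \<le> 2 * pi / real n"
  shows "cos (pi / real n) \<le> cos (pi / real n) / cos (a / 2)"
    "cos (pi / real n) / cos (a / 2) \<le> 1" "0 < cos (pi / real n) / cos (a / 2)"
  using half_side_bounds[OF assms] by (auto simp: divide_simps mult_le_cancel_left1)

lemma polygon_angle_0:
  assumes "3 \<le> n"
  shows "polygon_angle n 0 = pi - 2 * pi / real n"
proof -
  have "arcsin (cos (pi / real n)) = arcsin (sin (pi / 2 - pi / real n))"
    by (simp add: sin_diff)
  also have "\<dots> = pi / 2 - pi / real n"
    using half_side_bounds(3,4)[OF assms, of 0, simplified] assms pi_gt_zero by (intro arcsin_sin) linarith+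
  finally show ?thesis by (simp add: polygon_angle_def)
qed

lemma polygon_angle_at_hemisphere:
  assumes "3 \<le> n"
  shows "polygon_angle n (2 * pi / real n) = pi"
  using half_side_bounds[OF assms, of 0] by (simp add: polygon_angle_def)

text \<open>
  Half of \<open>\<Delta>\<^sub>n(a)\<close>'s central triangle is right-angled, which gives
  \<open>cos (\<pi>/n) = cos (a/2) cos (\<pi>/n - x)\<close> for the half-excess \<open>x\<close>.  Solved for \<open>1 / cos (a/2)\<close>, the side
  stands alone on the left.  All polygons glued at a vertex have the same side, so this single number
  controls all their excesses.
\<close>

lemma corner_excess_cos:
  assumes "3 \<le> n" "0 \<le> a" "a \<le> 2 * pi / real n"
  defines "x \<equiv> corner_excess n a / 2"
  shows "0 \<le> x" "x \<le> pi / real n" "1 / cos (a / 2) = cos x + tan (pi / real n) * sin x"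
proof -
  note h = half_side_bounds[OF assms(1-3)]
  note q = angle_ratio_bounds[OF assms(1-3)]
  let ?q = "cos (pi / real n) / cos (a / 2)"
  have x: "x = arcsin ?q - (pi / 2 - pi / real n)"
    by (simp add: x_def corner_excess_def polygon_angle_def field_simps)
  have "arcsin (cos (pi / real n)) \<le> arcsin ?q"
    using q h by (intro arcsin_le_arcsin) linarith+
  with polygon_angle_0[OF assms(1)] show "0 \<le> x" by (simp add: x polygon_angle_def field_simps)
  have "arcsin ?q \<le> pi / 2" using q by (intro arcsin_ubound) linarith+
  then show "x \<le> pi / real n" by (simp add: x)
  have "sin (arcsin ?q) = ?q" using q by (intro sin_arcsin) linarith+
  moreover have "arcsin ?q = pi / 2 - (pi / real n - x)" by (simp add: x)
  ultimately have "cos (pi / real n - x) = ?q"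
    unfolding cos_sin_eq[of "pi / real n - x"] by simp
  then show "1 / cos (a / 2) = cos x + tan (pi / real n) * sin x"
    using h by (simp add: cos_diff tan_def field_simps)
qed

lemma corner_excess_nonneg:
  assumes "3 \<le> n" "0 \<le> a" "a \<le> 2 * pi / real n"
  shows "0 \<le> corner_excess n a"
  using corner_excess_cos(1)[OF assms] by simp

lemma polygon_area_nonneg:
  assumes "3 \<le> n" "0 \<le> a" "a \<le> 2 * pi / real n"
  shows "0 \<le> polygon_area n a"
  using corner_excess_nonneg[OF assms] assms by (simp add: polygon_area_eq_corner_excess)

lemma polygon_area_hemisphere:
  assumes "3 \<le> n"
  shows "polygon_area n (2 * pi / real n) = 2 * pi"
  unfolding polygon_area_def polygon_angle_at_hemisphere[OF assms] by (simp add: algebra_simps)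

lemma corner_excess_pos:
  assumes "3 \<le> n" "0 < a" "a \<le> 2 * pi / real n"
  shows "0 < corner_excess n a"
proof (rule ccontr)
  assume "\<not> 0 < corner_excess n a"
  with corner_excess_nonneg[of n a] assms have 0: "corner_excess n a = 0" by simp
  have "1 / cos (a / 2) = 1"
    using corner_excess_cos(3)[of n a] assms by (simp add: 0)
  then have "cos (a / 2) = 1" by simp
  moreover have "cos (a / 2) < cos 0"
    using half_side_bounds[of n a] assms pi_gt_zero by (intro cos_monotone_0_pi) linarith+
  ultimately show False by simp
qed

lemma polygon_angle_less_pi:
  assumes "3 \<le> n" "0 \<le> a" "a < 2 * pi / real n"
  shows "polygon_angle n a < pi"
proof -
  note h = half_side_bounds[OF assms(1,2) less_imp_le[OF assms(3)]]
  note q = angle_ratio_bounds[OF assms(1,2) less_imp_le[OF assms(3)]]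
  have "cos (pi / real n) < cos (a / 2)"
    using h assms pi_gt_zero by (intro cos_monotone_0_pi) linarith+
  then have "cos (pi / real n) / cos (a / 2) < 1" using h by simp
  then have "arcsin (cos (pi / real n) / cos (a / 2)) < arcsin 1"
    using q by (intro arcsin_less_arcsin) linarith+
  then show ?thesis by (simp add: polygon_angle_def)
qed

lemma continuous_on_polygon_angle:
  assumes "3 \<le> n"
  shows "continuous_on {0 .. 2 * pi / real n} (polygon_angle n)"
proof -
  have "cos (a / 2) \<noteq> 0" if "a \<in> {0 .. 2 * pi / real n}" for a
    using half_side_bounds(5)[of n a] assms that by simp
  then have "continuous_on {0 .. 2 * pi / real n} (\<lambda>a. cos (pi / real n) / cos (a / 2))"
    by (intro continuous_intros) auto
  moreover have "- 1 \<le> cos (pi / real n) / cos (a / 2) \<and> cos (pi / real n) / cos (a / 2) \<le> 1"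
    if "a \<in> {0 .. 2 * pi / real n}" for a
    using angle_ratio_bounds(2,3)[of n a] assms that by auto
  ultimately show ?thesis
    unfolding polygon_angle_def by (intro continuous_on_mult_left continuous_on_arcsin) auto
qed

lemma sec_shift_strict_mono:
  fixes x y \<alpha> :: real
  assumes "0 \<le> x" "x < y" "y \<le> \<alpha>" "\<alpha> < pi / 2"
  shows "cos x + tan \<alpha> * sin x < cos y + tan \<alpha> * sin y"
proof -
  have c: "0 < cos \<alpha>" using assms by (intro cos_gt_zero) linarith+
  have *: "cos z + tan \<alpha> * sin z = cos (\<alpha> - z) / cos \<alpha>" for z
    using c by (simp add: cos_diff tan_def field_simps)
  have "cos (\<alpha> - x) < cos (\<alpha> - y)" using assms pi_gt_zero by (intro cos_monotone_0_pi) linarith+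
  then show ?thesis unfolding * using c by (simp add: divide_strict_right_mono)
qed

text \<open>
  The right-hand side of \<open>corner_excess_cos\<close> increases with \<open>x\<close>, so an estimate of \<open>1 / cos (a/2)\<close>
  turns into an estimate of the excess.
\<close>

lemma corner_excess_le:
  assumes "3 \<le> n" "0 \<le> a" "a \<le> 2 * pi / real n" "0 \<le> r"
    and "1 / cos (a / 2) \<le> cos r + tan (pi / real n) * sin r"
  shows "corner_excess n a \<le> 2 * r"
proof (rule ccontr)
  note c = corner_excess_cos[OF assms(1-3)]
  assume "\<not> corner_excess n a \<le> 2 * r"
  then have "cos r + tan (pi / real n) * sin r < 1 / cos (a / 2)"
    unfolding c(3) using half_side_bounds[OF assms(1-3)] c(2) assms(4) pi_gt_zero
    by (intro sec_shift_strict_mono) linarith+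
  with assms(5) show False by simp
qed

lemma corner_excess_gt:
  assumes "3 \<le> n" "0 \<le> a" "a \<le> 2 * pi / real n" "r \<le> pi / real n"
    and "cos r + tan (pi / real n) * sin r < 1 / cos (a / 2)"
  shows "2 * r < corner_excess n a"
proof (rule ccontr)
  note c = corner_excess_cos[OF assms(1-3)]
  let ?x = "corner_excess n a / 2"
  assume "\<not> 2 * r < corner_excess n a"
  then have "?x \<le> r" by simp
  then have "1 / cos (a / 2) \<le> cos r + tan (pi / real n) * sin r"
  proof (cases "?x = r")
    case False
    with \<open>?x \<le> r\<close> half_side_bounds(3)[OF assms(1-3)] c(1) assms(4) pi_gt_zero show ?thesis
      unfolding c(3) by (intro less_imp_le[OF sec_shift_strict_mono]) linarith+
  qed (use c(3) in simp)
  with assms(5) show False by simp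
qed

text \<open>
  Since \<open>tan (\<pi>/n)\<close> decreases in \<open>n\<close>, a polygon with more sides needs a larger half-excess to reach the
  common value \<open>1 / cos (a/2)\<close>.
\<close>

lemma corner_excess_mono:
  assumes "3 \<le> m" "m \<le> n" "0 \<le> a" "a \<le> 2 * pi / real n"
  shows "corner_excess m a \<le> corner_excess n a"
proof -
  have mn: "pi / real n \<le> pi / real m" using assms(1,2) by (intro divide_left_mono) auto
  have am: "a \<le> 2 * pi / real m" using mn assms(4) by simp
  have n3: "3 \<le> n" using assms by simp
  note c = corner_excess_cos[OF n3 assms(3,4)]
  note h = half_side_bounds[OF assms(1,3) am]
  let ?x = "corner_excess n a / 2"
  have "tan (pi / real n) \<le> tan (pi / real m)"
    using mn h half_side_bounds(4)[OF n3 assms(3,4)] pi_gt_zero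
    by (intro tan_mono_le) linarith+
  moreover have "0 \<le> sin ?x" using c h mn pi_gt_zero by (intro sin_ge_zero) linarith+
  ultimately have "cos ?x + tan (pi / real n) * sin ?x \<le> cos ?x + tan (pi / real m) * sin ?x"
    by (simp add: mult_right_mono)
  then have "corner_excess m a \<le> 2 * ?x"
    using assms am c by (intro corner_excess_le) auto
  then show ?thesis by simp
qed

lemma polygon_angle_mono:
  assumes "3 \<le> n" "0 \<le> a" "a \<le> b" "b \<le> 2 * pi / real n"
  shows "polygon_angle n a \<le> polygon_angle n b"
proof -
  have ab: "a \<le> 2 * pi / real n" "0 \<le> b" using assms by auto
  note q = angle_ratio_bounds[OF assms(1,2) ab(1)] angle_ratio_bounds[OF assms(1) ab(2) assms(4)]
  note h = half_side_bounds[OF assms(1,2) ab(1)] half_side_bounds[OF assms(1) ab(2) assms(4)]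
  have "cos (b / 2) \<le> cos (a / 2)" using h assms pi_gt_zero
    by (intro cos_monotone_0_pi_le) linarith+
  then have "cos (pi / real n) / cos (a / 2) \<le> cos (pi / real n) / cos (b / 2)"
    using h by (intro divide_left_mono) auto
  then show ?thesis unfolding polygon_angle_def
    using q by (intro mult_left_mono arcsin_le_arcsin) linarith+
qed

section \<open>Vertices of positive combinatorial curvature\<close>

text \<open>
  Chebyshev's inequality for two similarly ordered families, in a form that does not ask the list to be
  sorted.
\<close>

lemma Chebyshev_sum_list:
  fixes f g :: "'a \<Rightarrow> real"
  assumes "\<And>x y. x \<in> set xs \<Longrightarrow> y \<in> set xs \<Longrightarrow> (f x - f y) * (g x - g y) \<ge> 0"
  shows "sum_list (map f xs) * sum_list (map g xs) \<le> real (length xs) * sum_list (map (\<lambda>x. f x * g x) xs)"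
proof -
  let ?n = "length xs"
  let ?f = "\<lambda>i. f (xs ! i)" and ?g = "\<lambda>i. g (xs ! i)"
  \<comment> \<open>Every term of this double sum is nonnegative; expanding it gives the claim.\<close>
  have "0 \<le> (\<Sum>i<?n. \<Sum>j<?n. (?f i - ?f j) * (?g i - ?g j))"
    by (intro sum_nonneg assms) auto
  also have "\<dots> = 2 * (real ?n * (\<Sum>i<?n. ?f i * ?g i)) - 2 * ((\<Sum>i<?n. ?f i) * (\<Sum>i<?n. ?g i))"
  proof -
    have 1: "(\<Sum>i<?n. \<Sum>j<?n. ?f j * ?g i) = (\<Sum>i<?n. ?f i) * (\<Sum>i<?n. ?g i)"
      by (subst sum.swap) (simp add: sum_product)
    have 2: "(\<Sum>i<?n. \<Sum>j<?n. ?f i * ?g j) = (\<Sum>i<?n. ?f i) * (\<Sum>i<?n. ?g i)"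
      by (simp add: sum_product)
    have "(\<Sum>i<?n. \<Sum>j<?n. (?f i - ?f j) * (?g i - ?g j)) = (\<Sum>i<?n. \<Sum>j<?n. ?f i * ?g i)
        + (\<Sum>i<?n. \<Sum>j<?n. ?f j * ?g j) - (\<Sum>i<?n. \<Sum>j<?n. ?f i * ?g j) - (\<Sum>i<?n. \<Sum>j<?n. ?f j * ?g i)"
      unfolding sum.distrib[symmetric] sum_subtractf[symmetric] by (simp add: algebra_simps)
    then show ?thesis unfolding 1 2 by (simp add: sum_negf sum_distrib_left)
  qed
  finally show ?thesis
    by (simp add: sum_list_sum_nth atLeast0LessThan)
qed

text \<open>
  Summed around a vertex, the flat parts of the angles amount to \<open>(N - 2 \<Sum> 1/d\<^sub>i) \<pi>\<close>.  At total angle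
  \<open>2 \<pi>\<close> the excesses therefore add up to \<open>2 \<pi>\<close> times the combinatorial curvature defined next.
\<close>

lemma sum_list_corner_excess:
  shows "sum_list (map (\<lambda>n. corner_excess n a) ds) = sum_list (map (\<lambda>n. polygon_angle n a) ds)
    - 2 * pi * (real (length ds) / 2 - sum_list (map (\<lambda>n. 1 / real n) ds))"
proof (induction ds)
  case (Cons n ds)
  have "corner_excess n a = polygon_angle n a - 2 * pi * (1 / 2 - 1 / real n)"
    by (simp add: corner_excess_def algebra_simps)
  with Cons show ?case by (simp only: list.map sum_list.Cons length_Cons) (simp add: algebra_simps add_divide_distrib)
qed simp

abbreviation comb_curvature :: "nat list \<Rightarrow> real" where
  "comb_curvature ds \<equiv> 1 - real (length ds) / 2 + sum_list (map (\<lambda>n. 1 / real n) ds)"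

text \<open>
  With denominators cleared, the hypothesis says that \<open>1/p + 1/q + 1/r - 1/2\<close> is positive and the
  conclusion that its product with \<open>p + q + r\<close> is at least \<open>3/75\<close>.  In the families \<open>(3, q, r)\<close> with
  \<open>q \<le> 6\<close> and \<open>(4, 4, r)\<close>, where \<open>r\<close> is unbounded, the curvature is at least \<open>1/r\<close> and the claim is
  clear; positivity leaves finitely many other triples.
\<close>

lemma comb_curvature_three_cases:
  fixes p q r :: nat
  assumes "3 \<le> p" "p \<le> q" "q \<le> r" and pos: "p * q * r < 2 * (q * r + p * r + p * q)"
  shows "(p, q, r) \<in> {(3, 11, 13), (3, 7, 41)} \<or>
    (2 * (q * r + p * r + p * q) - p * q * r) * (p + q + r) * 25 \<ge> 2 * (p * q * r)"
    (is "?P p q r")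
proof -
  have arith: "6 * A \<le> D \<Longrightarrow> B \<le> A \<Longrightarrow> C \<le> A \<Longrightarrow> 2 * (A + B + C) \<le> D" for A B C D :: nat
    by presburger
  have "p < 6"
  proof (rule ccontr)
    assume "\<not> p < 6"
    then have "6 * (q * r) \<le> p * (q * r)" by (intro mult_right_mono) auto
    moreover have "p * r \<le> q * r" "p * q \<le> q * r" using assms by (simp_all add: mult.commute)
    ultimately have "2 * (q * r + p * r + p * q) \<le> p * (q * r)"
      by (rule arith)
    then show False using pos by (simp add: mult.assoc)
  qed
  then have p: "p = 3 \<or> p = 4 \<or> p = 5" using assms(1) by linarith
  have q: "q < 12"
  proof (rule ccontr)
    assume "\<not> q < 12"
    then have "12 * r \<le> q * r" by simp
    moreover have "q * r < 6 * r + 6 * q"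
    proof -
      have "A < 6 * r + 6 * q" if "p * A < 2 * (A + p * r + p * q)" for A
        using p that by (elim disjE; clarsimp; presburger)
      from this[of "q * r"] show ?thesis using pos by (simp add: mult.assoc)
    qed
    moreover have "A < 6 * r + 6 * q \<Longrightarrow> 12 * r \<le> A \<Longrightarrow> False" for A
      using assms(3) \<open>\<not> q < 12\<close> by presburger
    ultimately show False by blast
  qed
  have *: "?P p q r" if "p = 3 \<and> q < 7 \<or> p = 4 \<and> q = 4"
  proof -
    have "(p, q) \<in> {(3,3),(3,4),(3,5),(3,6),(4,4)}" using that assms by auto
    then show ?thesis by (elim insertE emptyE) (simp_all add: algebra_simps)
  qed
  moreover have "?P p q r" if "\<not> (p = 3 \<and> q < 7 \<or> p = 4 \<and> q = 4)"
  proof -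
    have "q = 4 \<or> q = 5 \<or> q = 6 \<or> q = 7 \<or> q = 8 \<or> q = 9 \<or> q = 10 \<or> q = 11"
      using q that assms(1-3) p by presburger
    then have "r < 42" using that p pos assms by (elim disjE) simp_all
    \<comment> \<open>The range of \<open>r\<close> ends at \<open>(3, 7, 42)\<close>, which has curvature zero.\<close>
    have "\<forall>p \<in> {3, 4, 5}. \<forall>q \<in> set [4..<12]. \<forall>r \<in> set [4..<42].
        q \<le> r \<longrightarrow> (p = 3 \<longrightarrow> 7 \<le> q) \<longrightarrow> p * q * r < 2 * (q * r + p * r + p * q) \<longrightarrow> ?P p q r"
      by simp
    moreover have "p \<in> {3, 4, 5}" using p by simp
    moreover have "4 \<le> q" using \<open>q = 4 \<or> _\<close> by linarith
    then have "q \<in> set [4..<12]" "r \<in> set [4..<42]"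
      using q \<open>r < 42\<close> assms(3) by (simp_all only: set_upt atLeastLessThan_iff, simp_all)
    ultimately have "q \<le> r \<longrightarrow> (p = 3 \<longrightarrow> 7 \<le> q) \<longrightarrow> p * q * r < 2 * (q * r + p * r + p * q) \<longrightarrow> ?P p q r"
      by blast
    moreover have "p = 3 \<longrightarrow> 7 \<le> q" using that by linarith
    ultimately show ?thesis using pos assms(3) by blast
  qed
  ultimately show ?thesis by blast
qed

text \<open>
  As for three faces.  Sorted quadruples of positive curvature begin with \<open>3, 3, 3\<close> or \<open>3, 3, 4\<close> or
  \<open>3, 3, 5\<close> or \<open>3, 4, 4\<close>, and the last entry is bounded except after \<open>3, 3, 3\<close>.
\<close>

lemma comb_curvature_four_cases:
  fixes p q r s :: nat
  assumes "3 \<le> p" "p \<le> q" "q \<le> r" "r \<le> s"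
    and pos: "p * q * r * s < q * r * s + p * r * s + p * q * s + p * q * r"
  shows "(q * r * s + p * r * s + p * q * s + p * q * r - p * q * r * s) * (p + q + r + s) * 75 \<ge> 4 * (p * q * r * s)"
    (is "?P p q r s")
proof -
  have le: "r * q \<le> s * q" "q * r \<le> s * r" "p * s \<le> q * s" "p * r \<le> q * r"
    using assms by simp_all
  have p: "p = 3"
  proof (rule ccontr)
    assume "p \<noteq> 3"
    then have "4 * (q * r * s) \<le> p * (q * r * s)" using assms(1) by (intro mult_right_mono) auto
    moreover have "p * r * s \<le> q * r * s" "p * q * s \<le> q * r * s" "p * q * r \<le> q * r * s"
      using assms by (auto intro!: mult_mono simp: mult.commute mult.left_commute)
    ultimately have "q * r * s + p * r * s + p * q * s + p * q * r \<le> p * (q * r * s)" by linarith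
    then show False using pos by (simp add: mult.assoc)
  qed
  have pos': "2 * (q * r * s) < 3 * (r * s) + 3 * (q * s) + 3 * (q * r)"
    using pos unfolding p by (simp add: mult.assoc)
  have q: "q = 3 \<or> q = 4"
  proof (rule ccontr)
    assume "\<not> (q = 3 \<or> q = 4)"
    then have "5 * (r * s) \<le> q * (r * s)" using assms p by (intro mult_right_mono) auto
    moreover have "q * s \<le> r * s" "q * r \<le> r * s"
      using assms by (auto intro!: mult_mono simp: mult.commute mult.left_commute)
    moreover have "0 < r * s" using assms by simp
    ultimately have "3 * (r * s) + 3 * (q * s) + 3 * (q * r) \<le> 2 * (q * (r * s))" by linarith
    then show False using pos' by (simp add: mult.assoc)
  qed
  have r: "r < 6"
  proof (rule ccontr)
    assume "\<not> r < 6"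
    then have "6 * s \<le> r * s" by simp
    with q pos' assms(4) show False by (elim disjE) simp_all
  qed
  have "r = 3 \<or> r = 4 \<or> r = 5" using r assms by linarith
  have "?P p q r s" if "r = 3"
    using that q p assms by (elim disjE) (simp_all add: algebra_simps)
  moreover have "?P p q r s" if "r \<noteq> 3"
  proof -
    have "s < 12" using q \<open>r = 3 \<or> _\<close> that pos' by (elim disjE) simp_all
    have "\<forall>q \<in> {3, 4}. \<forall>r \<in> {4, 5}. \<forall>s \<in> set [4..<12]. r \<le> s \<longrightarrow>
        2 * (q * r * s) < 3 * (r * s) + 3 * (q * s) + 3 * (q * r) \<longrightarrow> ?P 3 q r s"
      by simp
    moreover have "q \<in> {3, 4}" "r \<in> {4, 5}" using q \<open>r = 3 \<or> _\<close> that by auto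
    moreover have "s \<in> set [4..<12]"
      using \<open>r \<in> {4, 5}\<close> \<open>s < 12\<close> assms(4) by (auto simp only: set_upt atLeastLessThan_iff)
    ultimately show ?thesis using pos' assms(4) p by blast
  qed
  ultimately show ?thesis by blast
qed

lemma comb_curvature_five_cases:
  fixes p q r s t :: nat
  assumes o: "3 \<le> p" "p \<le> q" "q \<le> r" "r \<le> s" "s \<le> t"
    and pos: "0 < comb_curvature [p, q, r, s, t]"
  shows "p = 3 \<and> q = 3 \<and> r = 3 \<and> s = 3 \<and> t \<in> {3, 4, 5}"
proof -
  have inv: "1 / real n \<le> 1 / real m" if "m \<le> n" "0 < m" for m n
    using that by (simp add: frac_le)
  have s: "s = 3"
  proof (rule ccontr)
    assume "s \<noteq> 3"
    then have "1 / real p \<le> 1 / 3" "1 / real q \<le> 1 / 3" "1 / real r \<le> 1 / 3" "1 / real s \<le> 1 / 4" "1 / real t \<le> 1 / 4"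
      using o inv[of 3 p] inv[of 3 q] inv[of 3 r] inv[of 4 s] inv[of 4 t] by auto
    with pos show False by simp
  qed
  then have eq: "p = 3" "q = 3" "r = 3" using o by auto
  then have "1 / real t > 1 / 6" using pos s by simp
  then have "t < 6" using o(5) s by (simp add: field_simps)
  then show ?thesis using eq s o(5) by auto
qed

lemma numerator_pos: "0 < x / y \<Longrightarrow> 0 < y \<Longrightarrow> 0 < x" for x y :: real
  by (simp add: zero_less_divide_iff)

lemma comb_curvature_length:
  assumes "\<forall>n \<in> set ds. 3 \<le> n" "0 < comb_curvature ds"
  shows "length ds < 6"
proof -
  have "sum_list (map (\<lambda>n. 1 / real n) ds) \<le> sum_list (map (\<lambda>n. 1 / 3) ds)"
    using assms(1) by (intro sum_list_mono) (auto simp: field_simps)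
  with assms(2) show ?thesis by (simp add: sum_list_triv)
qed

text \<open>
  The factor \<open>1/75\<close> is chosen so that \<open>2 \<pi> / 75\<close> lies just above the area bound to be proved.  The two
  excluded vertex types have the curvatures \<open>1/858\<close> and \<open>1/1722\<close>, too small for this estimate.
\<close>

lemma comb_curvature_cases:
  assumes "sorted ds" "\<forall>n \<in> set ds. 3 \<le> n" "3 \<le> length ds" "0 < comb_curvature ds"
    "ds \<noteq> [3, 11, 13]" "ds \<noteq> [3, 7, 41]"
  shows "comb_curvature ds * real (sum_list ds) \<ge> real (length ds) / 75"
proof -
  have "length ds < 6" using comb_curvature_length assms(2,4) by blast
  then consider "length ds = 3" | "length ds = 4" | "length ds = 5" using assms(3) by linarith
  then show ?thesis
  proof cases
    case 1
    then obtain p q r where ds: "ds = [p, q, r]"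
      by (auto simp: numeral_eq_Suc length_Suc_conv)
    then have o: "3 \<le> p" "p \<le> q" "q \<le> r" using assms by auto
    then have pos: "0 < real p" "0 < real q" "0 < real r" by auto
    let ?K = "2 * (q * r + p * r + p * q)"
    have K: "comb_curvature ds = (real ?K - real (p * q * r)) / (2 * real (p * q * r))"
      using pos by (simp add: ds field_simps)
    have N: "0 < real (p * q * r)" using pos by simp
    have "real (p * q * r) < real ?K" using numerator_pos[OF assms(4)[unfolded K]] N by linarith
    then have lt: "p * q * r < ?K" by linarith
    have "2 * (p * q * r) \<le> (?K - p * q * r) * (p + q + r) * 25"
      using comb_curvature_three_cases[OF o lt] assms(5,6) ds by auto
    then have "real (2 * (p * q * r)) \<le> real ((?K - p * q * r) * (p + q + r) * 25)"
      by (rule of_nat_mono)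
    then have "2 * real (p * q * r) \<le> (real ?K - real (p * q * r)) * real (p + q + r) * 25"
      using lt by (simp only: of_nat_mult of_nat_diff[OF less_imp_le] of_nat_numeral)
    then show ?thesis unfolding K
      using N by (simp add: ds divide_simps add.assoc del: of_nat_mult of_nat_add)
  next
    case 2
    then obtain p q r s where ds: "ds = [p, q, r, s]"
      by (auto simp: numeral_eq_Suc length_Suc_conv)
    then have o: "3 \<le> p" "p \<le> q" "q \<le> r" "r \<le> s" using assms by auto
    then have pos: "0 < real p" "0 < real q" "0 < real r" "0 < real s" by auto
    let ?K = "q * r * s + p * r * s + p * q * s + p * q * r" and ?N = "p * q * r * s"
    have K: "comb_curvature ds = (real ?K - real ?N) / real ?N"
      using pos by (simp add: ds field_simps)
    have N: "0 < real ?N" using pos by simp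
    have "real ?N < real ?K" using numerator_pos[OF assms(4)[unfolded K]] N by linarith
    then have lt: "?N < ?K" by linarith
    have "4 * ?N \<le> (?K - ?N) * (p + q + r + s) * 75"
      using comb_curvature_four_cases[OF o lt] by simp
    then have "real (4 * ?N) \<le> real ((?K - ?N) * (p + q + r + s) * 75)"
      by (rule of_nat_mono)
    then have "4 * real ?N \<le> (real ?K - real ?N) * real (p + q + r + s) * 75"
      using lt by (simp only: of_nat_mult of_nat_diff[OF less_imp_le] of_nat_numeral)
    then show ?thesis unfolding K
      using N by (simp add: ds divide_simps add.assoc del: of_nat_mult of_nat_add)
  next
    case 3
    then obtain p q r s t where ds: "ds = [p, q, r, s, t]"
      by (auto simp: numeral_eq_Suc length_Suc_conv)
    then have "p = 3 \<and> q = 3 \<and> r = 3 \<and> s = 3 \<and> t \<in> {3, 4, 5}"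
      using assms by (intro comb_curvature_five_cases) auto
    then show ?thesis by (auto simp: ds)
  qed
qed

section \<open>Numerical bounds\<close>

lemma sin_taylor:
  fixes x :: real
  assumes "0 \<le> x"
  defines "p \<equiv> x - x^3/6 + x^5/120 - x^7/5040 + x^9/362880"
  shows "p - x^11 / 39916800 \<le> sin x" "sin x \<le> p + x^11 / 39916800"
proof -
  have s: "sum f {..<11} = f 0 + f 1 + f 2 + f 3 + f 4 + f 5 + f 6 + f 7 + f 8 + f 9 + f 10"
    for f :: "nat \<Rightarrow> real"
    by (simp add: eval_nat_numeral)
  have "(\<Sum>m<11. sin_coeff m * x ^ m) = p"
    unfolding s p_def by (simp add: sin_coeff_def fact_numeral)
  moreover have "fact 11 = (39916800::real)" by (simp add: fact_numeral)
  ultimately have "\<bar>sin x - p\<bar> \<le> x^11 / 39916800"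
    using Maclaurin_sin_bound[of x 11] assms(1) by (simp add: field_simps)
  then show "p - x^11 / 39916800 \<le> sin x" "sin x \<le> p + x^11 / 39916800"
    unfolding abs_le_iff by linarith+
qed

lemma cos_taylor:
  fixes x :: real
  defines "p \<equiv> 1 - x^2/2 + x^4/24 - x^6/720 + x^8/40320"
  shows "p - x^10 / 3628800 \<le> cos x" "cos x \<le> p + x^10 / 3628800"
proof -
  have s: "sum f {..<10} = f 0 + f 1 + f 2 + f 3 + f 4 + f 5 + f 6 + f 7 + f 8 + f 9"
    for f :: "nat \<Rightarrow> real"
    by (simp add: eval_nat_numeral)
  have p: "(\<Sum>m<10. cos_coeff m * x ^ m) = p"
    unfolding s p_def by (simp add: cos_coeff_def fact_numeral)
  have f: "fact 10 = (3628800::real)" by (simp add: fact_numeral)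
  obtain t where "cos x = (\<Sum>m<10. cos_coeff m * x ^ m)
      + (cos (t + 1/2 * real 10 * pi) / fact 10) * x ^ 10"
    using Maclaurin_cos_expansion[of x 10] by auto
  then obtain y where y: "cos x - p = cos y * (x ^ 10 / 3628800)"
    unfolding p f by (metis add_diff_cancel_left' times_divide_eq_left times_divide_eq_right)
  have "\<bar>cos x - p\<bar> \<le> 1 * (x ^ 10 / 3628800)"
    unfolding y abs_mult by (intro mult_mono) auto
  then show "p - x^10 / 3628800 \<le> cos x" "cos x \<le> p + x^10 / 3628800"
    unfolding abs_le_iff by linarith+
qed

lemmas sin_gt_taylor = less_le_trans[OF _ sin_taylor(1)]
lemmas sin_lt_taylor = le_less_trans[OF sin_taylor(2)]
lemmas cos_gt_taylor = less_le_trans[OF _ cos_taylor(1)]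
lemmas cos_lt_taylor = le_less_trans[OF cos_taylor(2)]

text \<open>
  The value \<open>sin (\<pi>/6) = 1/2\<close> separates \<open>\<pi>\<close> from a decimal approximation as soon as the sine of a sixth
  of the approximation is known precisely enough.
\<close>

lemma pi_gt_approx: "3.14159265 < pi"
proof (rule ccontr)
  assume "\<not> 3.14159265 < pi"
  then have "sin (pi / 6) \<le> sin 0.523598775" using pi_ge_two by (intro sin_monotone_2pi_le) auto
  moreover have "sin (0.523598775 :: real) < 1 / 2"
    by (rule sin_lt_taylor) (simp_all add: power_divide)
  ultimately show False by (simp add: sin_30)
qed

lemma pi_lt_approx: "pi < 3.14159266"
proof (rule ccontr)
  assume "\<not> pi < 3.14159266"
  then have "sin (3.14159266 / 6) \<le> sin (pi / 6)" using pi_ge_two by (intro sin_monotone_2pi_le) auto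
  moreover have "1 / 2 < sin (3.14159266 / 6 :: real)"
    by (rule sin_gt_taylor) (simp_all add: power_divide)
  ultimately show False by (simp add: sin_30)
qed

text \<open>
  Tangents at \<open>\<pi>/n\<close> are estimated at a nearby decimal \<open>x\<close>, where Taylor bounds for sine and cosine are
  rational numbers.
\<close>

lemma tan_gt:
  assumes "0 < x" "x < pi / 2" "t * cos x < sin x"
  shows "t < tan x"
proof -
  have "0 < cos x" using assms by (intro cos_gt_zero) auto
  then show ?thesis using assms(3) by (simp add: tan_def field_simps)
qed

lemma tan_lt:
  assumes "0 < x" "x < pi / 2" "sin x < t * cos x"
  shows "tan x < t"
proof -
  have "0 < cos x" using assms by (intro cos_gt_zero) auto
  then show ?thesis using assms(3) by (simp add: tan_def field_simps)
qed

lemma tan_pi_11_gt: "0.2936263 < tan (pi / 11)"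
proof -
  have s: "0.28173252599 < sin (0.2855993 :: real)"
    by (rule sin_gt_taylor) (simp_all add: power_divide)
  have c: "cos (0.2855993 :: real) < 0.95949298268"
    by (rule cos_lt_taylor) (simp_all add: power_divide)
  have "0.2936263 < tan (0.2855993 :: real)"
    using pi_gt_approx s c by (intro tan_gt) (linarith | simp)+
  also have "tan (0.2855993 :: real) \<le> tan (pi / 11)"
    using pi_gt_approx by (intro tan_mono_le) (linarith | simp)+
  finally show ?thesis .
qed

lemma tan_pi_11_lt: "tan (pi / 11) < 0.2936266"
proof -
  have s: "sin (0.28559934 :: real) < 0.28173256438"
    by (rule sin_lt_taylor) (simp_all add: power_divide)
  have c: "0.95949297140 < cos (0.28559934 :: real)"
    by (rule cos_gt_taylor) (simp_all add: power_divide)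
  have "tan (0.28559934 :: real) < 0.2936266"
    using pi_gt_approx s c by (intro tan_lt) (linarith | simp)+
  moreover have "tan (pi / 11) \<le> tan (0.28559934 :: real)"
    using pi_lt_approx pi_gt_approx by (intro tan_mono_le) (linarith | simp)+
  ultimately show ?thesis by simp
qed

lemma tan_pi_13_lt: "tan (pi / 13) < 0.24647793"
proof -
  have s: "sin (0.24166098 :: real) < 0.23931567075"
    by (rule sin_lt_taylor) (simp_all add: power_divide)
  have c: "0.97094181583 < cos (0.24166098 :: real)"
    by (rule cos_gt_taylor) (simp_all add: power_divide)
  have "tan (0.24166098 :: real) < 0.24647793"
    using pi_gt_approx s c by (intro tan_lt) (linarith | simp)+
  moreover have "tan (pi / 13) \<le> tan (0.24166098 :: real)"
    using pi_lt_approx pi_gt_approx by (intro tan_mono_le) (linarith | simp)+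
  ultimately show ?thesis by simp
qed

lemma tan_pi_13_gt: "0.2464 < tan (pi / 13)"
proof -
  have s: "0.23931471921 < sin (0.24166 :: real)"
    by (rule sin_gt_taylor) (simp_all add: power_divide)
  have c: "cos (0.24166 :: real) < 0.97094205037"
    by (rule cos_lt_taylor) (simp_all add: power_divide)
  have "0.2464 < tan (0.24166 :: real)"
    using pi_gt_approx s c by (intro tan_gt) (linarith | simp)+
  also have "tan (0.24166 :: real) \<le> tan (pi / 13)"
    using pi_gt_approx by (intro tan_mono_le) (linarith | simp)+
  finally show ?thesis .
qed

lemma tan_pi_7_gt: "0.48 < tan (pi / 7)"
proof -
  have s: "0.4337 < sin (0.4487 :: real)"
    by (rule sin_gt_taylor) (simp_all add: power_divide)
  have c: "cos (0.4487 :: real) < 0.9012"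
    by (rule cos_lt_taylor) (simp_all add: power_divide)
  have "0.48 < tan (0.4487 :: real)"
    using pi_gt_approx s c by (intro tan_gt) (linarith | simp)+
  also have "tan (0.4487 :: real) \<le> tan (pi / 7)"
    using pi_gt_approx by (intro tan_mono_le) (linarith | simp)+
  finally show ?thesis .
qed

lemma tan_pi_41_lt: "tan (pi / 41) < 0.077"
proof -
  have s: "sin (0.07663 :: real) < 0.0766"
    by (rule sin_lt_taylor) (simp_all add: power_divide)
  have c: "0.997 < cos (0.07663 :: real)"
    by (rule cos_gt_taylor) (simp_all add: power_divide)
  have "tan (0.07663 :: real) < 0.077"
    using pi_gt_approx s c by (intro tan_lt) (linarith | simp)+
  moreover have "tan (pi / 41) \<le> tan (0.07663 :: real)"
    using pi_lt_approx pi_gt_approx by (intro tan_mono_le) (linarith | simp)+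
  ultimately show ?thesis by simp
qed

section \<open>The two vertex types of smallest curvature\<close>

lemma sqrt_3_bounds: "1.7320508 < sqrt 3" "sqrt 3 < 1.7320509"
  by (rule real_less_rsqrt, simp add: power2_eq_square)
    (rule real_less_lsqrt, simp_all add: power2_eq_square)

lemma hemisphere_side_antimono: "a \<le> 2 * pi / real n \<Longrightarrow> m \<le> n \<Longrightarrow> 0 < m \<Longrightarrow> a \<le> 2 * pi / real m"
  by (erule order_trans) (simp add: frac_le)

text \<open>
  The three excesses at a vertex of type \<open>(3, 11, 13)\<close> add up to at most \<open>2 \<pi> / 858\<close>.  The constant
  \<open>1.00045403\<close> is the value of \<open>1 / cos (a/2)\<close> at which they reach this sum, rounded up.  If
  \<open>1 / cos (a/2)\<close> were larger, each half-excess would exceed its value at the constant; the decimals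
  \<open>l\<close> used below are these values rounded down, and they already add up to more than \<open>\<pi> / 858\<close>.
\<close>

lemma sec_half_side_le_of_3_11_13:
  assumes a: "0 \<le> a" "a \<le> 2 * pi / real 13"
    and angles: "polygon_angle 3 a + polygon_angle 11 a + polygon_angle 13 a \<le> 2 * pi"
  shows "1 / cos (a / 2) \<le> 1.00045403"
proof (rule ccontr)
  assume "\<not> 1 / cos (a / 2) \<le> 1.00045403"
  then have n: "1.00045403 < 1 / cos (a / 2)" by simp
  note a' = hemisphere_side_antimono[OF a(2)]
  have *: "2 * l < corner_excess n a"
    if "3 \<le> n" "n \<le> 13" "0 \<le> l" "l < 0.01" "0 \<le> t" "tan (pi / real n) \<le> t" "cos l < c" "c + t * l \<le> 1.00045403" for n l t c
  proof (rule corner_excess_gt)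
    have "3 / 13 \<le> pi / real n" using that pi_gt_approx by (intro frac_le) auto
    then show "l \<le> pi / real n" using that by simp
    have "0 \<le> sin l" using that pi_gt_approx by (intro sin_ge_zero) auto
    then have "tan (pi / real n) * sin l \<le> t * l"
      using that sin_x_le_x[of l] by (intro order_trans[OF mult_right_mono mult_left_mono]) auto
    then show "cos l + tan (pi / real n) * sin l < 1 / cos (a / 2)" using that n by linarith
  qed (use that a a'[of n] in auto)
  have c: "cos (0.000262153 :: real) < 0.99999996563791"
    by (rule cos_lt_taylor) (simp_all add: power_divide)
  have l3: "2 * 0.000262153 < corner_excess 3 a"
    by (rule *[where t = "1.7320509" and n = 3, OF _ _ _ _ _ _ c]) (use sqrt_3_bounds in \<open>simp_all add: tan_60\<close>)
  have c: "cos (0.001550376 :: real) < 0.99999879816738"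
    by (rule cos_lt_taylor) (simp_all add: power_divide)
  have l11: "2 * 0.001550376 < corner_excess 11 a"
    by (rule *[where t = "0.2936266" and n = 11, OF _ _ _ _ _ _ c]) (use tan_pi_11_lt in \<open>simp_all\<close>)
  have c: "cos (0.001849006 :: real) < 0.99999829058890"
    by (rule cos_lt_taylor) (simp_all add: power_divide)
  have l13: "2 * 0.001849006 < corner_excess 13 a"
    by (rule *[where t = "0.24647793" and n = 13, OF _ _ _ _ _ _ c]) (use tan_pi_13_lt in \<open>simp_all\<close>)
  have "corner_excess 3 a + corner_excess 11 a + corner_excess 13 a \<le> 2 * pi / 858"
    using angles by (simp add: corner_excess_def)
  with l3 l11 l13 pi_lt_approx show False by simp
qed

text \<open>
  The decimals are the half-excesses belonging to \<open>1 / cos (a/2) = 1.00045403\<close>, rounded up.  Those of the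
  triangle and the 11-gon have to be sharp; the other two serve only for the coarser upper bound.
\<close>

lemma corner_excess_le_of_sec:
  assumes a: "0 \<le> a" "a \<le> 2 * pi / real 13" and sec: "1 / cos (a / 2) \<le> 1.00045403"
  shows "corner_excess 3 a \<le> 2 * 0.000262156" "corner_excess 4 a \<le> 2 * 0.000455"
    "corner_excess 11 a \<le> 2 * 0.001550381" "corner_excess 13 a \<le> 2 * 0.00186"
proof -
  note a' = hemisphere_side_antimono[OF a(2)]
  have *: "corner_excess n a \<le> 2 * r"
    if "3 \<le> n" "n \<le> 13" "0 \<le> r" "0 \<le> t" "t \<le> tan (pi / real n)" "s < sin r" "c < cos r" "0 \<le> s"
      "1.00045403 \<le> c + t * s" for n r t s c
  proof (rule corner_excess_le)
    have "t * s \<le> tan (pi / real n) * sin r" using that by (intro mult_mono) auto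
    then show "1 / cos (a / 2) \<le> cos r + tan (pi / real n) * sin r" using that sec by linarith
  qed (use that a a'[of n] in auto)
  have s: "0.00026215599699 < sin (0.000262156 :: real)"
    by (rule sin_gt_taylor) (simp_all add: power_divide)
  have c: "0.99999996563711 < cos (0.000262156 :: real)"
    by (rule cos_gt_taylor) (simp_all add: power_divide)
  show "corner_excess 3 a \<le> 2 * 0.000262156"
    by (rule *[where t = "1.7320508" and n = 3, OF _ _ _ _ _ s c]) (use sqrt_3_bounds(1) in \<open>simp_all add: tan_60\<close>)
  have s: "0.00045499998430 < sin (0.000455 :: real)"
    by (rule sin_gt_taylor) (simp_all add: power_divide)
  have c: "0.99999989648750 < cos (0.000455 :: real)"
    by (rule cos_gt_taylor) (simp_all add: power_divide)
  show "corner_excess 4 a \<le> 2 * 0.000455"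
    by (rule *[where t = "1" and n = 4, OF _ _ _ _ _ s c]) (simp_all add: tan_45)
  have s: "0.00155038037889 < sin (0.001550381 :: real)"
    by (rule sin_gt_taylor) (simp_all add: power_divide)
  have c: "0.99999879815961 < cos (0.001550381 :: real)"
    by (rule cos_gt_taylor) (simp_all add: power_divide)
  show "corner_excess 11 a \<le> 2 * 0.001550381"
    by (rule *[where t = "0.2936263" and n = 11, OF _ _ _ _ _ s c]) (use tan_pi_11_gt in \<open>simp_all\<close>)
  have s: "0.00185999892752 < sin (0.00186 :: real)"
    by (rule sin_gt_taylor) (simp_all add: power_divide)
  have c: "0.99999827020049 < cos (0.00186 :: real)"
    by (rule cos_gt_taylor) (simp_all add: power_divide)
  show "corner_excess 13 a \<le> 2 * 0.00186"
    by (rule *[where t = "0.2464" and n = 13, OF _ _ _ _ _ s c]) (use tan_pi_13_gt in \<open>simp_all\<close>)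
qed

text \<open>
  Given the sum of the three excesses, the area is \<open>13\<close> times this sum minus \<open>10\<close> times the excess of
  the triangle and twice that of the 11-gon.  The true value is about \<open>0.0837552\<close>: this vertex type
  determines the lower bound.
\<close>

lemma area_3_11_13:
  assumes a: "0 \<le> a" "a \<le> 2 * pi / real 13"
    and angles: "polygon_angle 3 a + polygon_angle 11 a + polygon_angle 13 a = 2 * pi"
  shows "8.3755 / 10 ^ 2 \<le> polygon_area 3 a + polygon_area 11 a + polygon_area 13 a"
proof -
  have "corner_excess 3 a + corner_excess 11 a + corner_excess 13 a = 2 * pi / 858"
    using angles by (simp add: corner_excess_def)
  moreover note corner_excess_le_of_sec[OF a sec_half_side_le_of_3_11_13[OF a eq_refl[OF angles]]]
  ultimately show ?thesis
    using pi_gt_approx by (simp add: polygon_area_eq_corner_excess)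
qed

text \<open>
  Chebyshev's inequality alone would give about \<open>0.062\<close> here.  The 41-gon takes most of the excess,
  because \<open>tan (\<pi>/7) \<ge> 4 tan (\<pi>/41)\<close> makes its excess at least four times that of the heptagon.
\<close>

lemma area_3_7_41:
  assumes a: "0 \<le> a" "a \<le> 2 * pi / real 41"
    and angles: "polygon_angle 3 a + polygon_angle 7 a + polygon_angle 41 a = 2 * pi"
  shows "8.3755 / 10 ^ 2 \<le> polygon_area 3 a + polygon_area 7 a + polygon_area 41 a"
proof -
  note a' = hemisphere_side_antimono[OF a(2)]
  have sum: "corner_excess 3 a + corner_excess 7 a + corner_excess 41 a = 2 * pi / 1722"
    using angles by (simp add: corner_excess_def)
  have le: "corner_excess 3 a \<le> corner_excess 7 a"
    using a a'[of 7] by (intro corner_excess_mono) auto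
  have nn: "0 \<le> corner_excess 3 a" using a a'[of 3] by (intro corner_excess_nonneg) auto
  have quarter: "corner_excess 7 a \<le> corner_excess 41 a / 4"
  proof -
    define y where "y = corner_excess 41 a / 8"
    have y: "0 \<le> y" "2 * y \<le> 2 * pi / 1722 / 4"
      using corner_excess_nonneg[of 41 a] a sum le nn by (auto simp: y_def)
    have "1 / cos (a / 2) = cos (4 * y) + tan (pi / real 41) * sin (4 * y)"
      using corner_excess_cos(3)[of 41 a] a by (simp add: y_def)
    also have "\<dots> \<le> cos y + tan (pi / real 7) * sin y"
    proof (rule add_mono)
      show "cos (4 * y) \<le> cos y" using y pi_gt_zero by (intro cos_monotone_0_pi_le) auto
      have "sin (4 * y) = 2 * sin (2 * y) * cos (2 * y)" using sin_double[of "2 * y"] by simp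
      also have "\<dots> = 4 * sin y * cos y * cos (2 * y)" by (simp add: sin_double)
      also have "\<dots> \<le> 4 * sin y * 1 * 1"
        using y pi_gt_zero
        by (intro mult_mono' mult_nonneg_nonneg sin_ge_zero cos_ge_zero cos_le_one order_refl) auto
      finally have "sin (4 * y) \<le> 4 * sin y" by simp
      then have "tan (pi / real 41) * sin (4 * y) \<le> tan (pi / real 41) * (4 * sin y)"
        using pi_gt_zero by (intro mult_left_mono tan_pos_pi2_le) auto
      also have "\<dots> = (4 * tan (pi / real 41)) * sin y" by simp
      also have "\<dots> \<le> tan (pi / real 7) * sin y"
        using tan_pi_7_gt tan_pi_41_lt y pi_gt_zero by (intro mult_right_mono sin_ge_zero) auto
      finally show "tan (pi / real 41) * sin (4 * y) \<le> tan (pi / real 7) * sin y" .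
    qed
    finally show ?thesis using corner_excess_le[of 7 a y] a a'[of 7] y(1) by (simp add: y_def)
  qed
  show ?thesis
    using sum le nn quarter pi_gt_approx by (simp add: polygon_area_eq_corner_excess)
qed

section \<open>The lower bound\<close>

text \<open>
  Area around a vertex of total angle \<open>2 \<pi>\<close>.  If the side is as long as possible for one of the faces,
  that face is a hemisphere.  Otherwise every angle is below \<open>\<pi>\<close>, hence there are at least three faces,
  and Chebyshev's inequality applies because larger polygons have larger excesses.
\<close>

lemma vertex_area_lower_bound_list:
  fixes ds :: "nat list"
  assumes ds: "sorted ds" "\<forall>n \<in> set ds. 3 \<le> n" and a: "0 < a" "\<forall>n \<in> set ds. a \<le> 2 * pi / real n"
    and angles: "sum_list (map (\<lambda>n. polygon_angle n a) ds) = 2 * pi"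
  shows "8.3755 / 10 ^ 2 \<le> sum_list (map (\<lambda>n. polygon_area n a) ds)"
proof (cases "\<exists>n \<in> set ds. a = 2 * pi / real n")
  case True
  then obtain n where n: "n \<in> set ds" "a = 2 * pi / real n" by blast
  have "2 * pi = polygon_area n a" using ds n by (simp add: polygon_area_hemisphere)
  also have "\<dots> \<le> sum_list (map (\<lambda>n. polygon_area n a) ds)"
    using n ds a by (intro member_le_sum_list) (auto intro!: polygon_area_nonneg)
  finally show ?thesis using pi_gt_approx by simp
next
  case False
  have small: "polygon_angle n a < pi" if "n \<in> set ds" for n
    using that False ds a by (intro polygon_angle_less_pi) (auto simp: order_less_le)
  have len: "3 \<le> length ds"
  proof (rule ccontr)
    assume "\<not> 3 \<le> length ds"
    have "ds \<noteq> []" using angles by auto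
    then have "sum_list (map (\<lambda>n. polygon_angle n a) ds) < sum_list (map (\<lambda>n. pi) ds)"
      using small by (intro sum_list_strict_mono) auto
    also have "\<dots> \<le> 2 * pi" using \<open>\<not> 3 \<le> length ds\<close> by (simp add: sum_list_triv)
    finally show False using angles by simp
  qed
  let ?s = "\<lambda>n. corner_excess n a"
  have excess: "sum_list (map ?s ds) = 2 * pi * comb_curvature ds"
    unfolding sum_list_corner_excess angles by (simp add: algebra_simps)
  have "0 < sum_list (map ?s ds)"
    using len ds a by (cases ds) (auto intro!: add_pos_nonneg sum_list_nonneg corner_excess_pos corner_excess_nonneg)
  then have pos: "0 < comb_curvature ds" unfolding excess by (simp add: zero_less_mult_iff)
  consider "ds = [3, 11, 13]" | "ds = [3, 7, 41]" | "ds \<noteq> [3, 11, 13]" "ds \<noteq> [3, 7, 41]" by blast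
  then show ?thesis
  proof cases
    case 1
    then show ?thesis using area_3_11_13[of a] a angles by simp
  next
    case 2
    then show ?thesis using area_3_7_41[of a] a angles by simp
  next
    case 3
    have "real (length ds) * (2 * pi / 75) = 2 * pi * (real (length ds) / 75)" by simp
    also have "\<dots> \<le> 2 * pi * (comb_curvature ds * real (sum_list ds))"
      using comb_curvature_cases[OF ds len pos 3] by (intro mult_left_mono) auto
    also have "\<dots> = sum_list (map real ds) * sum_list (map ?s ds)"
    proof -
      have "real (sum_list ds) = sum_list (map real ds)" by (induction ds) auto
      then show ?thesis unfolding excess by simp
    qed
    also have "\<dots> \<le> real (length ds) * sum_list (map (\<lambda>n. real n * ?s n) ds)"
    proof (rule Chebyshev_sum_list)
      fix m n assume mn: "m \<in> set ds" "n \<in> set ds"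
      show "0 \<le> (real m - real n) * (?s m - ?s n)"
      proof (cases "m \<le> n")
        case True
        then have "?s m \<le> ?s n" using mn ds a by (intro corner_excess_mono) auto
        with True show ?thesis by (intro mult_nonpos_nonpos) auto
      next
        case False
        then have "?s n \<le> ?s m" using mn ds a by (intro corner_excess_mono) auto
        with False show ?thesis by (intro mult_nonneg_nonneg) auto
      qed
    qed
    also have "sum_list (map (\<lambda>n. real n * ?s n) ds) = sum_list (map (\<lambda>n. polygon_area n a) ds)"
      using ds by (intro arg_cong[where f = sum_list] map_cong) (auto intro!: polygon_area_eq_corner_excess[symmetric])
    finally have "2 * pi / 75 \<le> sum_list (map (\<lambda>n. polygon_area n a) ds)"
      using len by (subst (asm) mult_le_cancel_left_pos) auto
    then show ?thesis using pi_gt_approx by simp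
  qed
qed

lemma vertex_area_lower_bound:
  fixes d :: "'a \<Rightarrow> nat"
  assumes "finite I" "\<forall>i \<in> I. 3 \<le> d i" "0 < a" "\<forall>i \<in> I. a \<le> 2 * pi / real (d i)"
    and "(\<Sum>i \<in> I. polygon_angle (d i) a) = 2 * pi"
  shows "8.3755 / 10 ^ 2 \<le> (\<Sum>i \<in> I. polygon_area (d i) a)"
proof -
  obtain xs where xs: "set xs = I" "distinct xs" using finite_distinct_list[OF assms(1)] by blast
  let ?ds = "sort (map d xs)"
  have *: "sum_list (map f ?ds) = (\<Sum>i \<in> I. f (d i))" for f :: "nat \<Rightarrow> real"
  proof -
    have "sum_list (map f ?ds) = sum_mset (mset (map f ?ds))" by (simp only: sum_mset_sum_list)
    also have "\<dots> = sum_mset (mset (map (\<lambda>i. f (d i)) xs))" by (simp add: image_mset.compositionality comp_def)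
    also have "\<dots> = sum_list (map (\<lambda>i. f (d i)) xs)" by (simp only: sum_mset_sum_list)
    also have "\<dots> = (\<Sum>i \<in> I. f (d i))" using xs by (simp add: sum_list_distinct_conv_sum_set)
    finally show ?thesis .
  qed
  show ?thesis
    using vertex_area_lower_bound_list[of ?ds a] assms unfolding * by (simp add: xs)
qed


text \<open>
  Finiteness of the vertex set makes the edges finite, since an edge is determined by its two ends, and
  then the faces, since every face has an edge and an edge lies on two faces.
\<close>

lemma tessellation_incidences:
  assumes G: "tessellation M G" "M \<noteq> {}" and fin: "finite (verts G)"
  shows "finite (edges G)" "finite (faces G)" "verts G \<noteq> {}"
    "\<And>x. x \<in> verts G \<Longrightarrow> faces_at G x \<noteq> {}"
    "\<And>\<sigma>. \<sigma> \<in> faces G \<Longrightarrow> \<exists>x \<in> verts G. \<sigma> \<in> faces_at G x"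
    "\<And>\<sigma>. \<sigma> \<in> faces G \<Longrightarrow> 3 \<le> fdeg G \<sigma>"
proof -
  note t = G(1)[unfolded tessellation_def]
  have simple: "simple_graph_on M G" using t by (elim conjE)
  have comp: "faces G = components (M - (verts G \<union> \<Union>(edges G)))" using t by (elim conjE)
  have "\<forall>e \<in> edges G. card {\<sigma> \<in> faces G. e \<subseteq> closure \<sigma>} = 2" using t by (elim conjE)
  then have two: "card {\<sigma> \<in> faces G. e \<subseteq> closure \<sigma>} = 2" if "e \<in> edges G" for e using that by (rule bspec)
  have "\<forall>x \<in> verts G. 3 \<le> vdeg G x" using t by (elim conjE)
  then have vdeg: "3 \<le> vdeg G x" if "x \<in> verts G" for x using that by (rule bspec)
  have inj: "inj_on (\<lambda>e. e \<inter> verts G) (edges G)" using simple by (simp add: simple_graph_on_def)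
  have ends: "e \<inter> verts G \<noteq> {}" if e: "e \<in> edges G" for e
  proof -
    have "\<exists>g. arc g \<and> path_image g = e \<and> e \<inter> verts G = {pathstart g, pathfinish g}"
      using simple e by (simp add: simple_graph_on_def)
    then show ?thesis by auto
  qed
  have "\<forall>\<sigma> \<in> faces G. 3 \<le> fdeg G \<sigma>" using t by (elim conjE)
  then show fdeg: "3 \<le> fdeg G \<sigma>" if "\<sigma> \<in> faces G" for \<sigma> using that by (rule bspec)
  have "finite ((\<lambda>e. e \<inter> verts G) ` edges G)"
    by (rule finite_subset[of _ "Pow (verts G)"]) (use fin in auto)
  then show finE: "finite (edges G)" using inj by (rule finite_imageD)
  have edge: "\<exists>e \<in> edges G. e \<subseteq> closure \<sigma>" if "\<sigma> \<in> faces G" for \<sigma>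
  proof -
    have "card {e \<in> edges G. e \<subseteq> closure \<sigma>} \<noteq> 0" using fdeg[OF that] by (simp add: fdeg_def)
    then have "{e \<in> edges G. e \<subseteq> closure \<sigma>} \<noteq> {}" by (metis card.empty)
    then show ?thesis by blast
  qed
  have "faces G \<subseteq> (\<Union>e \<in> edges G. {\<sigma> \<in> faces G. e \<subseteq> closure \<sigma>})" using edge by blast
  moreover have "finite {\<sigma> \<in> faces G. e \<subseteq> closure \<sigma>}" if "e \<in> edges G" for e
    using two[OF that] by (metis card.infinite zero_neq_numeral)
  ultimately show finF: "finite (faces G)" using finE by (meson finite_UN finite_subset)
  show "faces_at G x \<noteq> {}" if x: "x \<in> verts G" for x
  proof -
    have "{y \<in> verts G. y \<noteq> x \<and> (\<exists>e \<in> edges G. e \<inter> verts G = {x, y})} \<noteq> {}"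
      using vdeg[OF x] unfolding vdeg_def by (metis card.empty not_numeral_le_zero)
    then obtain e where e: "e \<in> edges G" "x \<in> e" by blast
    have "{\<sigma> \<in> faces G. e \<subseteq> closure \<sigma>} \<noteq> {}" using two[OF e(1)] by (metis card.empty zero_neq_numeral)
    then show ?thesis using e(2) unfolding faces_at_def by blast
  qed
  show *: "\<exists>x \<in> verts G. \<sigma> \<in> faces_at G x" if s: "\<sigma> \<in> faces G" for \<sigma>
    using edge[OF s] ends s unfolding faces_at_def by blast
  \<comment> \<open>Without vertices there are no edges, so some component of the surface is a face of degree zero.\<close>
  show "verts G \<noteq> {}"
  proof
    assume "verts G = {}"
    then have "edges G = {}" using ends by auto
    then have "faces G = components M" using comp \<open>verts G = {}\<close> by simp
    then have "faces G \<noteq> {}" using G(2) by simp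
    then show False using * \<open>verts G = {}\<close> by blast
  qed
qed

lemma Greatest_compact:
  fixes S :: "real set"
  assumes "compact S" "S \<noteq> {}"
  shows "(GREATEST a. a \<in> S) \<in> S" "\<And>b. b \<in> S \<Longrightarrow> b \<le> (GREATEST a. a \<in> S)"
proof -
  obtain s where "s \<in> S" "\<forall>t \<in> S. t \<le> s" using compact_attains_sup[OF assms] by blast
  then have "(GREATEST a. a \<in> S) = s" by (intro Greatest_equality) auto
  with \<open>s \<in> S\<close> \<open>\<forall>t \<in> S. t \<le> s\<close>
  show "(GREATEST a. a \<in> S) \<in> S" "\<And>b. b \<in> S \<Longrightarrow> b \<le> (GREATEST a. a \<in> S)" by auto
qed

text \<open>
  The last conclusion is why critical sides are useful: a side that is neither maximal for an incident
  face nor has zero angle defect could be lengthened a little.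
\<close>

lemma a_crit_at_properties:
  assumes fin: "finite (faces_at G x)" "faces_at G x \<noteq> {}"
    and deg: "\<And>\<sigma>. \<sigma> \<in> faces_at G x \<Longrightarrow> 3 \<le> fdeg G \<sigma>"
    and b: "0 \<le> b" "\<And>\<sigma>. \<sigma> \<in> faces_at G x \<Longrightarrow> b \<le> 2 * pi / real (fdeg G \<sigma>)" "angle_defect G b x \<ge> 0"
  shows "b \<le> a_crit_at G x" "\<And>\<sigma>. \<sigma> \<in> faces_at G x \<Longrightarrow> a_crit_at G x \<le> 2 * pi / real (fdeg G \<sigma>)"
    "0 \<le> angle_defect G (a_crit_at G x) x"
    "angle_defect G (a_crit_at G x) x = 0 \<or> (\<exists>\<sigma> \<in> faces_at G x. a_crit_at G x = 2 * pi / real (fdeg G \<sigma>))"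
proof -
  let ?D = "fdeg G ` faces_at G x"
  let ?m = "2 * pi / real (Max ?D)"
  define S where "S = {a \<in> {0 .. ?m}. angle_defect G a x \<in> {0..}}"
  have Max: "Max ?D \<in> ?D" using fin by (intro Max_in) auto
  then have m: "\<exists>\<sigma> \<in> faces_at G x. ?m = 2 * pi / real (fdeg G \<sigma>)" by auto
  have le: "?m \<le> 2 * pi / real (fdeg G \<sigma>)" if "\<sigma> \<in> faces_at G x" for \<sigma>
  proof -
    have "fdeg G \<sigma> \<le> Max ?D" using fin(1) that by (intro Max_ge) auto
    then show ?thesis using deg[OF that] by (intro divide_left_mono) auto
  qed
  have cont: "continuous_on {0 .. ?m} (\<lambda>a. angle_defect G a x)"
    unfolding angle_defect_def total_angle_def
    by (intro continuous_intros continuous_on_subset[OF continuous_on_polygon_angle] deg) (auto dest: le)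
  have S_eq: "S = {0 .. ?m} \<inter> (\<lambda>a. angle_defect G a x) -` {0..}" by (auto simp: S_def)
  have "closed S" unfolding S_eq using cont by (rule continuous_closed_preimage) auto
  moreover have "bounded S" by (rule bounded_subset[of "{0 .. ?m}"]) (auto simp: S_def)
  ultimately have comp: "compact S" by (simp add: compact_eq_bounded_closed)
  have "b \<in> S" using b m by (auto simp: S_def)
  then have ne: "S \<noteq> {}" by blast
  have crit: "a_crit_at G x = (GREATEST a. a \<in> S)" by (simp add: a_crit_at_def S_def)
  note g = Greatest_compact[OF comp ne, folded crit]
  show "b \<le> a_crit_at G x" using g(2) \<open>b \<in> S\<close> .
  show "a_crit_at G x \<le> 2 * pi / real (fdeg G \<sigma>)" if "\<sigma> \<in> faces_at G x" for \<sigma>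
    using g(1) le[OF that] by (simp add: S_def)
  show "0 \<le> angle_defect G (a_crit_at G x) x" using g(1) by (simp add: S_def)
  show "angle_defect G (a_crit_at G x) x = 0 \<or> (\<exists>\<sigma> \<in> faces_at G x. a_crit_at G x = 2 * pi / real (fdeg G \<sigma>))"
  proof (rule ccontr)
    assume n: "\<not> ?thesis"
    let ?a = "a_crit_at G x"
    have "?a \<noteq> ?m" using n m by metis
    then have a: "0 \<le> ?a" "?a < ?m" "0 < angle_defect G ?a x" using g(1) n by (auto simp: S_def)
    show False
    proof (cases "angle_defect G ?m x \<ge> 0")
      case True
      then have "?m \<in> S" using a by (simp add: S_def)
      then show False using g(2)[of ?m] a by simp
    next
      case False
      have "continuous_on {?a .. ?m} (\<lambda>t. angle_defect G t x)"
        by (rule continuous_on_subset[OF cont]) (use a in auto)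
      then obtain t where t: "?a \<le> t" "t \<le> ?m" "angle_defect G t x = 0"
        using IVT2'[of "\<lambda>t. angle_defect G t x" ?m 0 ?a] a False by auto
      then have "t \<in> S" using a by (simp add: S_def)
      then have "t = ?a" using g(2)[of t] t by simp
      then show False using t a by simp
    qed
  qed
qed

text \<open>
  The faces at a vertex whose critical side is the smallest already have the required area, and the
  remaining faces contribute nonnegative area.
\<close>

lemma Area_cri_lower_bound:
  assumes "G \<in> PC_ge_1"
  shows "8.3755 / 10 ^ 2 \<le> Area_cri G"
proof -
  obtain M where M: "tessellation M G" "M \<noteq> {}"
  proof -
    have "tessellation (sphere 0 1) G \<or> tessellation plane G"
      using assms by (simp add: PC_ge_1_def planar_graph_def)
    moreover have "plane \<noteq> {}" by (auto simp: plane_def intro!: exI[of _ 0])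
    moreover have "sphere 0 1 \<noteq> ({} :: (real ^ 3) set)" by simp
    ultimately show ?thesis using that by blast
  qed
  have finV: "finite (verts G)" using assms by (simp add: PC_ge_1_def)
  note T = tessellation_incidences[OF M finV]
  obtain b where b: "b > 0" "b \<le> (INF \<sigma> \<in> faces G. 2 * pi / real (fdeg G \<sigma>))" "curvature_ge_1 b G"
    using assms by (auto simp: PC_ge_1_def)
  have bF: "b \<le> 2 * pi / real (fdeg G \<sigma>)" if "\<sigma> \<in> faces G" for \<sigma>
    using b(2) by (rule order_trans) (use T(2) that in \<open>auto intro!: cINF_lower\<close>)
  have at: "faces_at G x \<subseteq> faces G" for x by (auto simp: faces_at_def)
  have fin: "finite (faces_at G x)" for x using T(2) at by (rule rev_finite_subset)
  note crit = a_crit_at_properties[where b = b, OF fin T(4)]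
  have C: "b \<le> a_crit_at G x" "\<And>\<sigma>. \<sigma> \<in> faces_at G x \<Longrightarrow> a_crit_at G x \<le> 2 * pi / real (fdeg G \<sigma>)"
    "0 \<le> angle_defect G (a_crit_at G x) x"
    "angle_defect G (a_crit_at G x) x = 0 \<or> (\<exists>\<sigma> \<in> faces_at G x. a_crit_at G x = 2 * pi / real (fdeg G \<sigma>))"
    if "x \<in> verts G" for x
    using crit[OF that] at T(6) b(1,3) bF that unfolding curvature_ge_1_def by (meson less_imp_le subsetD)+
  have "a_crit G \<in> a_crit_at G ` verts G" unfolding a_crit_def using finV T(3) by (intro Min_in) auto
  then obtain x where x: "x \<in> verts G" "a_crit G = a_crit_at G x" by auto
  let ?a = "a_crit G"
  have a: "0 < ?a" using C(1)[OF x(1)] b(1) x(2) by simp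
  have aF: "?a \<le> 2 * pi / real (fdeg G \<sigma>)" if "\<sigma> \<in> faces G" for \<sigma>
  proof -
    obtain y where y: "y \<in> verts G" "\<sigma> \<in> faces_at G y" using T(5)[OF \<open>\<sigma> \<in> faces G\<close>] by blast
    have "?a \<le> a_crit_at G y" unfolding a_crit_def using finV y by (intro Min_le) auto
    then show ?thesis using C(2)[OF y] by simp
  qed
  have nn: "0 \<le> polygon_area (fdeg G \<sigma>) ?a" if "\<sigma> \<in> faces G" for \<sigma>
    using aF[OF that] T(6)[OF that] a by (intro polygon_area_nonneg) auto
  consider \<sigma> where "\<sigma> \<in> faces_at G x" "?a = 2 * pi / real (fdeg G \<sigma>)" | "angle_defect G ?a x = 0"
    using C(4)[OF x(1)] x(2) by auto
  then show ?thesis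
  proof cases
    case 1
    then have s: "\<sigma> \<in> faces G" using at by blast
    have "2 * pi = polygon_area (fdeg G \<sigma>) ?a" using 1(2) T(6)[OF s] by (simp add: polygon_area_hemisphere)
    also have "\<dots> \<le> Area ?a G" unfolding Area_def using s T(2) nn by (intro member_le_sum) auto
    finally show ?thesis unfolding Area_cri_def using pi_gt_approx by simp
  next
    case 2
    have "8.3755 / 10 ^ 2 \<le> (\<Sum>\<sigma> \<in> faces_at G x. polygon_area (fdeg G \<sigma>) ?a)"
    proof (rule vertex_area_lower_bound)
      show "\<forall>\<sigma> \<in> faces_at G x. 3 \<le> fdeg G \<sigma>" "\<forall>\<sigma> \<in> faces_at G x. ?a \<le> 2 * pi / real (fdeg G \<sigma>)"
        using at T(6) aF by blast+
      show "(\<Sum>\<sigma> \<in> faces_at G x. polygon_angle (fdeg G \<sigma>) ?a) = 2 * pi"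
        using 2 by (simp add: angle_defect_def total_angle_def)
    qed (use fin a in auto)
    also have "\<dots> \<le> Area ?a G" unfolding Area_def
      using nn by (intro sum_mono2 T(2) at) auto
    finally show ?thesis unfolding Area_cri_def .
  qed
qed

section \<open>Tessellations of the sphere from normal fans\<close>

lemma components_eq_open_partition:
  fixes S :: "'a::topological_space set"
  assumes op: "\<And>U. U \<in> \<U> \<Longrightarrow> openin (top_of_set S) U"
    and con: "\<And>U. U \<in> \<U> \<Longrightarrow> connected U" and ne: "{} \<notin> \<U>"
    and disj: "\<And>U W. U \<in> \<U> \<Longrightarrow> W \<in> \<U> \<Longrightarrow> U \<noteq> W \<Longrightarrow> U \<inter> W = {}" and un: "\<Union>\<U> = S"
  shows "components S = \<U>"
proof -
  have comp: "U \<in> components S" if U: "U \<in> \<U>" for U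
    unfolding in_components_maximal
  proof (intro conjI allI impI)
    show "U \<noteq> {}" using ne U by auto
    show "U \<subseteq> S" using un U by auto
    show "connected U" using con U .
    fix D assume D: "D \<noteq> {} \<and> U \<subseteq> D \<and> D \<subseteq> S \<and> connected D"
    have "S - U = \<Union>(\<U> - {U})" using un U disj by auto
    moreover have "openin (top_of_set S) (\<Union>(\<U> - {U}))" using op by (intro openin_Union) auto
    ultimately have "closedin (top_of_set S) U" using \<open>U \<subseteq> S\<close> by (simp add: closedin_def)
    then have "closedin (top_of_set D) U" "openin (top_of_set D) U"
      using D op[OF U] by (meson closedin_subset_trans openin_subset_trans)+
    then show "D = U" using D \<open>U \<noteq> {}\<close> unfolding connected_clopen by auto
  qed
  moreover have "C \<in> \<U>" if C: "C \<in> components S" for C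
  proof -
    obtain x where x: "x \<in> C" "x \<in> S" using C in_components_nonempty in_components_subset by fastforce
    then obtain U where "U \<in> \<U>" "x \<in> U" using un by auto
    then have "C = U" using components_eq[OF C comp[of U]] x by blast
    then show ?thesis using \<open>U \<in> \<U>\<close> by simp
  qed
  ultimately show ?thesis by blast
qed

abbreviation triple :: "real ^ 3 \<Rightarrow> real ^ 3 \<Rightarrow> real ^ 3 \<Rightarrow> real" where
  "triple u v w \<equiv> cross3 u v \<bullet> w"

text \<open>
  Cramer's rule for a vector \<open>x\<close> in terms of \<open>u\<close>, \<open>v\<close>, \<open>w\<close>, free of divisions.
\<close>

lemma triple_cramer:
  "triple u v w *\<^sub>R x = triple v w x *\<^sub>R u + triple w u x *\<^sub>R v + triple u v x *\<^sub>R w"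
  by (simp add: cross3_def inner_vec_def vec_eq_iff forall_3 sum_3 vector_3 algebra_simps)

lemma triple_swap: "triple u v x = - triple v u x"
  by (simp add: cross3_def inner_vec_def sum_3 algebra_simps)

lemma triple_rotate: "triple u v w = triple v w u"
  by (simp add: cross3_def inner_vec_def sum_3 algebra_simps)

text \<open>
  A spherical convex polygon is the union of the triangles spanned by its first vertex and its sides.
  The sign of \<open>triple (ws ! 0) (ws ! j) x\<close> tells on which side of the \<open>j\<close>-th diagonal \<open>x\<close> lies; the first
  change of sign locates the triangle containing \<open>x\<close>.
\<close>

lemma convex_polygon_fan:
  assumes k: "3 \<le> length ws"
    and conv: "\<And>i. 1 \<le> i \<Longrightarrow> Suc i < length ws \<Longrightarrow> 0 < triple (ws ! 0) (ws ! i) (ws ! Suc i)"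
    and x: "\<And>i. i < length ws \<Longrightarrow> 0 \<le> triple (ws ! i) (ws ! (Suc i mod length ws)) x"
  obtains i a b c where "1 \<le> i" "Suc i < length ws" "0 \<le> a" "0 \<le> b" "0 \<le> c"
    "x = a *\<^sub>R (ws ! 0) + b *\<^sub>R (ws ! i) + c *\<^sub>R (ws ! Suc i)"
proof -
  let ?k = "length ws"
  let ?d = "\<lambda>j. triple (ws ! 0) (ws ! j) x"
  have d1: "0 \<le> ?d 1" using x[of 0] k by (cases "length ws") auto
  have "Suc (?k - 1) = ?k" using k by simp
  then have "0 \<le> triple (ws ! (?k - 1)) (ws ! 0) x" using x[of "?k - 1"] k by simp
  then have dk: "?d (?k - 1) \<le> 0" by (subst triple_swap) simp
  define j where "j = (LEAST j. 2 \<le> j \<and> ?d j \<le> 0)"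
  have ex: "2 \<le> ?k - 1 \<and> ?d (?k - 1) \<le> 0" using k dk by auto
  have j: "2 \<le> j" "?d j \<le> 0" using LeastI[of "\<lambda>j. 2 \<le> j \<and> ?d j \<le> 0", OF ex] by (auto simp: j_def)
  have jk: "j \<le> ?k - 1" unfolding j_def by (rule Least_le) (use ex in auto)
  define i where "i = j - 1"
  have i: "1 \<le> i" "Suc i = j" "Suc i < ?k" using j jk k by (auto simp: i_def)
  have di: "0 \<le> ?d i"
  proof (cases "i = 1")
    case False
    then have "2 \<le> i" "i < j" using i by auto
    then show ?thesis using not_less_Least[of i "\<lambda>j. 2 \<le> j \<and> ?d j \<le> 0"] by (force simp: j_def)
  qed (use d1 in simp)
  let ?t = "triple (ws ! 0) (ws ! i) (ws ! Suc i)"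
  have t: "0 < ?t" using conv i by auto
  have e: "0 \<le> triple (ws ! i) (ws ! Suc i) x" using x[of i] i by simp
  have s: "0 \<le> triple (ws ! Suc i) (ws ! 0) x" using j(2) i(2) by (subst triple_swap) simp
  have "x = (1 / ?t) *\<^sub>R (?t *\<^sub>R x)" using t by simp
  also have "\<dots> = (triple (ws ! i) (ws ! Suc i) x / ?t) *\<^sub>R (ws ! 0)
      + (triple (ws ! Suc i) (ws ! 0) x / ?t) *\<^sub>R (ws ! i) + (?d i / ?t) *\<^sub>R (ws ! Suc i)"
    by (subst triple_cramer) (simp add: scaleR_add_right)
  finally show ?thesis using that i e s di t by (meson divide_nonneg_pos)
qed

definition normalize :: "real ^ 3 \<Rightarrow> real ^ 3" where
  "normalize x = x /\<^sub>R norm x"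

lemma normalize_in_sphere: "x \<noteq> 0 \<Longrightarrow> normalize x \<in> sphere 0 1"
  by (simp add: normalize_def)

lemma normalize_id: "x \<in> sphere 0 1 \<Longrightarrow> normalize x = x"
  by (simp add: normalize_def)

lemma normalize_scaleR: "0 < c \<Longrightarrow> normalize (c *\<^sub>R x) = normalize x"
  by (simp add: normalize_def)

lemma normalize_eq_imp: "normalize x = normalize y \<Longrightarrow> x \<noteq> 0 \<Longrightarrow> y \<noteq> 0 \<Longrightarrow> \<exists>c > 0. y = c *\<^sub>R x"
  unfolding normalize_def
  by (intro exI[of _ "norm y / norm x"]) (auto simp: divide_inverse dest: arg_cong[of _ _ "scaleR (norm y)"])

lemma continuous_on_normalize: "0 \<notin> S \<Longrightarrow> continuous_on S normalize"
  unfolding normalize_def by (intro continuous_intros) auto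

text \<open>
  The vectors \<open>n f\<close> are the vertices of a convex polytope, and the cells of the tessellation are the sets
  of directions in which one of them is the unique maximiser (the normal fan).  Maximality makes it
  immediate that the cells are disjoint and that their closures cover the sphere.  The combinatorial
  data are the cyclic list \<open>cyc f\<close> of the vertices around a cell and the ray \<open>r v\<close> through a vertex.  The
  assumptions are finitely many linear inequalities and incidences, so that they can be checked by
  computation in an example; together they say that the rays of \<open>cyc f\<close> are exactly those on which
  \<open>n f\<close> is maximal and that they form a strictly convex polygon.
\<close>

locale convex_fan =
  fixes F :: "'f set" and n :: "'f \<Rightarrow> real ^ 3" and cyc :: "'f \<Rightarrow> 'v list" and r :: "'v \<Rightarrow> real ^ 3"
  assumes finite_F: "finite F"
    and F_ne: "F \<noteq> {}"
    and length_cyc: "f \<in> F \<Longrightarrow> 3 \<le> length (cyc f)"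
    and distinct_cyc: "f \<in> F \<Longrightarrow> distinct (cyc f)"
    and convex_cyc: "f \<in> F \<Longrightarrow> i < length (cyc f) \<Longrightarrow> v \<in> set (cyc f) \<Longrightarrow> v \<noteq> cyc f ! i \<Longrightarrow>
        v \<noteq> cyc f ! (Suc i mod length (cyc f)) \<Longrightarrow>
        0 < triple (r (cyc f ! i)) (r (cyc f ! (Suc i mod length (cyc f)))) (r v)"
    and normal_le: "f \<in> F \<Longrightarrow> g \<in> F \<Longrightarrow> v \<in> set (cyc f) \<Longrightarrow> n g \<bullet> r v \<le> n f \<bullet> r v"
    and normal_eq: "f \<in> F \<Longrightarrow> g \<in> F \<Longrightarrow> v \<in> set (cyc f) \<Longrightarrow> n g \<bullet> r v = n f \<bullet> r v \<Longrightarrow> v \<in> set (cyc g)"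
    and normal_pos: "f \<in> F \<Longrightarrow> v \<in> set (cyc f) \<Longrightarrow> 0 < n f \<bullet> r v"
    and meet: "f \<in> F \<Longrightarrow> g \<in> F \<Longrightarrow> f \<noteq> g \<Longrightarrow> set (cyc f) \<inter> set (cyc g) = {} \<or>
        (\<exists>v. set (cyc f) \<inter> set (cyc g) = {v}) \<or>
        (\<exists>i < length (cyc f). set (cyc f) \<inter> set (cyc g) = {cyc f ! i, cyc f ! (Suc i mod length (cyc f))})"
    and two_faces: "f \<in> F \<Longrightarrow> i < length (cyc f) \<Longrightarrow>
        card {g \<in> F. {cyc f ! i, cyc f ! (Suc i mod length (cyc f))} \<subseteq> set (cyc g)} = 2"
    and three_edges: "f \<in> F \<Longrightarrow> v \<in> set (cyc f) \<Longrightarrow>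
        3 \<le> card {w. w \<noteq> v \<and> (\<exists>f \<in> F. \<exists>i < length (cyc f). {v, w} = {cyc f ! i, cyc f ! (Suc i mod length (cyc f))})}"
begin

definition sides :: "'f \<Rightarrow> 'v set set" where
  "sides f = (\<lambda>i. {cyc f ! i, cyc f ! (Suc i mod length (cyc f))}) ` {..<length (cyc f)}"

definition V :: "'v set" where "V = (\<Union>f \<in> F. set (cyc f))"

text \<open>
  The normal cone of the polytope at its vertex \<open>n f\<close>.
\<close>

definition closed_cone :: "'f \<Rightarrow> (real ^ 3) set" where
  "closed_cone f = {x. \<forall>g \<in> F. n g \<bullet> x \<le> n f \<bullet> x}"

definition cell :: "'f \<Rightarrow> (real ^ 3) set" where
  "cell f = {x \<in> sphere 0 1. \<forall>g \<in> F - {f}. n g \<bullet> x < n f \<bullet> x}"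

definition cone :: "'v set \<Rightarrow> (real ^ 3) set" where
  "cone s = {x. \<exists>c. (\<forall>v \<in> s. 0 \<le> c v) \<and> x = (\<Sum>v \<in> s. c v *\<^sub>R r v)}"

definition pt :: "'v \<Rightarrow> real ^ 3" where "pt v = normalize (r v)"

definition arc_of :: "'v set \<Rightarrow> (real ^ 3) set" where "arc_of s = sphere 0 1 \<inter> cone s"

definition graph :: pgraph where
  "graph = \<lparr>verts = pt ` V, edges = arc_of ` (\<Union>f \<in> F. sides f), faces = cell ` F\<rparr>"

lemma side_cases:
  assumes "f \<in> F" "s \<in> sides f"
  obtains i where "i < length (cyc f)" "s = {cyc f ! i, cyc f ! (Suc i mod length (cyc f))}"
    "cyc f ! i \<noteq> cyc f ! (Suc i mod length (cyc f))" "s \<subseteq> set (cyc f)"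
proof -
  obtain i where i: "i < length (cyc f)" "s = {cyc f ! i, cyc f ! (Suc i mod length (cyc f))}"
    using assms(2) by (auto simp: sides_def)
  have 3: "3 \<le> length (cyc f)" using length_cyc assms by auto
  have m: "Suc i mod length (cyc f) < length (cyc f)" using 3 by (intro mod_less_divisor) auto
  have "i \<noteq> Suc i mod length (cyc f)" using 3 i(1) by (cases "Suc i = length (cyc f)") auto
  then have "cyc f ! i \<noteq> cyc f ! (Suc i mod length (cyc f))"
    using distinct_cyc[OF assms(1)] i(1) m by (simp add: nth_eq_iff_index_eq)
  moreover have "s \<subseteq> set (cyc f)" using i m by auto
  ultimately show ?thesis using that i by blast
qed

lemma side_card: "f \<in> F \<Longrightarrow> s \<in> sides f \<Longrightarrow> card s = 2"
  by (erule (1) side_cases) auto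

lemma side_subset: "f \<in> F \<Longrightarrow> s \<in> sides f \<Longrightarrow> s \<subseteq> set (cyc f)"
  by (erule (1) side_cases) auto

lemma side_finite: "f \<in> F \<Longrightarrow> s \<in> sides f \<Longrightarrow> finite s"
  by (erule (1) side_cases) auto

lemma meet_sides:
  assumes "f \<in> F" "g \<in> F" "f \<noteq> g"
  shows "set (cyc f) \<inter> set (cyc g) = {} \<or> (\<exists>v. set (cyc f) \<inter> set (cyc g) = {v}) \<or>
    set (cyc f) \<inter> set (cyc g) \<in> sides f"
  using meet[OF assms] by (auto simp: sides_def)

lemma meet_card: "f \<in> F \<Longrightarrow> g \<in> F \<Longrightarrow> f \<noteq> g \<Longrightarrow> card (set (cyc f) \<inter> set (cyc g)) \<le> 2"
  using meet_sides[of f g] side_card[of f] by fastforce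

lemma meet_eq_side:
  assumes "f \<in> F" "g \<in> F" "f \<noteq> g" "h \<in> F" "s \<in> sides h" "s \<subseteq> set (cyc f)" "s \<subseteq> set (cyc g)"
  shows "set (cyc f) \<inter> set (cyc g) = s" "s \<in> sides f"
proof -
  have "card s = 2" using side_card assms by blast
  then show eq: "set (cyc f) \<inter> set (cyc g) = s"
    using meet_card[OF assms(1-3)] assms by (metis card_seteq finite_Int finite_set Int_greatest)
  have "card (set (cyc f) \<inter> set (cyc g)) = 2" using eq \<open>card s = 2\<close> by simp
  then show "s \<in> sides f" using meet_sides[OF assms(1-3)] eq by force
qed

lemma side_two_faces:
  assumes "f \<in> F" "s \<in> sides f"
  shows "card {g \<in> F. s \<subseteq> set (cyc g)} = 2"
  using two_faces[OF assms(1)] assms by (auto simp: sides_def)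

lemma side_other_face:
  assumes "f \<in> F" "s \<in> sides f"
  obtains g where "g \<in> F" "g \<noteq> f" "s \<subseteq> set (cyc g)" "{h \<in> F. s \<subseteq> set (cyc h)} = {f, g}"
    "set (cyc f) \<inter> set (cyc g) = s"
proof -
  have "f \<in> {g \<in> F. s \<subseteq> set (cyc g)}" using assms side_subset by auto
  then obtain g where g: "{h \<in> F. s \<subseteq> set (cyc h)} = {f, g}" "g \<noteq> f"
  proof -
    obtain a b where "{h \<in> F. s \<subseteq> set (cyc h)} = {a, b}" "a \<noteq> b"
      using side_two_faces[OF assms] by (auto simp: card_2_iff)
    moreover from this have "f = a \<or> f = b" using \<open>f \<in> {g \<in> F. _ g}\<close> by blast
    ultimately show ?thesis using that[of a] that[of b] by (auto simp: insert_commute)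
  qed
  then have "g \<in> F" "s \<subseteq> set (cyc g)" by blast+
  moreover have "set (cyc f) \<inter> set (cyc g) = s"
    using meet_eq_side(1)[of f g f s] g(2) assms side_subset calculation by auto
  ultimately show ?thesis using that g by blast
qed

lemma side_faces_self:
  assumes "f \<in> F" "h \<in> F" "s \<in> sides h" "s \<subseteq> set (cyc f)"
  shows "s \<in> sides f"
  using assms meet_eq_side(2)[of f h h s] side_subset by (cases "f = h") auto

lemma cone_add: "x \<in> cone s \<Longrightarrow> y \<in> cone s \<Longrightarrow> x + y \<in> cone s"
proof -
  assume "x \<in> cone s" "y \<in> cone s"
  then obtain c d where "\<forall>v \<in> s. 0 \<le> c v" "x = (\<Sum>v \<in> s. c v *\<^sub>R r v)"
    "\<forall>v \<in> s. 0 \<le> d v" "y = (\<Sum>v \<in> s. d v *\<^sub>R r v)" by (auto simp: cone_def)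
  then show ?thesis unfolding cone_def
    by (intro CollectI exI[of _ "\<lambda>v. c v + d v"]) (simp add: scaleR_add_left sum.distrib)
qed

lemma cone_scaleR: "0 \<le> a \<Longrightarrow> x \<in> cone s \<Longrightarrow> a *\<^sub>R x \<in> cone s"
proof -
  assume a: "0 \<le> a" and "x \<in> cone s"
  then obtain c where "\<forall>v \<in> s. 0 \<le> c v" "x = (\<Sum>v \<in> s. c v *\<^sub>R r v)" by (auto simp: cone_def)
  then show ?thesis unfolding cone_def using a
    by (intro CollectI exI[of _ "\<lambda>v. a * c v"]) (simp add: scaleR_sum_right)
qed

lemma r_in_cone: "v \<in> s \<Longrightarrow> finite s \<Longrightarrow> r v \<in> cone s"
proof -
  assume v: "v \<in> s" "finite s"
  have "(\<Sum>u \<in> s. (if u = v then 1 else 0) *\<^sub>R r u) = (\<Sum>u \<in> s. if u = v then r u else 0)"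
    by (intro sum.cong) auto
  also have "\<dots> = r v" using v by simp
  finally show ?thesis unfolding cone_def
    by (intro CollectI exI[of _ "\<lambda>u. if u = v then 1 else 0"]) auto
qed

text \<open>
  Across each side of \<open>cyc f\<close> there is another cell \<open>g\<close>, and \<open>n f - n g\<close> is a positive multiple of the
  inner normal of that side.  Hence a vector on which \<open>n f\<close> is maximal lies on the inner side of all
  sides, and \<open>convex_polygon_fan\<close> writes it as a nonnegative combination of the rays.
\<close>

lemma closed_cone_subset_cone:
  assumes f: "f \<in> F" and x: "x \<in> closed_cone f"
  shows "x \<in> cone (set (cyc f))"
proof -
  let ?k = "length (cyc f)" and ?ws = "map r (cyc f)"
  have 3: "3 \<le> ?k" using length_cyc f .
  have conv: "0 < triple (?ws ! 0) (?ws ! i) (?ws ! Suc i)" if "1 \<le> i" "Suc i < length ?ws" for i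
  proof -
    have "cyc f ! 0 \<noteq> cyc f ! i" "cyc f ! 0 \<noteq> cyc f ! Suc i"
      using that 3 distinct_cyc[OF f] by (subst nth_eq_iff_index_eq; force)+
    then have "0 < triple (?ws ! i) (?ws ! Suc i) (?ws ! 0)"
    proof -
      have "cyc f ! 0 \<in> set (cyc f)" using 3 by (intro nth_mem) linarith
      moreover have "Suc i mod ?k = Suc i" "i < ?k" "0 < ?k" using that by auto
      ultimately show ?thesis
        using convex_cyc[OF f, of i "cyc f ! 0"] \<open>cyc f ! 0 \<noteq> cyc f ! i\<close> \<open>cyc f ! 0 \<noteq> cyc f ! Suc i\<close> that
        by simp
    qed
    then show ?thesis by (metis triple_rotate)
  qed
  have side: "0 \<le> triple (?ws ! i) (?ws ! (Suc i mod length ?ws)) x" if i: "i < length ?ws" for i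
  proof -
    let ?u = "cyc f ! i" and ?w = "cyc f ! (Suc i mod ?k)"
    have m: "Suc i mod ?k < ?k" using 3 by (intro mod_less_divisor) auto
    have s: "{?u, ?w} \<in> sides f" using i by (auto simp: sides_def)
    obtain g where g: "g \<in> F" "g \<noteq> f" "{?u, ?w} \<subseteq> set (cyc g)" "set (cyc f) \<inter> set (cyc g) = {?u, ?w}"
      by (rule side_other_face[OF f s])
    have "card {?u, ?w} = 2" using side_card[OF f s] .
    moreover have "3 \<le> card (set (cyc f))" using 3 distinct_cyc[OF f] by (simp add: distinct_card)
    ultimately have "\<not> set (cyc f) \<subseteq> {?u, ?w}" using card_mono[of "{?u, ?w}" "set (cyc f)"] by fastforce
    then obtain y where y: "y \<in> set (cyc f)" "y \<notin> {?u, ?w}" by blast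
    let ?m = "n f - n g"
    have "?m \<bullet> r v = 0" if "v \<in> {?u, ?w}" for v
    proof -
      have "v \<in> set (cyc g)" "v \<in> set (cyc f)" using that g(3) side_subset[OF f s] by blast+
      then have "n f \<bullet> r v = n g \<bullet> r v"
        using normal_le[OF f g(1)] normal_le[OF g(1) f] by (intro antisym)
      then show ?thesis by (simp add: inner_diff_left)
    qed
    then have uw: "?m \<bullet> r ?u = 0" "?m \<bullet> r ?w = 0" by auto
    have "y \<notin> set (cyc g)" using g(4) y by blast
    then have my: "0 < ?m \<bullet> r y"
      using normal_le[OF f g(1) y(1)] normal_eq[OF f g(1) y(1)] by (force simp: inner_diff_left)
    have mx: "0 \<le> ?m \<bullet> x" using x g(1) by (auto simp: closed_cone_def inner_diff_left)
    have t: "0 < triple (r ?u) (r ?w) (r y)" using convex_cyc[OF f, of i y] y i by auto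
    \<comment> \<open>The vertex \<open>y\<close> off the side fixes the sign of the multiple.\<close>
    have "triple (r ?u) (r ?w) (r y) * (?m \<bullet> x) = ?m \<bullet> (triple (r ?u) (r ?w) (r y) *\<^sub>R x)" by simp
    also have "\<dots> = triple (r ?u) (r ?w) x * (?m \<bullet> r y)"
      by (subst triple_cramer) (simp only: inner_add_right inner_scaleR_right uw mult_zero_right add_0_left)
    finally have "0 \<le> triple (r ?u) (r ?w) x * (?m \<bullet> r y)" using t mx by (metis mult_nonneg_nonneg less_imp_le)
    then have "0 \<le> triple (r ?u) (r ?w) x" using my by (simp add: zero_le_mult_iff)
    then show ?thesis using i m by simp
  qed
  obtain i a b c where i: "1 \<le> i" "Suc i < ?k" and nn: "0 \<le> a" "0 \<le> b" "0 \<le> c"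
    and eq: "x = a *\<^sub>R r (cyc f ! 0) + b *\<^sub>R r (cyc f ! i) + c *\<^sub>R r (cyc f ! Suc i)"
  proof (rule convex_polygon_fan[of ?ws x])
    fix i a b c assume *: "1 \<le> i" "Suc i < length ?ws" "0 \<le> a" "0 \<le> b" "0 \<le> c"
      "x = a *\<^sub>R (?ws ! 0) + b *\<^sub>R (?ws ! i) + c *\<^sub>R (?ws ! Suc i)"
    then have k: "Suc i < ?k" by simp
    have "0 < ?k" "i < ?k" using k by linarith+
    with k have "?ws ! 0 = r (cyc f ! 0)" "?ws ! i = r (cyc f ! i)" "?ws ! Suc i = r (cyc f ! Suc i)"
      by simp_all
    with * show thesis using that by simp
  qed (use 3 conv side in auto)
  have "cyc f ! 0 \<in> set (cyc f)" "cyc f ! i \<in> set (cyc f)" "cyc f ! Suc i \<in> set (cyc f)"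
    using i by (intro nth_mem; linarith)+
  then show ?thesis unfolding eq by (intro cone_add cone_scaleR r_in_cone nn) auto
qed


lemma cone_subset_closed_cone:
  assumes "f \<in> F" "s \<subseteq> set (cyc f)"
  shows "cone s \<subseteq> closed_cone f"
proof
  fix x assume "x \<in> cone s"
  then obtain c where c: "\<forall>v \<in> s. 0 \<le> c v" "x = (\<Sum>v \<in> s. c v *\<^sub>R r v)" by (auto simp: cone_def)
  have "n g \<bullet> x \<le> n f \<bullet> x" if "g \<in> F" for g
    unfolding c(2) inner_sum_right inner_scaleR_right
    using c(1) normal_le[OF assms(1) that] assms(2) by (intro sum_mono mult_left_mono) auto
  then show "x \<in> closed_cone f" by (simp add: closed_cone_def)
qed

text \<open>
  Complementary slackness: a second normal \<open>n g\<close> is maximal on a nonnegative combination only if it is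
  maximal on every ray that occurs in it.
\<close>

lemma cone_tight:
  assumes "f \<in> F" "g \<in> F" "s \<subseteq> set (cyc f)" "\<forall>v \<in> s. 0 \<le> c v"
  shows "n g \<bullet> (\<Sum>v \<in> s. c v *\<^sub>R r v) = n f \<bullet> (\<Sum>v \<in> s. c v *\<^sub>R r v) \<longleftrightarrow>
    (\<forall>v \<in> s. 0 < c v \<longrightarrow> v \<in> set (cyc g))"
proof -
  have fin: "finite s" using assms(3) by (rule finite_subset) simp
  have nn: "0 \<le> c v * (n f \<bullet> r v - n g \<bullet> r v)" if "v \<in> s" for v
    using normal_le[OF assms(1,2)] assms(3,4) that by (intro mult_nonneg_nonneg) auto
  have "n g \<bullet> (\<Sum>v \<in> s. c v *\<^sub>R r v) = n f \<bullet> (\<Sum>v \<in> s. c v *\<^sub>R r v) \<longleftrightarrow>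
    (\<Sum>v \<in> s. c v * (n f \<bullet> r v - n g \<bullet> r v)) = 0"
    by (auto simp: inner_sum_right sum_subtractf right_diff_distrib)
  also have "\<dots> \<longleftrightarrow> (\<forall>v \<in> s. c v * (n f \<bullet> r v - n g \<bullet> r v) = 0)"
    using fin nn by (rule sum_nonneg_eq_0_iff)
  also have "\<dots> \<longleftrightarrow> (\<forall>v \<in> s. 0 < c v \<longrightarrow> v \<in> set (cyc g))"
  proof (intro ball_cong refl)
    fix v assume v: "v \<in> s"
    then have vf: "v \<in> set (cyc f)" using assms(3) by blast
    have "n f \<bullet> r v = n g \<bullet> r v \<longleftrightarrow> v \<in> set (cyc g)"
      using normal_le[OF assms(1,2) vf] normal_le[OF assms(2,1)] normal_eq[OF assms(1,2) vf]
      by (metis antisym)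
    moreover have "0 < c v \<longleftrightarrow> c v \<noteq> 0" using v assms(4) by (auto simp: order_less_le)
    ultimately show "c v * (n f \<bullet> r v - n g \<bullet> r v) = 0 \<longleftrightarrow> (0 < c v \<longrightarrow> v \<in> set (cyc g))" by auto
  qed
  finally show ?thesis .
qed

lemma closed_cone_eq: "f \<in> F \<Longrightarrow> closed_cone f = cone (set (cyc f))"
  using closed_cone_subset_cone cone_subset_closed_cone by blast

text \<open>
  This is where the tiling becomes edge-to-edge: two closed cells meet in the cone over their common
  vertices.
\<close>

lemma closed_cone_Int:
  assumes "f \<in> F" "g \<in> F"
  shows "closed_cone f \<inter> closed_cone g = cone (set (cyc f) \<inter> set (cyc g))"
proof (intro equalityI subsetI)
  fix x assume x: "x \<in> closed_cone f \<inter> closed_cone g"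
  then obtain c where c: "\<forall>v \<in> set (cyc f). 0 \<le> c v" "x = (\<Sum>v \<in> set (cyc f). c v *\<^sub>R r v)"
    using closed_cone_eq[OF assms(1)] by (auto simp: cone_def)
  have "n g \<bullet> x = n f \<bullet> x" using x assms by (auto simp: closed_cone_def intro: antisym)
  then have "\<forall>v \<in> set (cyc f). 0 < c v \<longrightarrow> v \<in> set (cyc g)"
    using cone_tight[OF assms order_refl c(1)] c(2) by simp
  then have "c v = 0" if "v \<in> set (cyc f) - set (cyc g)" for v
    using that c(1) by (metis DiffD1 DiffD2 less_eq_real_def)
  then have "x = (\<Sum>v \<in> set (cyc f) \<inter> set (cyc g). c v *\<^sub>R r v)"
    unfolding c(2) by (intro sum.mono_neutral_right) auto
  then show "x \<in> cone (set (cyc f) \<inter> set (cyc g))" using c(1) by (auto simp: cone_def)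
next
  fix x assume "x \<in> cone (set (cyc f) \<inter> set (cyc g))"
  then show "x \<in> closed_cone f \<inter> closed_cone g"
    using cone_subset_closed_cone assms by (meson Int_lower1 Int_lower2 IntI subsetD)
qed

lemma closed_cone_exists: obtains f where "f \<in> F" "x \<in> closed_cone f"
proof -
  have "Max ((\<lambda>f. n f \<bullet> x) ` F) \<in> (\<lambda>f. n f \<bullet> x) ` F" using finite_F F_ne by (intro Max_in) auto
  then obtain f where f: "f \<in> F" "n f \<bullet> x = Max ((\<lambda>f. n f \<bullet> x) ` F)" by auto
  then have "x \<in> closed_cone f" unfolding closed_cone_def using finite_F by auto
  then show ?thesis using that f by blast
qed

lemma normal_dot_pos:
  assumes "f \<in> F" "x \<in> closed_cone f" "x \<noteq> 0"
  shows "0 < n f \<bullet> x"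
proof -
  obtain c where c: "\<forall>v \<in> set (cyc f). 0 \<le> c v" "x = (\<Sum>v \<in> set (cyc f). c v *\<^sub>R r v)"
    using assms closed_cone_eq[OF assms(1)] by (auto simp: cone_def)
  have nn: "0 \<le> c v * (n f \<bullet> r v)" if "v \<in> set (cyc f)" for v
    using normal_pos[OF assms(1) that] c(1) that by simp
  have eq: "n f \<bullet> x = (\<Sum>v \<in> set (cyc f). c v * (n f \<bullet> r v))" by (simp add: c(2) inner_sum_right)
  have "n f \<bullet> x \<noteq> 0"
  proof
    assume "n f \<bullet> x = 0"
    then have "\<forall>v \<in> set (cyc f). c v * (n f \<bullet> r v) = 0"
      using nn unfolding eq by (subst (asm) sum_nonneg_eq_0_iff) auto
    then have "c v = 0" if "v \<in> set (cyc f)" for v using normal_pos[OF assms(1) that] that by force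
    then show False using c(2) assms(3) by simp
  qed
  moreover have "0 \<le> n f \<bullet> x" unfolding eq using nn by (intro sum_nonneg)
  ultimately show ?thesis by simp
qed

lemma r_nonzero: "v \<in> V \<Longrightarrow> r v \<noteq> 0"
  using normal_pos by (force simp: V_def)

lemma V_I: "f \<in> F \<Longrightarrow> v \<in> set (cyc f) \<Longrightarrow> v \<in> V"
  by (auto simp: V_def)

lemma pt_sphere: "v \<in> V \<Longrightarrow> pt v \<in> sphere 0 1"
  unfolding pt_def by (intro normalize_in_sphere r_nonzero)

lemma pt_eq_scaleR: "v \<in> V \<Longrightarrow> pt v = (1 / norm (r v)) *\<^sub>R r v"
  by (simp add: pt_def normalize_def inverse_eq_divide)

lemma closed_cone_scaleR: "0 < c \<Longrightarrow> c *\<^sub>R x \<in> closed_cone f \<longleftrightarrow> x \<in> closed_cone f"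
  by (simp add: closed_cone_def)

lemma closed_cone_normalize: "x \<noteq> 0 \<Longrightarrow> normalize x \<in> closed_cone f \<longleftrightarrow> x \<in> closed_cone f"
  unfolding normalize_def by (intro closed_cone_scaleR) simp

lemma r_in_closed_cone_iff:
  assumes "v \<in> V" "f \<in> F"
  shows "r v \<in> closed_cone f \<longleftrightarrow> v \<in> set (cyc f)"
proof
  assume *: "r v \<in> closed_cone f"
  obtain g where g: "g \<in> F" "v \<in> set (cyc g)" using assms(1) by (auto simp: V_def)
  have "n f \<bullet> r v = n g \<bullet> r v"
    using * g normal_le[OF g(1) assms(2) g(2)] by (auto simp: closed_cone_def intro: antisym)
  then show "v \<in> set (cyc f)" using normal_eq[OF g(1) assms(2) g(2)] by simp
next
  assume "v \<in> set (cyc f)"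
  then show "r v \<in> closed_cone f" using normal_le[OF assms(2)] by (simp add: closed_cone_def)
qed

lemma pt_in_closed_cone_iff: "v \<in> V \<Longrightarrow> f \<in> F \<Longrightarrow> pt v \<in> closed_cone f \<longleftrightarrow> v \<in> set (cyc f)"
  unfolding pt_def by (simp add: closed_cone_normalize r_nonzero r_in_closed_cone_iff)

lemma independent_vertices:
  assumes f: "f \<in> F" and uw: "u \<in> set (cyc f)" "w \<in> set (cyc f)" "u \<noteq> w"
    and 0: "a *\<^sub>R r u + b *\<^sub>R r w = 0"
  shows "a = 0 \<and> b = 0"
proof -
  have *: "cross3 (r u) (r w) \<noteq> 0"
  proof
    assume z: "cross3 (r u) (r w) = 0"
    obtain i where i: "i < length (cyc f)" "cyc f ! i = u" using uw(1) by (auto simp: in_set_conv_nth)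
    let ?u' = "cyc f ! (Suc i mod length (cyc f))"
    have s: "{u, ?u'} \<in> sides f" using i by (auto simp: sides_def)
    have ne: "u \<noteq> ?u'" using side_card[OF f s] by (auto simp: card_insert_if split: if_splits)
    have u': "?u' \<in> set (cyc f)" using side_subset[OF f s] by simp
    have "3 \<le> card (set (cyc f))" using length_cyc[OF f] distinct_cyc[OF f] by (simp add: distinct_card)
    then have "\<not> set (cyc f) \<subseteq> {u, ?u'}" using card_mono[of "{u, ?u'}" "set (cyc f)"] side_card[OF f s] by fastforce
    then obtain y where y: "y \<in> set (cyc f)" "y \<noteq> u" "y \<noteq> ?u'" by blast
    show False
    proof (cases "w = ?u'")
      case True
      then have "0 < triple (r u) (r w) (r y)" using convex_cyc[OF f i(1) y(1)] i(2) y by simp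
      then show False using z by simp
    next
      case False
      then have "0 < triple (r u) (r ?u') (r w)" using convex_cyc[OF f i(1) uw(2)] i(2) uw(3) by simp
      also have "\<dots> = triple (r w) (r u) (r ?u')" by (metis triple_rotate)
      also have "\<dots> = - triple (r u) (r w) (r ?u')" by (rule triple_swap)
      finally show False using z by simp
    qed
  qed
  have "b *\<^sub>R cross3 (r u) (r w) = cross3 (r u) (a *\<^sub>R r u + b *\<^sub>R r w)"
    by (simp add: cross_add_right cross_mult_right)
  then have b: "b = 0" using * by (simp add: 0)
  have "a *\<^sub>R cross3 (r u) (r w) = cross3 (a *\<^sub>R r u + b *\<^sub>R r w) (r w)"
    by (simp add: cross_add_left cross_mult_left)
  then have "a *\<^sub>R cross3 (r u) (r w) = 0" unfolding 0 by simp
  then show ?thesis using * b by simp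
qed

lemma inj_on_pt: "inj_on pt V"
proof (rule inj_onI)
  fix v w assume vw: "v \<in> V" "w \<in> V" "pt v = pt w"
  obtain f where f: "f \<in> F" "v \<in> set (cyc f)" using vw(1) by (auto simp: V_def)
  then have w: "w \<in> set (cyc f)" using vw pt_in_closed_cone_iff by metis
  obtain c where "r w = c *\<^sub>R r v"
    using normalize_eq_imp[OF vw(3)[unfolded pt_def]] r_nonzero vw by blast
  then have "c *\<^sub>R r v + (- 1) *\<^sub>R r w = 0" by simp
  then show "v = w" using independent_vertices[OF f w, of c "- 1"] by auto
qed

lemma cone_pair: "u \<noteq> w \<Longrightarrow> cone {u, w} = {a *\<^sub>R r u + b *\<^sub>R r w |a b. 0 \<le> a \<and> 0 \<le> b}"
proof (intro equalityI subsetI)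
  fix x assume uw: "u \<noteq> w" and "x \<in> {a *\<^sub>R r u + b *\<^sub>R r w |a b. 0 \<le> a \<and> 0 \<le> b}"
  then obtain a b where "0 \<le> a" "0 \<le> b" "x = a *\<^sub>R r u + b *\<^sub>R r w" by auto
  then show "x \<in> cone {u, w}" using uw
    by (auto simp: cone_def intro!: exI[of _ "\<lambda>v. if v = u then a else b"])
qed (auto simp: cone_def)

lemma cone_singleton: "cone {u} = {a *\<^sub>R r u |a. 0 \<le> a}"
  by (auto simp: cone_def intro: exI[of _ "\<lambda>_. _"])

lemma cone_mono: "s \<subseteq> t \<Longrightarrow> finite t \<Longrightarrow> cone s \<subseteq> cone t"
proof
  fix x assume st: "s \<subseteq> t" "finite t" and "x \<in> cone s"
  then obtain c where c: "\<forall>v \<in> s. 0 \<le> c v" "x = (\<Sum>v \<in> s. c v *\<^sub>R r v)" by (auto simp: cone_def)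
  have "x = (\<Sum>v \<in> t. (if v \<in> s then c v else 0) *\<^sub>R r v)"
    unfolding c(2) using st by (intro sum.mono_neutral_cong_left) auto
  then show "x \<in> cone t" using c(1) by (auto simp: cone_def intro!: exI[of _ "\<lambda>v. if v \<in> s then c v else 0"])
qed

lemma pt_in_cone: "v \<in> V \<Longrightarrow> v \<in> s \<Longrightarrow> finite s \<Longrightarrow> pt v \<in> cone s"
  unfolding pt_eq_scaleR by (intro cone_scaleR r_in_cone) auto

lemma normalize_eq_pt: "0 < c \<Longrightarrow> normalize (c *\<^sub>R r v) = pt v"
  by (simp add: pt_def normalize_scaleR)

lemma arc_of_singleton: "v \<in> V \<Longrightarrow> sphere 0 1 \<inter> cone {v} = {pt v}"
proof (intro equalityI subsetI)
  fix x assume v: "v \<in> V" and x: "x \<in> sphere 0 1 \<inter> cone {v}"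
  then obtain a where a: "x = a *\<^sub>R r v" "0 \<le> a" by (auto simp: cone_singleton)
  have "a \<noteq> 0" using x a by auto
  then have "normalize x = pt v" unfolding a(1) using a(2) by (intro normalize_eq_pt) simp
  then show "x \<in> {pt v}" using x normalize_id by simp
qed (use pt_sphere pt_in_cone in blast)

text \<open>
  An edge is the radial projection of the chord between its two ends.
\<close>

lemma side_arc:
  assumes f: "f \<in> F" and s: "{u, w} \<in> sides f"
  obtains p where "arc p" "path_image p = arc_of {u, w}" "pathstart p = pt u" "pathfinish p = pt w"
proof -
  have uw: "u \<in> set (cyc f)" "w \<in> set (cyc f)" "u \<noteq> w"
    using side_subset[OF f s] side_card[OF f s] by (auto simp: card_insert_if split: if_splits)
  let ?l = "linepath (r u) (r w)"
  let ?p = "normalize \<circ> ?l"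
  have l: "?l t = (1 - t) *\<^sub>R r u + t *\<^sub>R r w" for t by (simp add: linepath_def)
  have l0: "?l t \<noteq> 0" for t
    using independent_vertices[OF f uw, of "1 - t" t] unfolding l by auto
  have cont: "continuous_on {0..1} ?p"
  proof (rule continuous_on_compose)
    show "continuous_on {0..1} ?l" by (rule continuous_on_linepath)
    show "continuous_on (?l ` {0..1}) normalize" using l0 by (intro continuous_on_normalize) force
  qed
  have inj: "inj_on ?p {0..1}"
  proof (rule inj_onI)
    fix t t' assume "?p t = ?p t'"
    then obtain c where c: "0 < c" "?l t' = c *\<^sub>R ?l t"
      using normalize_eq_imp[of "?l t" "?l t'"] l0 by auto
    have "((1 - t') - c * (1 - t)) *\<^sub>R r u + (t' - c * t) *\<^sub>R r w = ?l t' - c *\<^sub>R ?l t"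
      unfolding l by (simp add: algebra_simps)
    also have "\<dots> = 0" using c by simp
    finally have e: "(1 - t') - c * (1 - t) = 0" "t' - c * t = 0"
      using independent_vertices[OF f uw] by blast+
    then have "c = 1" by (simp add: algebra_simps)
    then show "t = t'" using e by simp
  qed
  have image: "path_image ?p = arc_of {u, w}"
  proof (intro equalityI subsetI)
    fix x assume "x \<in> path_image ?p"
    then obtain t where t: "0 \<le> t" "t \<le> 1" "x = normalize (?l t)" by (auto simp: path_image_def)
    have "x = ((1 - t) / norm (?l t)) *\<^sub>R r u + (t / norm (?l t)) *\<^sub>R r w"
      unfolding t(3) normalize_def l by (simp add: scaleR_add_right divide_inverse mult.commute)
    also have "\<dots> \<in> cone {u, w}"
      using t by (intro cone_add cone_scaleR r_in_cone) auto
    finally have "x \<in> cone {u, w}" .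
    then show "x \<in> arc_of {u, w}" using normalize_in_sphere[OF l0] t(3) unfolding arc_of_def by blast
  next
    fix x assume "x \<in> arc_of {u, w}"
    then obtain a b where x: "x \<in> sphere 0 1" "0 \<le> a" "0 \<le> b" "x = a *\<^sub>R r u + b *\<^sub>R r w"
      unfolding arc_of_def cone_pair[OF uw(3)] by auto
    have ab: "0 < a + b"
    proof (rule ccontr)
      assume "\<not> 0 < a + b"
      then have "a = 0" "b = 0" using x by auto
      then show False using x by simp
    qed
    let ?t = "b / (a + b)"
    have "1 - ?t = a / (a + b)" using ab by (simp add: field_simps)
    then have "?l ?t = (1 / (a + b)) *\<^sub>R x" unfolding l x(4) by (simp add: scaleR_add_right divide_inverse mult.commute)
    then have "?p ?t = normalize x" using normalize_scaleR[of "1 / (a + b)" x] ab by simp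
    then have "x = ?p ?t" using normalize_id[OF x(1)] by simp
    moreover have "?t \<in> {0..1}" using x ab by (simp add: field_simps)
    ultimately show "x \<in> path_image ?p" unfolding path_image_def by blast
  qed
  show ?thesis
  proof (rule that[of ?p])
    show "arc ?p" using cont inj by (simp add: arc_def path_def)
    show "pathstart ?p = pt u" "pathfinish ?p = pt w"
      by (simp_all add: pathstart_def pathfinish_def pt_def linepath_def)
  qed (rule image)
qed


lemma side_doubleton:
  assumes "f \<in> F" "s \<in> sides f"
  obtains u w where "s = {u, w}" "u \<noteq> w" "u \<in> set (cyc f)" "w \<in> set (cyc f)" "u \<in> V" "w \<in> V"
proof -
  obtain i where "s = {cyc f ! i, cyc f ! (Suc i mod length (cyc f))}"
    "cyc f ! i \<noteq> cyc f ! (Suc i mod length (cyc f))" "s \<subseteq> set (cyc f)"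
    by (rule side_cases[OF assms])
  then show ?thesis using that V_I[OF assms(1)] by auto
qed

lemma arc_of_subset_closed_cone_iff:
  assumes "h \<in> F" "s \<in> sides h" "f \<in> F"
  shows "arc_of s \<subseteq> closed_cone f \<longleftrightarrow> s \<subseteq> set (cyc f)"
proof
  assume *: "arc_of s \<subseteq> closed_cone f"
  show "s \<subseteq> set (cyc f)"
  proof
    fix v assume v: "v \<in> s"
    then have "v \<in> V" using side_subset[OF assms(1,2)] V_I[OF assms(1)] by blast
    moreover have "pt v \<in> arc_of s"
      using pt_in_cone pt_sphere \<open>v \<in> V\<close> v side_finite[OF assms(1,2)] by (simp add: arc_of_def)
    ultimately show "v \<in> set (cyc f)" using * pt_in_closed_cone_iff[OF _ assms(3)] by blast
  qed
next
  assume "s \<subseteq> set (cyc f)"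
  then show "arc_of s \<subseteq> closed_cone f"
    using cone_subset_closed_cone[OF assms(3)] by (auto simp: arc_of_def)
qed

lemma arc_of_Int_verts:
  assumes "f \<in> F" "s \<in> sides f"
  shows "arc_of s \<inter> pt ` V = pt ` s"
proof (intro equalityI subsetI)
  fix x assume "x \<in> arc_of s \<inter> pt ` V"
  then obtain v where v: "v \<in> V" "x = pt v" "x \<in> arc_of s" by blast
  obtain g where g: "g \<in> F" "g \<noteq> f" "s \<subseteq> set (cyc g)" "set (cyc f) \<inter> set (cyc g) = s"
    by (rule side_other_face[OF assms])
  have "v \<in> set (cyc h)" if "h \<in> F" "s \<subseteq> set (cyc h)" for h
    using v that arc_of_subset_closed_cone_iff[OF assms that(1)] pt_in_closed_cone_iff[OF v(1) that(1)] by blast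
  then have "v \<in> s" using g side_subset[OF assms] assms(1) by blast
  then show "x \<in> pt ` s" using v by blast
next
  fix x assume "x \<in> pt ` s"
  then obtain v where v: "v \<in> s" "x = pt v" by blast
  then have "v \<in> V" using side_subset[OF assms] V_I[OF assms(1)] by blast
  then show "x \<in> arc_of s \<inter> pt ` V"
    using v pt_in_cone pt_sphere side_finite[OF assms] by (simp add: arc_of_def)
qed

lemma side_eqI:
  assumes "f \<in> F" "s \<in> sides f" "g \<in> F" "s' \<in> sides g" "pt ` s = pt ` s'"
  shows "s = s'"
  using assms side_subset V_I inj_on_image_eq_iff[OF inj_on_pt, of s s'] by blast

text \<open>
  At an interior point of an edge only the two normals of the adjacent cells are maximal, and these two
  cells determine the edge.
\<close>

lemma arc_of_Int_arc_of:
  assumes s: "f \<in> F" "s \<in> sides f" and s': "g \<in> F" "s' \<in> sides g" and ne: "s \<noteq> s'"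
  shows "arc_of s \<inter> arc_of s' \<subseteq> pt ` V"
proof
  fix x assume x: "x \<in> arc_of s \<inter> arc_of s'"
  obtain u w where uw: "s = {u, w}" "u \<noteq> w" "u \<in> set (cyc f)" "w \<in> set (cyc f)" "u \<in> V" "w \<in> V"
    by (rule side_doubleton[OF s])
  obtain c where c: "\<forall>v \<in> s. 0 \<le> c v" "x = (\<Sum>v \<in> s. c v *\<^sub>R r v)" and sph: "x \<in> sphere 0 1"
    using x by (auto simp: arc_of_def cone_def)
  have xe: "x = c u *\<^sub>R r u + c w *\<^sub>R r w" using c(2) uw by simp
  show "x \<in> pt ` V"
  proof (cases "c u = 0 \<or> c w = 0")
    case True
    then have "x = c u *\<^sub>R r u \<or> x = c w *\<^sub>R r w" using xe by auto
    then obtain v where v: "v \<in> {u, w}" "x = c v *\<^sub>R r v" by blast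
    then have "0 < c v" using sph c(1) uw(1) by (auto simp: order_less_le)
    then have "normalize x = pt v" using v(2) normalize_eq_pt by simp
    then have "x = pt v" using normalize_id[OF sph] by simp
    then show ?thesis using v(1) uw by blast
  next
    case False
    have pos: "\<forall>v \<in> s. 0 < c v" using False c(1) uw(1) by (auto simp: order_less_le)
    have "s \<subseteq> set (cyc h)" if h: "h \<in> F" "x \<in> closed_cone h" for h
    proof -
      have "x \<in> closed_cone f" using x arc_of_subset_closed_cone_iff[OF s s(1)] side_subset[OF s] by blast
      then have "n h \<bullet> x = n f \<bullet> x" using h s(1) by (auto simp: closed_cone_def intro: antisym)
      then have "\<forall>v \<in> s. 0 < c v \<longrightarrow> v \<in> set (cyc h)"
        using cone_tight[OF s(1) h(1) side_subset[OF s] c(1)] unfolding c(2) by blast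
      then show ?thesis using pos by blast
    qed
    moreover obtain g' where g': "g' \<in> F" "g' \<noteq> g" "s' \<subseteq> set (cyc g')" "set (cyc g) \<inter> set (cyc g') = s'"
      by (rule side_other_face[OF s'])
    moreover have "x \<in> closed_cone g" "x \<in> closed_cone g'"
      using x arc_of_subset_closed_cone_iff[OF s'] s'(1) g' side_subset[OF s'] by blast+
    ultimately have "s \<subseteq> s'" using s'(1) by blast
    then have "s = s'" using side_card[OF s] side_card[OF s'] side_finite[OF s'] by (metis card_subset_eq)
    then show ?thesis using ne by simp
  qed
qed

lemma closed_cone_convex: "convex (closed_cone f)"
proof -
  have "closed_cone f = (\<Inter>g \<in> F. {x. (n g - n f) \<bullet> x \<le> 0})"
    by (auto simp: closed_cone_def inner_diff_left)
  then show ?thesis by (auto intro!: convex_INT convex_halfspace_le)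
qed

lemma closed_cone_closed: "closed (closed_cone f)"
proof -
  have "closed_cone f = (\<Inter>g \<in> F. {x. n g \<bullet> x \<le> n f \<bullet> x})" by (auto simp: closed_cone_def)
  moreover have "closed {x. n g \<bullet> x \<le> n f \<bullet> x}" for g
    by (intro closed_Collect_le continuous_intros)
  ultimately show ?thesis by (auto intro: closed_INT)
qed

definition open_cone :: "'f \<Rightarrow> (real ^ 3) set" where
  "open_cone f = {x. \<forall>g \<in> F - {f}. n g \<bullet> x < n f \<bullet> x}"

lemma open_cone_open: "open (open_cone f)"
proof -
  have "open_cone f = (\<Inter>g \<in> F - {f}. {x. n g \<bullet> x < n f \<bullet> x})" by (auto simp: open_cone_def)
  moreover have "open {x. n g \<bullet> x < n f \<bullet> x}" for g
    by (intro open_Collect_less continuous_intros)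
  ultimately show ?thesis using finite_F by (auto intro: open_INT)
qed

lemma open_cone_convex: "convex (open_cone f)"
proof -
  have "open_cone f = (\<Inter>g \<in> F - {f}. {x. (n g - n f) \<bullet> x < 0})"
    by (auto simp: open_cone_def inner_diff_left)
  then show ?thesis by (auto intro!: convex_INT convex_halfspace_lt)
qed

lemma cell_eq: "cell f = sphere 0 1 \<inter> open_cone f"
  by (auto simp: cell_def open_cone_def)

lemma open_cone_scaleR: "0 < c \<Longrightarrow> c *\<^sub>R x \<in> open_cone f \<longleftrightarrow> x \<in> open_cone f"
  by (simp add: open_cone_def)

lemma open_cone_subset: "open_cone f \<subseteq> closed_cone f"
proof
  fix x assume x: "x \<in> open_cone f"
  have "n g \<bullet> x \<le> n f \<bullet> x" if "g \<in> F" for g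
    using x that by (cases "g = f") (auto simp: open_cone_def less_imp_le)
  then show "x \<in> closed_cone f" by (simp add: closed_cone_def)
qed

lemma cell_Int_closed_cone:
  assumes "f \<in> F" "g \<in> F" "f \<noteq> g"
  shows "cell f \<inter> closed_cone g = {}"
proof -
  have False if "x \<in> cell f" "x \<in> closed_cone g" for x
  proof -
    have "n g \<bullet> x < n f \<bullet> x" using that(1) assms by (simp add: cell_def)
    moreover have "n f \<bullet> x \<le> n g \<bullet> x" using that(2) assms by (simp add: closed_cone_def)
    ultimately show False by simp
  qed
  then show ?thesis by blast
qed

lemma sum_in_open_cone:
  assumes "f \<in> F"
  shows "(\<Sum>v \<in> set (cyc f). r v) \<in> open_cone f"
proof -
  let ?x = "\<Sum>v \<in> set (cyc f). r v"
  have x: "?x = (\<Sum>v \<in> set (cyc f). 1 *\<^sub>R r v)" by simp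
  have "?x \<in> closed_cone f"
    unfolding closed_cone_eq[OF assms] cone_def x by (intro CollectI exI[of _ "\<lambda>_. 1"]) simp
  moreover have "n g \<bullet> ?x \<noteq> n f \<bullet> ?x" if g: "g \<in> F" "g \<noteq> f" for g
  proof
    assume "n g \<bullet> ?x = n f \<bullet> ?x"
    then have "set (cyc f) \<subseteq> set (cyc g)"
      using cone_tight[OF assms g(1) order_refl, of "\<lambda>_. 1"] by auto
    then have "card (set (cyc f)) \<le> 2" using meet_card[OF assms g(1)] g(2) by (simp add: Int_absorb2)
    then show False using length_cyc[OF assms] distinct_cyc[OF assms] by (simp add: distinct_card)
  qed
  ultimately show ?thesis by (auto simp: open_cone_def closed_cone_def order_less_le)
qed

lemma zero_notin_open_cone:
  assumes "f \<in> F"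
  shows "0 \<notin> open_cone f"
proof -
  have "F \<noteq> {f}"
  proof
    assume "F = {f}"
    obtain s where "s \<in> sides f" using length_cyc[OF assms] by (force simp: sides_def)
    then have "card {g \<in> F. s \<subseteq> set (cyc g)} = 2" using side_two_faces assms by blast
    moreover have "card {g \<in> F. s \<subseteq> set (cyc g)} \<le> card {f}"
      using \<open>F = {f}\<close> by (intro card_mono) auto
    ultimately show False by simp
  qed
  then show ?thesis using assms by (auto simp: open_cone_def)
qed

lemma cell_nonempty:
  assumes "f \<in> F"
  shows "cell f \<noteq> {}"
proof -
  let ?x = "\<Sum>v \<in> set (cyc f). r v"
  have "?x \<noteq> 0" using sum_in_open_cone zero_notin_open_cone assms by metis
  then have "normalize ?x \<in> cell f"
    using normalize_in_sphere sum_in_open_cone[OF assms]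
    unfolding cell_eq normalize_def by (simp add: open_cone_scaleR)
  then show ?thesis by blast
qed

lemma cell_connected:
  assumes "f \<in> F"
  shows "connected (cell f)"
proof -
  have 0: "0 \<notin> open_cone f" using zero_notin_open_cone[OF assms] .
  have "cell f = normalize ` open_cone f"
  proof (intro equalityI subsetI)
    fix x assume "x \<in> cell f"
    then have "normalize x = x" "x \<in> open_cone f" unfolding cell_eq using normalize_id by blast+
    then show "x \<in> normalize ` open_cone f" by (metis imageI)
  next
    fix x assume "x \<in> normalize ` open_cone f"
    then obtain y where y: "y \<in> open_cone f" "x = normalize y" by blast
    then have "y \<noteq> 0" using 0 by metis
    then show "x \<in> cell f" using y normalize_in_sphere unfolding cell_eq normalize_def
      by (simp add: open_cone_scaleR)
  qed
  moreover have "connected (normalize ` open_cone f)"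
    using 0 by (intro connected_continuous_image continuous_on_normalize convex_connected open_cone_convex)
  ultimately show ?thesis by simp
qed

lemma cells_disjoint: "f \<in> F \<Longrightarrow> g \<in> F \<Longrightarrow> f \<noteq> g \<Longrightarrow> cell f \<inter> cell g = {}"
  using cell_Int_closed_cone[of f g] open_cone_subset[of g] by (auto simp: cell_eq)

lemma inj_on_cell: "inj_on cell F"
  using cells_disjoint cell_nonempty by (intro inj_onI) (metis inf.idem)

text \<open>
  A boundary point of a cell lies in a second closed cell, hence in the cone over common vertices, which
  are among the two ends of a side.
\<close>

lemma not_cell_cases:
  assumes f: "f \<in> F" and x: "x \<in> sphere 0 1 \<inter> closed_cone f" "x \<notin> cell f"
  obtains s where "s \<in> sides f" "x \<in> arc_of s"
proof -
  obtain g where g: "g \<in> F" "g \<noteq> f" "n f \<bullet> x \<le> n g \<bullet> x"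
    using x by (auto simp: cell_def not_less)
  then have "x \<in> closed_cone g" using x by (force simp: closed_cone_def)
  then have xc: "x \<in> cone (set (cyc f) \<inter> set (cyc g))" using x closed_cone_Int[OF f g(1)] by blast
  have side_at: "\<exists>s \<in> sides f. v \<in> s" if v: "v \<in> set (cyc f)" for v
  proof -
    obtain i where i: "i < length (cyc f)" "cyc f ! i = v" using v by (auto simp: in_set_conv_nth)
    then have "{v, cyc f ! (Suc i mod length (cyc f))} \<in> sides f" by (auto simp: sides_def)
    then show ?thesis by blast
  qed
  have "cyc f \<noteq> []" using length_cyc[OF f] by auto
  then obtain v where v: "v \<in> set (cyc f)" by (cases "cyc f") auto
  consider "set (cyc f) \<inter> set (cyc g) = {}" | v where "set (cyc f) \<inter> set (cyc g) = {v}"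
    | "set (cyc f) \<inter> set (cyc g) \<in> sides f"
    using meet_sides[OF f g(1)] g(2) by blast
  then have "\<exists>s \<in> sides f. set (cyc f) \<inter> set (cyc g) \<subseteq> s"
  proof cases
    case 1
    then show ?thesis using side_at[OF v] unfolding 1 by blast
  next
    case (2 w)
    then have "w \<in> set (cyc f)" by auto
    then show ?thesis using side_at[of w] unfolding 2 by simp
  next
    case 3
    then show ?thesis by (rule rev_bexI) (rule order_refl)
  qed
  then obtain s where s: "s \<in> sides f" "set (cyc f) \<inter> set (cyc g) \<subseteq> s" by blast
  then have "x \<in> cone s" using cone_mono side_finite[OF f] xc by blast
  then show ?thesis using that s x by (auto simp: arc_of_def)
qed

lemma arc_of_Int_cell:
  assumes "h \<in> F" "s \<in> sides h" "f \<in> F"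
  shows "arc_of s \<inter> cell f = {}"
proof -
  obtain g where g: "g \<in> F" "g \<noteq> h" "s \<subseteq> set (cyc g)" by (rule side_other_face[OF assms(1,2)])
  have "arc_of s \<subseteq> closed_cone h" "arc_of s \<subseteq> closed_cone g"
    using arc_of_subset_closed_cone_iff assms g side_subset by auto
  moreover have "cell f \<inter> closed_cone h = {} \<or> cell f \<inter> closed_cone g = {}"
    using cell_Int_closed_cone[OF assms(3)] g assms(1) by metis
  ultimately show ?thesis by blast
qed

lemma verts_in_arcs:
  assumes "v \<in> V"
  obtains f s where "f \<in> F" "s \<in> sides f" "v \<in> s" "pt v \<in> arc_of s"
proof -
  obtain f where f: "f \<in> F" "v \<in> set (cyc f)" using assms by (auto simp: V_def)
  then obtain i where i: "i < length (cyc f)" "cyc f ! i = v" by (auto simp: in_set_conv_nth)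
  then have s: "{v, cyc f ! (Suc i mod length (cyc f))} \<in> sides f" by (auto simp: sides_def)
  then show ?thesis using that[OF f(1) s] pt_in_cone pt_sphere assms by (simp add: arc_of_def)
qed

lemma union_cells: "\<Union>(cell ` F) = sphere 0 1 - (pt ` V \<union> \<Union>(arc_of ` (\<Union>f \<in> F. sides f)))"
proof -
  let ?E = "\<Union>(arc_of ` (\<Union>f \<in> F. sides f))"
  have "pt ` V \<subseteq> \<Union>(arc_of ` (\<Union>f \<in> F. sides f))"
  proof
    fix x assume "x \<in> pt ` V"
    then obtain v where v: "v \<in> V" "x = pt v" by blast
    obtain f s where "f \<in> F" "s \<in> sides f" "v \<in> s" "pt v \<in> arc_of s" by (rule verts_in_arcs[OF v(1)])
    then show "x \<in> \<Union>(arc_of ` (\<Union>f \<in> F. sides f))" using v(2) by blast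
  qed
  then have absorb: "pt ` V \<union> ?E = ?E" by (rule Un_absorb1)
  show ?thesis unfolding absorb
  proof (intro equalityI subsetI)
    fix x assume "x \<in> \<Union>(cell ` F)"
    then obtain f where f: "f \<in> F" "x \<in> cell f" by blast
    then have "x \<notin> arc_of s" if "h \<in> F" "s \<in> sides h" for h s
      using arc_of_Int_cell[OF that f(1)] by blast
    moreover have "x \<in> sphere 0 1" using f by (simp add: cell_def)
    ultimately show "x \<in> sphere 0 1 - \<Union>(arc_of ` (\<Union>f \<in> F. sides f))" by blast
  next
    fix x assume x: "x \<in> sphere 0 1 - \<Union>(arc_of ` (\<Union>f \<in> F. sides f))"
    obtain f where f: "f \<in> F" "x \<in> closed_cone f" by (rule closed_cone_exists)
    have "x \<in> cell f"
    proof (rule ccontr)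
      assume "x \<notin> cell f"
      then obtain s where "s \<in> sides f" "x \<in> arc_of s"
        by (rule not_cell_cases[OF f(1), rotated]) (use x f in auto)
      then show False using x f by blast
    qed
    then show "x \<in> \<Union>(cell ` F)" using f by blast
  qed
qed

lemma faces_eq_components:
  "components (sphere 0 1 - (pt ` V \<union> \<Union>(arc_of ` (\<Union>f \<in> F. sides f)))) = cell ` F"
  unfolding union_cells[symmetric]
proof (rule components_eq_open_partition)
  show "{} \<notin> cell ` F" using cell_nonempty by force
  fix U assume "U \<in> cell ` F"
  then obtain f where f: "f \<in> F" "U = cell f" by blast
  show "connected U" using f cell_connected by simp
  have "\<Union>(cell ` F) \<subseteq> sphere 0 1" by (auto simp: cell_def)
  then have "U = \<Union>(cell ` F) \<inter> open_cone f" using f by (auto simp: cell_eq)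
  then show "openin (top_of_set (\<Union>(cell ` F))) U"
    using open_cone_open openin_open by metis
  fix W assume "W \<in> cell ` F" "U \<noteq> W"
  then show "U \<inter> W = {}" using f cells_disjoint by blast
qed simp

text \<open>
  Moving a point of the closed cone slightly towards the sum of all rays of the cell, which is an
  interior direction, brings it into the cell.
\<close>

lemma closure_cell:
  assumes f: "f \<in> F"
  shows "closure (cell f) = sphere 0 1 \<inter> closed_cone f"
proof
  show "closure (cell f) \<subseteq> sphere 0 1 \<inter> closed_cone f"
    using open_cone_subset by (intro closure_minimal closed_Int closed_cone_closed) (auto simp: cell_eq)
  show "sphere 0 1 \<inter> closed_cone f \<subseteq> closure (cell f)"
  proof
    fix x assume x: "x \<in> sphere 0 1 \<inter> closed_cone f"
    let ?y = "\<Sum>v \<in> set (cyc f). r v"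
    let ?z = "\<lambda>k. x + (1 / real (Suc k)) *\<^sub>R ?y"
    have z: "?z k \<in> open_cone f" for k
    proof -
      have "n g \<bullet> x + (1 / real (Suc k)) * (n g \<bullet> ?y) < n f \<bullet> x + (1 / real (Suc k)) * (n f \<bullet> ?y)" if "g \<in> F - {f}" for g
      proof (rule add_le_less_mono)
        show "n g \<bullet> x \<le> n f \<bullet> x" using x that by (simp add: closed_cone_def)
        have "n g \<bullet> ?y < n f \<bullet> ?y" using sum_in_open_cone[OF f] that unfolding open_cone_def by blast
        then show "(1 / real (Suc k)) * (n g \<bullet> ?y) < (1 / real (Suc k)) * (n f \<bullet> ?y)"
          by (intro mult_strict_left_mono) auto
      qed
      then show ?thesis by (simp add: open_cone_def inner_add_right)
    qed
    have z0: "?z k \<noteq> 0" for k using z zero_notin_open_cone[OF f] by metis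
    have "(\<lambda>k. 1 / real (Suc k)) \<longlonglongrightarrow> 0" using LIMSEQ_inverse_real_of_nat by (simp add: inverse_eq_divide)
    then have lim: "?z \<longlonglongrightarrow> x + 0 *\<^sub>R ?y" by (intro tendsto_intros)
    have "(\<lambda>k. normalize (?z k)) \<longlonglongrightarrow> normalize x"
      unfolding normalize_def using lim x by (intro tendsto_intros) auto
    moreover have "normalize x = x" using x normalize_id by blast
    moreover have "normalize (?z k) \<in> cell f" for k
      using z[of k] z0[of k] normalize_in_sphere[OF z0[of k]] unfolding cell_eq normalize_def
      by (simp add: open_cone_scaleR del: of_nat_Suc)
    ultimately show "x \<in> closure (cell f)" unfolding closure_sequential by metis
  qed
qed

end

text \<open>
  That the homeomorphism of the closed disk onto the body takes the open disk to the interior follows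
  from invariance of domain, applied in both directions.
\<close>

lemma convex_planar_body_disk:
  fixes D :: "complex set"
  assumes "convex D" "compact D" "interior D \<noteq> {}"
  obtains h k where "homeomorphism (cball (0 :: complex) 1) D h k" "h ` ball 0 1 = interior D"
proof -
  have "D homeomorphic cball (0 :: complex) 1"
    using homeomorphic_convex_compact_cball[OF assms, of 1 0] by simp
  then obtain h k where hk: "homeomorphism (cball (0 :: complex) 1) D h k"
    by (metis homeomorphic_sym homeomorphic_def)
  have hD: "h ` ball 0 1 \<subseteq> interior D"
  proof (rule interior_maximal)
    show "h ` ball 0 1 \<subseteq> D" using hk ball_subset_cball by (auto simp: homeomorphism_def)
    show "open (h ` ball 0 1)"
    proof (rule invariance_of_domain)
      show "continuous_on (ball 0 1) h"
        using hk continuous_on_subset[OF _ ball_subset_cball] by (auto simp: homeomorphism_def)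
      show "inj_on h (ball 0 1)"
        using hk by (intro inj_on_inverseI[of _ k]) (auto simp: homeomorphism_def)
    qed simp
  qed
  have kD: "k ` interior D \<subseteq> ball 0 1"
  proof -
    have "k ` interior D \<subseteq> interior (cball 0 1)"
    proof (rule interior_maximal)
      show "k ` interior D \<subseteq> cball 0 1" using hk interior_subset[of D] by (auto simp: homeomorphism_def)
      show "open (k ` interior D)"
      proof (rule invariance_of_domain)
        show "continuous_on (interior D) k"
          using hk continuous_on_subset[OF _ interior_subset] by (auto simp: homeomorphism_def)
        show "inj_on k (interior D)"
          using hk interior_subset[of D] by (intro inj_on_inverseI[of _ h]) (auto simp: homeomorphism_def)
      qed simp
    qed
    then show ?thesis by simp
  qed
  have "interior D \<subseteq> h ` ball 0 1"
  proof
    fix x assume x: "x \<in> interior D"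
    then have "x \<in> D" using interior_subset by blast
    then have "h (k x) = x" using homeomorphism_apply2[OF hk] by simp
    moreover have "k x \<in> ball 0 1" using x kD by blast
    ultimately show "x \<in> h ` ball 0 1" by (metis imageI)
  qed
  with hD have eq: "h ` ball 0 1 = interior D" by (rule equalityI)
  show ?thesis using that[OF hk eq] .
qed

context convex_fan begin

lemma slice_bounded:
  assumes f: "f \<in> F"
  shows "bounded {x \<in> closed_cone f. n f \<bullet> x = 1}"
proof (rule boundedI)
  fix x assume x: "x \<in> {x \<in> closed_cone f. n f \<bullet> x = 1}"
  then obtain c where c: "\<forall>v \<in> set (cyc f). 0 \<le> c v" "x = (\<Sum>v \<in> set (cyc f). c v *\<^sub>R r v)"
    using closed_cone_eq[OF f] by (auto simp: cone_def)
  have nn: "0 \<le> c v * (n f \<bullet> r v)" if "v \<in> set (cyc f)" for v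
    using normal_pos[OF f that] c(1) that by simp
  have one: "(\<Sum>v \<in> set (cyc f). c v * (n f \<bullet> r v)) = 1" using x by (simp add: c(2) inner_sum_right)
  have "norm (c v *\<^sub>R r v) \<le> norm (r v) / (n f \<bullet> r v)" if v: "v \<in> set (cyc f)" for v
  proof -
    have "c v * (n f \<bullet> r v) \<le> 1" unfolding one[symmetric] using v nn by (intro member_le_sum) auto
    then have "c v \<le> 1 / (n f \<bullet> r v)" using normal_pos[OF f v] by (simp add: field_simps)
    then have "c v * norm (r v) \<le> 1 / (n f \<bullet> r v) * norm (r v)" by (rule mult_right_mono) simp
    then show ?thesis using c(1) v by simp
  qed
  then show "norm x \<le> (\<Sum>v \<in> set (cyc f). norm (r v) / (n f \<bullet> r v))"
    unfolding c(2) by (rule sum_norm_le)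
qed

text \<open>
  Central projection onto the plane \<open>n f \<bullet> x = 1\<close> identifies the closed cell with a compact convex planar
  body.  The plane meets every ray of the cone once, since \<open>n f\<close> is positive on the cone.
\<close>

lemma cell_disk:
  assumes f: "f \<in> F"
  obtains h k where "homeomorphism (cball (0 :: complex) 1) (closure (cell f)) h k" "h ` ball 0 1 = cell f"
proof -
  let ?m = "n f"
  let ?y = "\<Sum>v \<in> set (cyc f). r v"
  have y: "?y \<in> open_cone f" using sum_in_open_cone[OF f] .
  have y0: "?y \<noteq> 0" using y zero_notin_open_cone[OF f] by metis
  have my: "0 < ?m \<bullet> ?y" using normal_dot_pos[OF f _ y0] y open_cone_subset by blast
  then have m: "?m \<noteq> 0" by auto
  let ?H = "{x. ?m \<bullet> x = 0}"
  have "dim (UNIV :: complex set) = dim ?H" using dim_hyperplane[OF m] by simp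
  then obtain \<phi> \<psi> where \<phi>: "linear \<phi>" "\<phi> ` (UNIV :: complex set) = ?H"
    "\<And>z. norm (\<phi> z) = norm z" "\<And>x. x \<in> ?H \<Longrightarrow> \<phi> (\<psi> x) = x"
  proof (rule isometries_subspaces[OF subspace_UNIV subspace_hyperplane[of ?m]])
    fix \<phi> :: "complex \<Rightarrow> real ^ 3" and \<psi>
    assume "linear \<phi>" "\<phi> ` UNIV = ?H" "\<And>z. z \<in> UNIV \<Longrightarrow> norm (\<phi> z) = norm z"
      "\<And>x. x \<in> ?H \<Longrightarrow> \<phi> (\<psi> x) = x"
    then show thesis using that by blast
  qed
  have \<phi>m: "?m \<bullet> \<phi> z = 0" for z using \<phi>(2) by blast
  define c where "c = (1 / (?m \<bullet> ?m)) *\<^sub>R ?m"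
  have c: "?m \<bullet> c = 1" using m by (simp add: c_def)
  define \<theta> where "\<theta> z = c + \<phi> z" for z
  have m\<theta>: "?m \<bullet> \<theta> z = 1" for z by (simp add: \<theta>_def inner_add_right c \<phi>m)
  have \<theta>0: "\<theta> z \<noteq> 0" for z using m\<theta>[of z] by auto
  have cont: "continuous_on S \<theta>" for S
    unfolding \<theta>_def using \<phi>(1) by (intro continuous_intros linear_continuous_on) (simp add: linear_conv_bounded_linear)
  have onto: "\<exists>z. x = (?m \<bullet> x) *\<^sub>R \<theta> z" if "0 < ?m \<bullet> x" for x
  proof -
    let ?w = "(1 / (?m \<bullet> x)) *\<^sub>R x - c"
    have "?w \<in> ?H" using that by (simp add: inner_diff_right c)
    then have "\<theta> (\<psi> ?w) = (1 / (?m \<bullet> x)) *\<^sub>R x" by (simp add: \<theta>_def \<phi>(4))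
    then have "x = (?m \<bullet> x) *\<^sub>R \<theta> (\<psi> ?w)" using that by simp
    then show ?thesis by blast
  qed
  have affine: "\<theta> ((1 - t) *\<^sub>R z + t *\<^sub>R w) = (1 - t) *\<^sub>R \<theta> z + t *\<^sub>R \<theta> w" for t z w
    unfolding \<theta>_def linear_add[OF \<phi>(1)] linear_scale[OF \<phi>(1)] by (simp add: algebra_simps)
  define D where "D = \<theta> -` closed_cone f"
  define I where "I = \<theta> -` open_cone f"
  have "convex D"
    unfolding D_def convex_alt vimage_def mem_Collect_eq affine
    using closed_cone_convex[of f] by (simp add: convex_alt)
  have "closed D" unfolding D_def using closed_cone_closed[of f] cont[of UNIV] by (rule closed_vimage)
  moreover have "bounded D"
  proof -
    obtain B where B: "\<And>x. x \<in> closed_cone f \<Longrightarrow> ?m \<bullet> x = 1 \<Longrightarrow> norm x \<le> B"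
      using slice_bounded[OF f] by (auto simp: bounded_iff)
    have "norm z \<le> B + norm c" if "z \<in> D" for z
    proof -
      have "norm (\<theta> z) \<le> B" using that B m\<theta> by (simp add: D_def)
      moreover have "norm (\<phi> z) \<le> norm (\<theta> z) + norm c"
        using norm_triangle_ineq4[of "\<theta> z" c] by (simp add: \<theta>_def)
      ultimately show ?thesis using \<phi>(3)[of z] by simp
    qed
    then show ?thesis by (rule boundedI)
  qed
  ultimately have "compact D" by (simp add: compact_eq_bounded_closed)
  have "open I" unfolding I_def using open_cone_open[of f] cont[of UNIV] by (rule open_vimage)
  have "I \<subseteq> D" unfolding I_def D_def using open_cone_subset by auto
  then have I_int: "I \<subseteq> interior D" using \<open>open I\<close> by (rule interior_maximal)
  obtain z0 where z0: "?y = (?m \<bullet> ?y) *\<^sub>R \<theta> z0" using onto[OF my] by blast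
  have z0I: "z0 \<in> I" using y my open_cone_scaleR[of "?m \<bullet> ?y" "\<theta> z0" f] unfolding I_def z0[symmetric] by simp
  have "interior D \<subseteq> I"
  proof
    fix z assume "z \<in> interior D"
    then obtain e where e: "0 < e" "ball z e \<subseteq> D" using mem_interior by blast
    \<comment> \<open>The segment from the inner point \<open>z0\<close> to \<open>z\<close> can be prolonged beyond \<open>z\<close> within the body; as the
      inequalities of the cone are strict at \<open>z0\<close>, they are strict at \<open>z\<close>.\<close>
    define t where "t = e / (2 * (norm (z - z0) + 1))"
    have t: "0 < t" using e(1) by (simp add: t_def add_nonneg_pos)
    define w where "w = (1 - (1 + t)) *\<^sub>R z0 + (1 + t) *\<^sub>R z"
    have "w - z = t *\<^sub>R (z - z0)" by (simp add: w_def algebra_simps)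
    then have "norm (w - z) = t * norm (z - z0)" using t by simp
    also have "\<dots> < e" unfolding t_def using e(1) by (simp add: divide_simps add_nonneg_pos)
    finally have "w \<in> D" using e(2) by (auto simp: dist_norm norm_minus_commute)
    have "n g \<bullet> \<theta> z < ?m \<bullet> \<theta> z" if g: "g \<in> F - {f}" for g
    proof -
      let ?d = "n g - ?m"
      have "?d \<bullet> \<theta> w = - t * (?d \<bullet> \<theta> z0) + (1 + t) * (?d \<bullet> \<theta> z)"
        unfolding w_def affine by (simp add: inner_add_right inner_diff_left algebra_simps)
      moreover have "?d \<bullet> \<theta> w \<le> 0" using \<open>w \<in> D\<close> g by (simp add: D_def closed_cone_def inner_diff_left)
      moreover have "?d \<bullet> \<theta> z0 < 0" using z0I g by (simp add: I_def open_cone_def inner_diff_left)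
      then have "t * (?d \<bullet> \<theta> z0) < 0" using t by (simp add: mult_pos_neg)
      ultimately have "(1 + t) * (?d \<bullet> \<theta> z) < 0" by simp
      then have "?d \<bullet> \<theta> z < 0" using t by (simp add: mult_less_0_iff)
      then show ?thesis by (simp add: inner_diff_left)
    qed
    then show "z \<in> I" by (simp add: I_def open_cone_def)
  qed
  with I_int have int: "interior D = I" by blast
  have ne: "interior D \<noteq> {}" using z0I int by blast
  obtain h k where hk: "homeomorphism (cball (0 :: complex) 1) D h k" "h ` ball 0 1 = interior D"
    by (rule convex_planar_body_disk[OF \<open>convex D\<close> \<open>compact D\<close> ne])
  let ?p = "normalize \<circ> \<theta>"
  have p: "continuous_on D ?p"
    by (intro continuous_on_compose cont continuous_on_normalize) (metis \<theta>0 imageE)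
  have inj: "inj_on ?p D"
  proof (rule inj_onI)
    fix z w assume "?p z = ?p w"
    then obtain t where t: "\<theta> w = t *\<^sub>R \<theta> z" using normalize_eq_imp \<theta>0 by (metis comp_apply)
    then have "?m \<bullet> \<theta> w = t * (?m \<bullet> \<theta> z)" by simp
    then have "t = 1" by (simp add: m\<theta>)
    then have "\<phi> z = \<phi> w" using t by (simp add: \<theta>_def)
    then have "norm (z - w) = 0" using \<phi>(3)[of "z - w"] linear_diff[OF \<phi>(1)] by simp
    then show "z = w" by simp
  qed
  have image: "?p ` (\<theta> -` S) = sphere 0 1 \<inter> S"
    if scale: "\<And>t x. 0 < t \<Longrightarrow> t *\<^sub>R x \<in> S \<longleftrightarrow> x \<in> S" and sub: "S \<subseteq> closed_cone f" for S
  proof (intro equalityI subsetI)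
    fix x assume "x \<in> ?p ` (\<theta> -` S)"
    then obtain z where z: "x = normalize (\<theta> z)" "\<theta> z \<in> S" by auto
    then show "x \<in> sphere 0 1 \<inter> S"
      using normalize_in_sphere[OF \<theta>0[of z]] scale[of "inverse (norm (\<theta> z))"] \<theta>0[of z]
      by (simp add: normalize_def)
  next
    fix x assume x: "x \<in> sphere 0 1 \<inter> S"
    then have "x \<noteq> 0" by auto
    then have mx: "0 < ?m \<bullet> x" using normal_dot_pos[OF f] x sub by blast
    then obtain z where z: "x = (?m \<bullet> x) *\<^sub>R \<theta> z" using onto by blast
    then have "\<theta> z \<in> S" using scale[OF mx] x by (metis IntD2)
    moreover have "normalize (\<theta> z) = x" using normalize_scaleR[OF mx, of "\<theta> z"] z normalize_id x by (metis IntD1)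
    ultimately show "x \<in> ?p ` (\<theta> -` S)" by (metis comp_apply imageI vimageI)
  qed
  have "?p ` D = closure (cell f)"
    unfolding D_def closure_cell[OF f] using closed_cone_scaleR by (intro image) auto
  then obtain q where "homeomorphism D (closure (cell f)) ?p q"
    using homeomorphism_compact[OF \<open>compact D\<close> p _ inj] by blast
  with hk(1) have "homeomorphism (cball 0 1) (closure (cell f)) (?p \<circ> h) (k \<circ> q)"
    by (rule homeomorphism_compose)
  moreover have "(?p \<circ> h) ` ball 0 1 = cell f"
  proof -
    have "(?p \<circ> h) ` ball 0 1 = ?p ` (\<theta> -` open_cone f)"
      unfolding image_comp[symmetric] hk(2) int I_def ..
    also have "\<dots> = cell f"
      unfolding cell_eq using open_cone_scaleR open_cone_subset by (intro image) auto
    finally show ?thesis .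
  qed
  ultimately show ?thesis by (rule that)
qed


lemma finite_V: "finite V"
  unfolding V_def using finite_F by simp

lemma finite_sides: "finite (sides f)"
  by (simp add: sides_def)

lemma card_sides:
  assumes f: "f \<in> F"
  shows "card (sides f) = length (cyc f)"
proof -
  let ?k = "length (cyc f)"
  have 3: "3 \<le> ?k" using length_cyc[OF f] .
  have "inj_on (\<lambda>i. {cyc f ! i, cyc f ! (Suc i mod ?k)}) {..<?k}"
  proof (rule inj_onI)
    fix i j assume i: "i \<in> {..<?k}" and j: "j \<in> {..<?k}"
      and eq: "{cyc f ! i, cyc f ! (Suc i mod ?k)} = {cyc f ! j, cyc f ! (Suc j mod ?k)}"
    have m: "Suc i mod ?k < ?k" "Suc j mod ?k < ?k" using 3 by (intro mod_less_divisor; linarith)+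
    have idx: "cyc f ! a = cyc f ! b \<longleftrightarrow> a = b" if "a < ?k" "b < ?k" for a b
      using nth_eq_iff_index_eq[OF distinct_cyc[OF f] that] .
    have "i = j \<or> (i = Suc j mod ?k \<and> Suc i mod ?k = j)"
      using eq i j m idx unfolding doubleton_eq_iff by auto
    moreover have False if "i = Suc j mod ?k" "Suc i mod ?k = j"
    proof (cases "Suc j = ?k")
      case True
      then have "i = 0" using that by simp
      then show False using that True 3 by simp
    next
      case False
      then have "i = Suc j" using that j by simp
      then show False using that 3 i by (cases "Suc i = ?k") auto
    qed
    ultimately show "i = j" by blast
  qed
  then show ?thesis unfolding sides_def by (simp add: card_image)
qed

lemma inj_on_arc_of: "inj_on arc_of (\<Union>f \<in> F. sides f)"
proof (rule inj_onI)
  fix s s' assume "s \<in> (\<Union>f \<in> F. sides f)" "s' \<in> (\<Union>f \<in> F. sides f)" and eq: "arc_of s = arc_of s'"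
  then obtain f g where "f \<in> F" "s \<in> sides f" "g \<in> F" "s' \<in> sides g" by blast
  then show "s = s'" using arc_of_Int_verts eq side_eqI by metis
qed

lemma simple_graph: "simple_graph_on (sphere 0 1) graph"
  unfolding simple_graph_on_def
proof (intro conjI ballI impI)
  show "verts graph \<subseteq> sphere 0 1" using pt_sphere by (auto simp: graph_def simp del: mem_sphere)
  fix e assume "e \<in> edges graph"
  then obtain f s where fs: "f \<in> F" "s \<in> sides f" "e = arc_of s" by (auto simp: graph_def)
  show "e \<subseteq> sphere 0 1" using fs by (auto simp: arc_of_def)
  obtain u w where uw: "s = {u, w}" by (rule side_doubleton[OF fs(1,2)])
  obtain p where p: "arc p" "path_image p = arc_of {u, w}" "pathstart p = pt u" "pathfinish p = pt w"
    by (rule side_arc[OF fs(1,2)[unfolded uw]])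
  have "e \<inter> verts graph = {pathstart p, pathfinish p}"
    using arc_of_Int_verts[OF fs(1,2)] fs(3) uw p by (simp add: graph_def)
  then show "\<exists>g. arc g \<and> path_image g = e \<and> e \<inter> verts graph = {pathstart g, pathfinish g}"
    using p fs(3) uw by blast
  fix e' assume "e' \<in> edges graph" and ne: "e \<noteq> e'"
  then obtain f' s' where fs': "f' \<in> F" "s' \<in> sides f'" "e' = arc_of s'" by (auto simp: graph_def)
  then show "e \<inter> e' \<subseteq> verts graph"
    using arc_of_Int_arc_of[OF fs(1,2) fs'(1,2)] ne fs(3) by (auto simp: graph_def)
next
  show "inj_on (\<lambda>e. e \<inter> verts graph) (edges graph)"
  proof (rule inj_onI)
    fix e e' assume "e \<in> edges graph" "e' \<in> edges graph" and eq: "e \<inter> verts graph = e' \<inter> verts graph"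
    then obtain f s f' s' where fs: "f \<in> F" "s \<in> sides f" "e = arc_of s" "f' \<in> F" "s' \<in> sides f'" "e' = arc_of s'"
      by (auto simp: graph_def)
    have "pt ` s = pt ` s'" using eq arc_of_Int_verts fs by (simp add: graph_def)
    then have "s = s'" using side_eqI fs by metis
    then show "e = e'" using fs by simp
  qed
qed

lemma edges_in_closure_cell:
  assumes f: "f \<in> F"
  shows "{e \<in> edges graph. e \<subseteq> closure (cell f)} = arc_of ` sides f"
proof (intro equalityI subsetI)
  fix e assume "e \<in> {e \<in> edges graph. e \<subseteq> closure (cell f)}"
  then obtain g s where gs: "g \<in> F" "s \<in> sides g" "e = arc_of s" "e \<subseteq> closure (cell f)" by (auto simp: graph_def)
  then have "arc_of s \<subseteq> closed_cone f" unfolding closure_cell[OF f] by blast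
  then have "s \<subseteq> set (cyc f)" using arc_of_subset_closed_cone_iff gs f by blast
  then show "e \<in> arc_of ` sides f" using side_faces_self[OF f gs(1,2)] gs(3) by blast
next
  fix e assume "e \<in> arc_of ` sides f"
  then obtain s where s: "s \<in> sides f" "e = arc_of s" by blast
  then have "e \<subseteq> closed_cone f" using arc_of_subset_closed_cone_iff[OF f s(1) f] side_subset[OF f] by blast
  then show "e \<in> {e \<in> edges graph. e \<subseteq> closure (cell f)}"
    using s f unfolding closure_cell[OF f] by (auto simp: graph_def arc_of_def)
qed

lemma fdeg_cell:
  assumes f: "f \<in> F"
  shows "fdeg graph (cell f) = length (cyc f)"
proof -
  have "inj_on arc_of (sides f)" using inj_on_arc_of f by (rule_tac inj_on_subset) auto
  then show ?thesis unfolding fdeg_def edges_in_closure_cell[OF f] by (simp add: card_image card_sides f)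
qed

lemma faces_of_edge:
  assumes "f \<in> F" "s \<in> sides f"
  shows "card {\<sigma> \<in> faces graph. arc_of s \<subseteq> closure \<sigma>} = 2"
proof -
  have "arc_of s \<subseteq> closure (cell g) \<longleftrightarrow> s \<subseteq> set (cyc g)" if "g \<in> F" for g
    using arc_of_subset_closed_cone_iff[OF assms that] unfolding closure_cell[OF that] by (auto simp: arc_of_def)
  then have "{\<sigma> \<in> faces graph. arc_of s \<subseteq> closure \<sigma>} = cell ` {g \<in> F. s \<subseteq> set (cyc g)}"
    by (auto simp: graph_def)
  moreover have "inj_on cell {g \<in> F. s \<subseteq> set (cyc g)}" using inj_on_cell by (rule inj_on_subset) auto
  ultimately show ?thesis using side_two_faces[OF assms] by (simp add: card_image)
qed

lemma faces_meet:
  assumes f: "f \<in> F" and g: "g \<in> F" and ne: "f \<noteq> g" and meet: "closure (cell f) \<inter> closure (cell g) \<noteq> {}"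
  shows "(\<exists>v \<in> verts graph. closure (cell f) \<inter> closure (cell g) = {v}) \<or>
    closure (cell f) \<inter> closure (cell g) \<in> edges graph"
proof -
  have eq: "closure (cell f) \<inter> closure (cell g) = sphere 0 1 \<inter> cone (set (cyc f) \<inter> set (cyc g))"
    unfolding closure_cell[OF f] closure_cell[OF g] closed_cone_Int[OF f g, symmetric] by blast
  consider "set (cyc f) \<inter> set (cyc g) = {}" | v where "set (cyc f) \<inter> set (cyc g) = {v}"
    | "set (cyc f) \<inter> set (cyc g) \<in> sides f"
    using meet_sides[OF f g ne] by blast
  then show ?thesis
  proof cases
    case 1
    then show ?thesis using meet unfolding eq by (simp add: cone_def)
  next
    case (2 v)
    then have "v \<in> V" using V_I[OF f, of v] by auto
    then show ?thesis unfolding eq 2 using arc_of_singleton by (auto simp: graph_def)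
  next
    case 3
    then show ?thesis unfolding eq using f by (auto simp: graph_def arc_of_def)
  qed
qed

lemma vdeg_pt:
  assumes v: "v \<in> V"
  shows "3 \<le> vdeg graph (pt v)"
proof -
  let ?W = "{w. w \<noteq> v \<and> (\<exists>f \<in> F. \<exists>i < length (cyc f). {v, w} = {cyc f ! i, cyc f ! (Suc i mod length (cyc f))})}"
  let ?Y = "{y \<in> verts graph. y \<noteq> pt v \<and> (\<exists>e \<in> edges graph. e \<inter> verts graph = {pt v, y})}"
  have W: "w \<noteq> v \<and> w \<in> V \<and> (\<exists>f \<in> F. {v, w} \<in> sides f)" if wW: "w \<in> ?W" for w
  proof -
    obtain f i where fi: "w \<noteq> v" "f \<in> F" "i < length (cyc f)" "{v, w} = {cyc f ! i, cyc f ! (Suc i mod length (cyc f))}"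
      using wW by blast
    then have "{v, w} \<in> sides f" by (auto simp: sides_def)
    then show ?thesis using fi V_I[OF fi(2)] side_subset[OF fi(2)] by blast
  qed
  have "pt ` ?W \<subseteq> ?Y"
  proof
    fix y assume "y \<in> pt ` ?W"
    then obtain w where w: "w \<in> ?W" "y = pt w" by blast
    then obtain f where f: "f \<in> F" "{v, w} \<in> sides f" "w \<noteq> v" "w \<in> V" using W by blast
    have "arc_of {v, w} \<in> edges graph" using f by (auto simp: graph_def)
    moreover have "arc_of {v, w} \<inter> verts graph = {pt v, y}"
      using arc_of_Int_verts[OF f(1,2)] w(2) by (simp add: graph_def)
    moreover have "y \<noteq> pt v" using w(2) f v inj_on_pt by (metis inj_on_def)
    moreover have "y \<in> verts graph" using w(2) f(4) by (simp add: graph_def)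
    ultimately show "y \<in> ?Y" by blast
  qed
  moreover have "finite ?Y" using finite_V by (simp add: graph_def)
  ultimately have "card (pt ` ?W) \<le> card ?Y" by (rule card_mono[rotated])
  moreover have "card (pt ` ?W) = card ?W"
  proof (rule card_image, rule inj_on_subset[OF inj_on_pt], rule subsetI)
    fix w assume "w \<in> ?W"
    then show "w \<in> V" using W by blast
  qed
  moreover have "3 \<le> card ?W" using v three_edges unfolding V_def by blast
  ultimately show ?thesis by (simp add: vdeg_def)
qed

lemma tessellation_graph: "tessellation (sphere 0 1) graph"
  unfolding tessellation_def
proof (intro conjI ballI impI)
  show "simple_graph_on (sphere 0 1) graph" by (rule simple_graph)
  show "faces graph = components (sphere 0 1 - (verts graph \<union> \<Union>(edges graph)))"
    using faces_eq_components by (simp add: graph_def)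
next
  fix e assume "e \<in> edges graph"
  then show "card {\<sigma> \<in> faces graph. e \<subseteq> closure \<sigma>} = 2"
    using faces_of_edge by (auto simp: graph_def)
next
  fix x assume "x \<in> verts graph"
  then show "3 \<le> vdeg graph x" using vdeg_pt by (auto simp: graph_def)
next
  fix \<sigma> assume "\<sigma> \<in> faces graph"
  then obtain f where f: "f \<in> F" "\<sigma> = cell f" by (auto simp: graph_def)
  show "3 \<le> fdeg graph \<sigma>" using f fdeg_cell length_cyc by simp
  show "\<exists>h k. homeomorphism (cball (0 :: complex) 1) (closure \<sigma>) h k \<and> h ` ball 0 1 = \<sigma>"
    using cell_disk[OF f(1)] f(2) by metis
  show "\<exists>B. finite B \<and> B \<subseteq> edges graph \<and> closure \<sigma> - \<sigma> = \<Union>B"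
  proof (intro exI conjI)
    show "finite (arc_of ` sides f)" using finite_sides by simp
    show "arc_of ` sides f \<subseteq> edges graph" using f by (auto simp: graph_def)
    show "closure \<sigma> - \<sigma> = \<Union>(arc_of ` sides f)"
    proof (intro equalityI subsetI)
      fix x assume x: "x \<in> closure \<sigma> - \<sigma>"
      then have "x \<in> sphere 0 1 \<inter> closed_cone f" "x \<notin> cell f" using f closure_cell by auto
      then obtain s where "s \<in> sides f" "x \<in> arc_of s" by (rule not_cell_cases[OF f(1)])
      then show "x \<in> \<Union>(arc_of ` sides f)" by blast
    next
      fix x assume "x \<in> \<Union>(arc_of ` sides f)"
      then obtain s where s: "s \<in> sides f" "x \<in> arc_of s" by blast
      then have "arc_of s \<subseteq> closure (cell f)" using edges_in_closure_cell[OF f(1)] by blast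
      then show "x \<in> closure \<sigma> - \<sigma>" using s arc_of_Int_cell[OF f(1) s(1) f(1)] f(2) by blast
    qed
  qed
  fix \<tau> assume "\<tau> \<in> faces graph" "\<sigma> \<noteq> \<tau>" "closure \<sigma> \<inter> closure \<tau> \<noteq> {}"
  then show "(\<exists>v \<in> verts graph. closure \<sigma> \<inter> closure \<tau> = {v}) \<or> closure \<sigma> \<inter> closure \<tau> \<in> edges graph"
    using f faces_meet by (auto simp: graph_def)
qed

lemma finite_verts_graph: "finite (verts graph)"
  using finite_V by (simp add: graph_def)

lemma Area_graph: "Area a graph = (\<Sum>f \<in> F. polygon_area (length (cyc f)) a)"
  unfolding Area_def using inj_on_cell by (simp add: graph_def sum.reindex fdeg_cell[unfolded graph_def])

lemma faces_at_pt:
  assumes "v \<in> V"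
  shows "faces_at graph (pt v) = cell ` {f \<in> F. v \<in> set (cyc f)}"
proof -
  have "pt v \<in> closure (cell f) \<longleftrightarrow> v \<in> set (cyc f)" if "f \<in> F" for f
    unfolding closure_cell[OF that] using pt_in_closed_cone_iff[OF assms that] pt_sphere[OF assms] by blast
  then show ?thesis by (auto simp: faces_at_def graph_def)
qed

lemma total_angle_pt:
  assumes "v \<in> V"
  shows "total_angle graph a (pt v) = (\<Sum>f \<in> {f \<in> F. v \<in> set (cyc f)}. polygon_angle (length (cyc f)) a)"
proof -
  have "inj_on cell {f \<in> F. v \<in> set (cyc f)}" using inj_on_cell by (rule inj_on_subset) auto
  then show ?thesis
    unfolding total_angle_def faces_at_pt[OF assms] by (simp add: sum.reindex fdeg_cell)
qed

end


section \<open>A wedge spanned by a 13-gon and an 11-gon\<close>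

definition vec3 :: "int \<times> int \<times> int \<Rightarrow> real ^ 3" where
  "vec3 = (\<lambda>(a, b, c). vector [of_int a, of_int b, of_int c])"

definition idot :: "int \<times> int \<times> int \<Rightarrow> int \<times> int \<times> int \<Rightarrow> int" where
  "idot = (\<lambda>(a, b, c) (x, y, z). a * x + b * y + c * z)"

definition itriple :: "int \<times> int \<times> int \<Rightarrow> int \<times> int \<times> int \<Rightarrow> int \<times> int \<times> int \<Rightarrow> int" where
  "itriple = (\<lambda>(a, b, c) (d, e, f) (x, y, z).
    (b * f - c * e) * x + (c * d - a * f) * y + (a * e - b * d) * z)"

lemma vec3_dot: "vec3 p \<bullet> vec3 q = of_int (idot p q)"
  by (cases p; cases q) (simp add: vec3_def idot_def inner_vec_def sum_3 vector_3)

lemma vec3_triple: "triple (vec3 p) (vec3 q) (vec3 s) = of_int (itriple p q s)"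
  by (cases p; cases q; cases s)
    (simp add: vec3_def itriple_def cross3_def inner_vec_def sum_3 vector_3 algebra_simps)

text \<open>
  In this order: the 13-gon, the 11-gon, a triangle, a second triangle, eight squares, and the mirror
  images of the two triangles in reverse order.  The eight squares and the two outermost triangles have normals in
  the plane \<open>z = 0\<close>, where they form a convex polygon: eight times the points \<open>(\<plusminus>1, 0)\<close>, \<open>(\<plusminus>3, 1)\<close>,
  \<open>(\<plusminus>5, 3)\<close>, \<open>(\<plusminus>7, 6)\<close>, \<open>(\<plusminus>9, 12)\<close>, shifted so that the origin lies inside the polytope.  Above and
  below it, beyond the side joining the outermost triangles, lie the normals of the 13-gon and the
  11-gon.  The inner triangle \<open>(66, 39, 1)\<close> is put into the plane through the normals of the 11-gon and
  of the neighbouring square and triangle: beyond the midpoint of the latter two, by \<open>1/32\<close> of the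
  distance from the former.  This coplanarity creates a vertex of degree four.
\<close>

definition normals :: "(int \<times> int \<times> int) list" where
  "normals = [(0, 72, 32), (0, 72, -32), (-72, 64, 0), (-66, 39, 1),
    (-56, 16, 0), (-40, -8, 0), (-24, -24, 0), (-8, -32, 0),
    (8, -32, 0), (24, -24, 0), (40, -8, 0), (56, 16, 0), (66, 39, 1), (72, 64, 0)]"

text \<open>
  The outward normals of the facets of that polytope.  Entries 0 and 12 are the ends of the hinge, the
  edge shared by the 13-gon and the 11-gon; entries 1 to 11 are the other vertices of the 13-gon and 13
  to 21 those of the 11-gon.
\<close>

definition rays :: "(int \<times> int \<times> int) list" where
  "rays = [(-1, 9, 0), (-101, -15, 231), (-85, -47, 231), (-12, -8, 35), (-4, -4, 15), (-4, -8, 27),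
    (0, -4, 13), (4, -8, 27), (4, -4, 15), (12, -8, 35), (85, -47, 231), (101, -15, 231), (1, 9, 0),
    (-3, -1, -7), (-12, -8, -35), (-4, -4, -15), (-4, -8, -27), (0, -4, -13), (4, -8, -27),
    (4, -4, -15), (12, -8, -35), (3, -1, -7)]"

definition polygons :: "nat list list" where
  "polygons = [[0, 1, 2, 3, 4, 5, 6, 7, 8, 9, 10, 11, 12], [12, 21, 20, 19, 18, 17, 16, 15, 14, 13, 0], [0, 13, 1], [1, 13, 2],
    [2, 13, 14, 3], [3, 14, 15, 4], [4, 15, 16, 5], [5, 16, 17, 6],
    [6, 17, 18, 7], [7, 18, 19, 8], [8, 19, 20, 9], [9, 20, 21, 10], [10, 21, 11], [11, 21, 12]]"

definition polygon_sides :: "nat list \<Rightarrow> (nat \<times> nat) list" where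
  "polygon_sides p = map (\<lambda>i. (p ! i, p ! (Suc i mod length p))) [0..<length p]"

lemma polygons_simple: "list_all (\<lambda>p. 3 \<le> length p \<and> distinct p \<and> list_all (\<lambda>v. v < 22) p) polygons"
  by code_simp

lemma polygons_convex: "list_all (\<lambda>p. list_all (\<lambda>(a, b). list_all (\<lambda>v. v = a \<or> v = b \<or>
    0 < itriple (rays ! a) (rays ! b) (rays ! v)) p) (polygon_sides p)) polygons"
  by code_simp

lemma normals_tight_iff: "list_all (\<lambda>(p, m). list_all (\<lambda>v. 0 < idot m (rays ! v) \<and> list_all (\<lambda>(q, k).
   (if List.member q v then idot k (rays ! v) = idot m (rays ! v)
    else idot k (rays ! v) < idot m (rays ! v))) (zip polygons normals)) p) (zip polygons normals)"
  by code_simp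

lemma polygons_meet: "list_all (\<lambda>p. list_all (\<lambda>q. p = q \<or> (let s = filter (List.member q) p in
    length s \<le> 1 \<or> list_ex (\<lambda>(a, b). s = [a, b] \<or> s = [b, a]) (polygon_sides p))) polygons) polygons"
  by code_simp

lemma sides_in_two_polygons: "list_all (\<lambda>p. list_all (\<lambda>(a, b).
    length (filter (\<lambda>q. List.member q a \<and> List.member q b) polygons) = 2) (polygon_sides p)) polygons"
  by code_simp

lemma degree_at_least_three: "list_all (\<lambda>v. 3 \<le> length (remdups (map snd (filter (\<lambda>(a, b). a = v)
    (concat (map polygon_sides polygons)))))) [0..<22]"
  by code_simp

definition wedge :: "(nat list \<times> (int \<times> int \<times> int)) set" where
  "wedge = set (zip polygons normals)"

lemma polygons_distinct_aligned: "distinct polygons" "length polygons = length normals"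
  by code_simp+

lemma wedgeD:
  assumes "f \<in> wedge"
  shows "fst f \<in> set polygons" "f \<in> set (zip polygons normals)"
  using assms set_zip_leftD[of "fst f" "snd f"] by (auto simp: wedge_def)

lemma wedge_eqI: "f \<in> wedge \<Longrightarrow> g \<in> wedge \<Longrightarrow> fst f = fst g \<Longrightarrow> f = g"
  unfolding wedge_def by (auto simp: in_set_conv_nth nth_eq_iff_index_eq[OF polygons_distinct_aligned(1)])

lemma fst_wedge: "fst ` wedge = set polygons"
  unfolding wedge_def set_map[symmetric] map_fst_zip[OF polygons_distinct_aligned(2)] ..

lemma inj_on_fst_wedge: "inj_on fst wedge"
  using wedge_eqI by (auto intro!: inj_onI)

lemma polygon_side: "i < length p \<Longrightarrow> (p ! i, p ! (Suc i mod length p)) \<in> set (polygon_sides p)"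
  by (auto simp: polygon_sides_def)

lemma polygon_sideE:
  assumes "(a, b) \<in> set (polygon_sides p)"
  obtains i where "i < length p" "a = p ! i" "b = p ! (Suc i mod length p)"
  using assms by (auto simp: polygon_sides_def)

interpretation wedge: convex_fan wedge "\<lambda>f. vec3 (snd f)" fst "\<lambda>v. vec3 (rays ! v)"
proof
  show "finite wedge" by (simp add: wedge_def)
  show "wedge \<noteq> {}" by (simp add: wedge_def polygons_def normals_def)
next
  fix f :: "nat list \<times> int \<times> int \<times> int" assume f: "f \<in> wedge"
  note p = wedgeD[OF f]
  show "3 \<le> length (fst f)" "distinct (fst f)" using polygons_simple p by (auto simp: list_all_iff)
  {
    fix i v assume i: "i < length (fst f)" and v: "v \<in> set (fst f)" "v \<noteq> fst f ! i" "v \<noteq> fst f ! (Suc i mod length (fst f))"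
    have "0 < itriple (rays ! (fst f ! i)) (rays ! (fst f ! (Suc i mod length (fst f)))) (rays ! v)"
      using polygons_convex[unfolded list_all_iff] p(1) polygon_side[OF i] v by fastforce
    then show "0 < triple (vec3 (rays ! (fst f ! i))) (vec3 (rays ! (fst f ! (Suc i mod length (fst f))))) (vec3 (rays ! v))"
      by (simp add: vec3_triple)
  next
    fix v assume v: "v \<in> set (fst f)"
    have c: "0 < idot (snd f) (rays ! v) \<and> (\<forall>g \<in> wedge. if v \<in> set (fst g)
        then idot (snd g) (rays ! v) = idot (snd f) (rays ! v) else idot (snd g) (rays ! v) < idot (snd f) (rays ! v))"
      using normals_tight_iff[unfolded list_all_iff] p(2) v unfolding wedge_def by (fastforce simp: List.member_iff)
    then show "0 < vec3 (snd f) \<bullet> vec3 (rays ! v)" by (simp add: vec3_dot)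
    fix g :: "nat list \<times> int \<times> int \<times> int" assume g: "g \<in> wedge"
    then show "vec3 (snd g) \<bullet> vec3 (rays ! v) \<le> vec3 (snd f) \<bullet> vec3 (rays ! v)"
      using c by (fastforce simp: vec3_dot split: if_splits)
    show "v \<in> set (fst g)" if "vec3 (snd g) \<bullet> vec3 (rays ! v) = vec3 (snd f) \<bullet> vec3 (rays ! v)"
      using c g that by (fastforce simp: vec3_dot split: if_splits)
  next
    fix g :: "nat list \<times> int \<times> int \<times> int" assume g: "g \<in> wedge" "f \<noteq> g"
    let ?s = "filter (List.member (fst g)) (fst f)"
    have s: "set (fst f) \<inter> set (fst g) = set ?s" by (auto simp: List.member_iff)
    have "fst f \<noteq> fst g" using wedge_eqI f g by blast
    then have "length ?s \<le> 1 \<or> list_ex (\<lambda>(a, b). ?s = [a, b] \<or> ?s = [b, a]) (polygon_sides (fst f))"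
      using polygons_meet[unfolded list_all_iff Let_def] p(1) wedgeD(1)[OF g(1)] by blast
    then consider "length ?s = 0" | "length ?s = 1"
      | a b where "(a, b) \<in> set (polygon_sides (fst f))" "?s = [a, b] \<or> ?s = [b, a]"
      unfolding list_ex_iff by (cases "length ?s") auto
    then show "set (fst f) \<inter> set (fst g) = {} \<or> (\<exists>v. set (fst f) \<inter> set (fst g) = {v}) \<or>
        (\<exists>i < length (fst f). set (fst f) \<inter> set (fst g) = {fst f ! i, fst f ! (Suc i mod length (fst f))})"
    proof cases
      case 1
      then show ?thesis unfolding s by simp
    next
      case 2
      then obtain v where "?s = [v]" by (auto simp: length_Suc_conv)
      then show ?thesis unfolding s by auto
    next
      case 3
      then obtain i where "i < length (fst f)" "a = fst f ! i" "b = fst f ! (Suc i mod length (fst f))"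
        by (elim polygon_sideE)
      moreover have "set ?s = {a, b}" using 3(2) by (elim disjE) (simp_all only: list.set insert_commute)
      ultimately show ?thesis unfolding s by auto
    qed
  next
    fix i assume i: "i < length (fst f)"
    let ?a = "fst f ! i" and ?b = "fst f ! (Suc i mod length (fst f))"
    let ?L = "filter (\<lambda>q. List.member q ?a \<and> List.member q ?b) polygons"
    have L: "q \<in> set ?L \<longleftrightarrow> q \<in> set polygons \<and> {?a, ?b} \<subseteq> set q" for q by simp
    have image: "fst ` {g \<in> wedge. {?a, ?b} \<subseteq> set (fst g)} = set ?L"
    proof (intro set_eqI iffI)
      fix q assume "q \<in> fst ` {g \<in> wedge. {?a, ?b} \<subseteq> set (fst g)}"
      then show "q \<in> set ?L" unfolding L using wedgeD(1) by blast
    next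
      fix q assume "q \<in> set ?L"
      then have q: "q \<in> fst ` wedge" "{?a, ?b} \<subseteq> set q" unfolding L fst_wedge by blast+
      then obtain g where "g \<in> wedge" "q = fst g" by blast
      with q(2) show "q \<in> fst ` {g \<in> wedge. {?a, ?b} \<subseteq> set (fst g)}" by blast
    qed
    have inj: "inj_on fst {g \<in> wedge. {?a, ?b} \<subseteq> set (fst g)}"
      using inj_on_fst_wedge by (rule inj_on_subset) blast
    have "card {g \<in> wedge. {?a, ?b} \<subseteq> set (fst g)} = card (set ?L)"
      using card_image[OF inj] unfolding image by (rule sym)
    also have "\<dots> = length ?L"
      using polygons_distinct_aligned(1) by (intro distinct_card) simp
    also have "\<dots> = 2"
    proof -
      have "\<forall>e \<in> set (polygon_sides (fst f)).
          (\<lambda>(a, b). length (filter (\<lambda>q. List.member q a \<and> List.member q b) polygons) = 2) e"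
        using sides_in_two_polygons[unfolded list_all_iff] p(1) by (rule bspec)
      from bspec[OF this polygon_side[OF i]] show ?thesis by (simp only: prod.case)
    qed
    finally show "card {g \<in> wedge. {?a, ?b} \<subseteq> set (fst g)} = 2" .
  next
    fix v assume v: "v \<in> set (fst f)"
    let ?l = "map snd (filter (\<lambda>(a, b). a = v) (concat (map polygon_sides polygons)))"
    let ?W = "{w. w \<noteq> v \<and> (\<exists>f \<in> wedge. \<exists>i < length (fst f). {v, w} = {fst f ! i, fst f ! (Suc i mod length (fst f))})}"
    have "v < 22" using polygons_simple p(1) v by (auto simp: list_all_iff)
    then have "3 \<le> length (remdups ?l)" using degree_at_least_three by (simp add: list_all_iff)
    also have "\<dots> = card (set ?l)" by (rule length_remdups_card_conv)
    also have "\<dots> \<le> card ?W"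
    proof (rule card_mono)
      have "?W \<subseteq> \<Union>(set ` fst ` wedge)"
      proof
        fix w assume "w \<in> ?W"
        then obtain f i where *: "f \<in> wedge" "i < length (fst f)" "{v, w} = {fst f ! i, fst f ! (Suc i mod length (fst f))}" by blast
        then have "Suc i mod length (fst f) < length (fst f)" by (intro mod_less_divisor) auto
        then have "{v, w} \<subseteq> set (fst f)" unfolding *(3) using *(2) by simp
        then show "w \<in> \<Union>(set ` fst ` wedge)" using *(1) by blast
      qed
      then show "finite ?W" by (rule finite_subset) (auto simp: wedge_def)
      show "set ?l \<subseteq> ?W"
      proof
        fix w assume "w \<in> set ?l"
        then obtain q where q: "q \<in> set polygons" "(v, w) \<in> set (polygon_sides q)" by auto
        then obtain g where g: "g \<in> wedge" "fst g = q" using fst_wedge by (metis imageE)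
        obtain i where i: "i < length q" "v = q ! i" "w = q ! (Suc i mod length q)"
          using q(2) by (rule polygon_sideE)
        have "length q \<ge> 3" "distinct q" using polygons_simple q(1) by (auto simp: list_all_iff)
        have lt: "Suc i mod length q < length q"
          using \<open>length q \<ge> 3\<close> by (intro mod_less_divisor) linarith
        have ne: "Suc i mod length q \<noteq> i"
        proof (cases "Suc i = length q")
          case True
          then have "Suc i mod length q = 0" by simp
          then show ?thesis using True \<open>length q \<ge> 3\<close> by linarith
        next
          case False
          then have "Suc i mod length q = Suc i" using i(1) by (intro mod_less) linarith
          then show ?thesis by simp
        qed
        have "w \<noteq> v" using nth_eq_iff_index_eq[OF \<open>distinct q\<close> lt i(1)] ne i(2,3) by simp
        moreover have "i < length (fst g)" "{v, w} = {fst g ! i, fst g ! (Suc i mod length (fst g))}"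
          using g(2) i by simp_all
        ultimately show "w \<in> ?W" using g(1) by (intro CollectI conjI bexI[of _ g] exI[of _ i])
      qed
    qed
    finally show "3 \<le> card ?W" .
  }
qed

definition wedge_degrees :: "nat \<Rightarrow> nat list" where
  "wedge_degrees v = map length (filter (\<lambda>p. List.member p v) polygons)"

lemma wedge_vertices: "v \<in> wedge.V \<longleftrightarrow> v < 22"
proof -
  have "wedge.V = (\<Union>p \<in> set polygons. set p)" unfolding wedge.V_def fst_wedge[symmetric] by simp
  also have "\<dots> = {..<22}" by (simp add: polygons_def lessThan_nat_numeral lessThan_Suc) blast
  finally show ?thesis by auto
qed

lemma wedge_total_angle:
  assumes "v \<in> wedge.V"
  shows "total_angle wedge.graph a (wedge.pt v) = sum_list (map (\<lambda>n. polygon_angle n a) (wedge_degrees v))"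
proof -
  have "(\<Sum>f \<in> {f \<in> wedge. v \<in> set (fst f)}. polygon_angle (length (fst f)) a)
      = (\<Sum>p \<in> fst ` {f \<in> wedge. v \<in> set (fst f)}. polygon_angle (length p) a)"
    using inj_on_fst_wedge by (subst sum.reindex) (auto intro: inj_on_subset)
  also have "fst ` {f \<in> wedge. v \<in> set (fst f)} = set (filter (\<lambda>p. List.member p v) polygons)"
    using fst_wedge by (auto simp: List.member_iff)
  also have "(\<Sum>p \<in> set (filter (\<lambda>p. List.member p v) polygons). polygon_angle (length p) a)
      = sum_list (map (\<lambda>p. polygon_angle (length p) a) (filter (\<lambda>p. List.member p v) polygons))"
    using polygons_distinct_aligned(1) by (intro sum_list_distinct_conv_sum_set[symmetric]) simp
  finally show ?thesis
    unfolding wedge.total_angle_pt[OF assms] wedge_degrees_def by (simp add: comp_def)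
qed

text \<open>
  At the ends of the hinge the face degrees are \<open>3, 11, 13\<close>; all other vertices have larger curvature.
\<close>

lemma wedge_degrees_cases: "list_all (\<lambda>v. wedge_degrees v \<in> set [[13, 11, 3], [13, 3, 3], [13, 3, 4],
    [13, 4, 4], [13, 4, 3], [11, 3, 3, 4], [11, 4, 4], [11, 4, 3, 3]]) [0..<22]"
  by code_simp

text \<open>
  For side tending to zero the angles become those of flat polygons, whose sum is below \<open>2 \<pi>\<close> when the
  combinatorial curvature is positive.
\<close>

lemma eventually_angle_sum_le:
  assumes "\<forall>n \<in> set ds. 3 \<le> n" "0 < comb_curvature ds"
  shows "eventually (\<lambda>a. sum_list (map (\<lambda>n. polygon_angle n a) ds) \<le> 2 * pi) (at_right 0)"
proof -
  have lim: "(polygon_angle n \<longlongrightarrow> polygon_angle n 0) (at_right 0)" if "n \<in> set ds" for n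
  proof -
    have n: "3 \<le> n" "0 < 2 * pi / real n" using assms(1) that by auto
    have "(polygon_angle n \<longlongrightarrow> polygon_angle n 0) (at 0 within {0 .. 2 * pi / real n})"
      using continuous_on_polygon_angle[OF n(1)] n(2) by (simp add: continuous_on_def)
    then show ?thesis using n(2) by (simp add: at_within_Icc_at_right)
  qed
  have sum: "((\<lambda>a. sum_list (map (\<lambda>n. polygon_angle n a) xs)) \<longlongrightarrow> sum_list (map (\<lambda>n. polygon_angle n 0) xs)) (at_right 0)"
    if "set xs \<subseteq> set ds" for xs
    using that by (induction xs) (auto intro!: tendsto_intros lim)
  have "sum_list (map (\<lambda>n. polygon_angle n 0) ds) = sum_list (map (\<lambda>n. corner_excess n 0) ds)
      + 2 * pi * (real (length ds) / 2 - sum_list (map (\<lambda>n. 1 / real n) ds))"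
    by (simp add: sum_list_corner_excess)
  also have "map (\<lambda>n. corner_excess n 0) ds = map (\<lambda>n. 0) ds"
    using assms(1) by (auto simp: corner_excess_def polygon_angle_0)
  finally have "sum_list (map (\<lambda>n. polygon_angle n 0) ds) = 2 * pi * (1 - comb_curvature ds)"
    by (simp add: sum_list_0)
  also have "\<dots> < 2 * pi * 1" using assms(2) by (intro mult_strict_left_mono) auto
  finally have "sum_list (map (\<lambda>n. polygon_angle n 0) ds) < 2 * pi" by simp
  from order_tendstoD(2)[OF sum[OF order_refl] this] show ?thesis
    by (rule eventually_mono) simp
qed

lemma wedge_degrees:
  assumes "v \<in> wedge.V"
  shows "\<forall>n \<in> set (wedge_degrees v). 3 \<le> n" "0 < comb_curvature (wedge_degrees v)"
proof -
  have "v \<in> set [0..<22]" using assms by (simp add: wedge_vertices)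
  with wedge_degrees_cases have "wedge_degrees v \<in> set [[13, 11, 3], [13, 3, 3], [13, 3, 4],
    [13, 4, 4], [13, 4, 3], [11, 3, 3, 4], [11, 4, 4], [11, 4, 3, 3]]" unfolding list_all_iff by blast
  then show "\<forall>n \<in> set (wedge_degrees v). 3 \<le> n" "0 < comb_curvature (wedge_degrees v)"
    unfolding list.set by (elim insertE emptyE; simp)+
qed

lemma wedge_face_degrees:
  assumes "\<sigma> \<in> faces wedge.graph"
  shows "fdeg wedge.graph \<sigma> \<le> 13" "3 \<le> fdeg wedge.graph \<sigma>"
proof -
  obtain f where f: "f \<in> wedge" "\<sigma> = wedge.cell f" using assms by (auto simp: wedge.graph_def)
  have "list_all (\<lambda>p. 3 \<le> length p \<and> length p \<le> 13) polygons" by code_simp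
  then have "3 \<le> length (fst f) \<and> length (fst f) \<le> 13" using wedgeD(1)[OF f(1)] by (auto simp: list_all_iff)
  then show "fdeg wedge.graph \<sigma> \<le> 13" "3 \<le> fdeg wedge.graph \<sigma>" using f wedge.fdeg_cell by auto
qed

lemma wedge_small_side:
  obtains b where "0 < b" "b \<le> 2 * pi / real 13" "curvature_ge_1 b wedge.graph"
proof -
  have "eventually (\<lambda>a. sum_list (map (\<lambda>n. polygon_angle n a) (wedge_degrees v)) \<le> 2 * pi) (at_right 0)"
    if "v \<in> wedge.V" for v
    using eventually_angle_sum_le wedge_degrees[OF that] by blast
  then have "eventually (\<lambda>a. \<forall>v \<in> wedge.V. sum_list (map (\<lambda>n. polygon_angle n a) (wedge_degrees v)) \<le> 2 * pi) (at_right 0)"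
    by (simp add: eventually_ball_finite_distrib wedge.finite_V)
  moreover have "eventually (\<lambda>a. a \<in> {0 <..< 2 * pi / real 13}) (at_right 0)"
    by (rule eventually_at_right_real) simp
  ultimately have "eventually (\<lambda>a. a \<in> {0 <..< 2 * pi / real 13} \<and>
      (\<forall>v \<in> wedge.V. sum_list (map (\<lambda>n. polygon_angle n a) (wedge_degrees v)) \<le> 2 * pi)) (at_right (0 :: real))"
    by (rule eventually_conj[rotated])
  then obtain b where "b \<in> {0 <..< 2 * pi / real 13}"
      "\<forall>v \<in> wedge.V. sum_list (map (\<lambda>n. polygon_angle n b) (wedge_degrees v)) \<le> 2 * pi"
    using eventually_happens'[OF trivial_limit_at_right_real] by blast
  then show ?thesis
    using that[of b] wedge_total_angle[of _ b]
    by (auto simp: curvature_ge_1_def angle_defect_def wedge.graph_def)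
qed

lemma wedge_in_PC: "wedge.graph \<in> PC_ge_1"
proof -
  obtain b where b: "0 < b" "b \<le> 2 * pi / real 13" "curvature_ge_1 b wedge.graph" by (rule wedge_small_side)
  have "b \<le> (INF \<sigma> \<in> faces wedge.graph. 2 * pi / real (fdeg wedge.graph \<sigma>))"
  proof (rule cINF_greatest)
    show "faces wedge.graph \<noteq> {}" using wedge.F_ne by (simp add: wedge.graph_def)
    fix \<sigma> assume "\<sigma> \<in> faces wedge.graph"
    then show "b \<le> 2 * pi / real (fdeg wedge.graph \<sigma>)"
      using b(2) wedge_face_degrees by (intro hemisphere_side_antimono[OF b(2)]) fastforce+
  qed
  then show ?thesis
    using b wedge.tessellation_graph wedge.finite_verts_graph by (auto simp: PC_ge_1_def planar_graph_def)
qed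

lemma wedge_Area: "Area a wedge.graph = polygon_area 13 a + polygon_area 11 a + 4 * polygon_area 3 a + 8 * polygon_area 4 a"
proof -
  have "Area a wedge.graph = (\<Sum>p \<in> fst ` wedge. polygon_area (length p) a)"
    unfolding wedge.Area_graph using inj_on_fst_wedge by (subst sum.reindex) auto
  also have "\<dots> = sum_list (map (\<lambda>p. polygon_area (length p) a) polygons)"
    unfolding fst_wedge using polygons_distinct_aligned(1) by (rule sum_list_distinct_conv_sum_set[symmetric])
  also have "\<dots> = sum_list (map (\<lambda>n. polygon_area n a) (map length polygons))"
    by (simp add: comp_def)
  also have "map length polygons = [13, 11, 3, 3, 4, 4, 4, 4, 4, 4, 4, 4, 3, 3]" by code_simp
  also have "sum_list (map (\<lambda>n. polygon_area n a) \<dots>)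
      = polygon_area 13 a + polygon_area 11 a + 4 * polygon_area 3 a + 8 * polygon_area 4 a" by simp
  finally show ?thesis .
qed

text \<open>
  The critical side is at most that of the end of the hinge, so the bounds for a vertex of type
  \<open>(3, 11, 13)\<close> limit the excess of every corner; the total area comes out below \<open>0.12\<close>.
\<close>

lemma wedge_Area_cri: "Area_cri wedge.graph \<le> 2.0961 / 10"
proof -
  let ?G = "wedge.graph"
  obtain b where b: "0 < b" "b \<le> 2 * pi / real 13" "curvature_ge_1 b ?G" by (rule wedge_small_side)
  have M: "sphere 0 1 \<noteq> ({} :: (real ^ 3) set)" by simp
  note T = tessellation_incidences[OF wedge.tessellation_graph M wedge.finite_verts_graph]
  have at: "faces_at ?G x \<subseteq> faces ?G" for x by (auto simp: faces_at_def)
  have crit: "b \<le> a_crit_at ?G x" "\<And>\<sigma>. \<sigma> \<in> faces_at ?G x \<Longrightarrow> a_crit_at ?G x \<le> 2 * pi / real (fdeg ?G \<sigma>)"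
    "0 \<le> angle_defect ?G (a_crit_at ?G x) x" if x: "x \<in> verts ?G" for x
  proof -
    have fin: "finite (faces_at ?G x)" using T(2) at by (rule rev_finite_subset)
    have deg: "3 \<le> fdeg ?G \<sigma>" "fdeg ?G \<sigma> \<le> 13" if "\<sigma> \<in> faces_at ?G x" for \<sigma>
      using wedge_face_degrees at that by blast+
    have le: "b \<le> 2 * pi / real (fdeg ?G \<sigma>)" if "\<sigma> \<in> faces_at ?G x" for \<sigma>
      using deg[OF that] by (intro hemisphere_side_antimono[OF b(2)]) auto
    have "0 \<le> angle_defect ?G b x" using b(3) x by (simp add: curvature_ge_1_def)
    note c = a_crit_at_properties[OF fin T(4)[OF x] deg(1) less_imp_le[OF b(1)] le this]
    show "b \<le> a_crit_at ?G x" "\<And>\<sigma>. \<sigma> \<in> faces_at ?G x \<Longrightarrow> a_crit_at ?G x \<le> 2 * pi / real (fdeg ?G \<sigma>)"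
      "0 \<le> angle_defect ?G (a_crit_at ?G x) x" using c(1-3) by blast+
  qed
  let ?x = "wedge.pt 0" and ?a = "a_crit ?G"
  have V0: "0 \<in> wedge.V" by (simp add: wedge_vertices)
  then have x: "?x \<in> verts ?G" by (simp add: wedge.graph_def)
  let ?c = "a_crit_at ?G ?x"
  have "?a \<le> ?c" unfolding a_crit_def using x wedge.finite_verts_graph by (intro Min_le) auto
  have "?a \<in> a_crit_at ?G ` verts ?G" unfolding a_crit_def
    using x wedge.finite_verts_graph by (intro Min_in) auto
  then have "0 \<le> ?a" using crit(1) b(1) by fastforce
  have deg0: "wedge_degrees 0 = [13, 11, 3]" by code_simp
  have "?c \<le> 2 * pi / real 13"
  proof -
    let ?f = "([0, 1, 2, 3, 4, 5, 6, 7, 8, 9, 10, 11, 12], (0, 72, 32)) :: nat list \<times> int \<times> int \<times> int"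
    have f: "?f \<in> wedge" by (simp add: wedge_def polygons_def normals_def)
    have "wedge.cell ?f \<in> faces_at ?G ?x" unfolding wedge.faces_at_pt[OF V0] using f by auto
    from crit(2)[OF x this] show ?thesis unfolding wedge.fdeg_cell[OF f] by simp
  qed
  then have a: "?a \<le> 2 * pi / real 13" using \<open>?a \<le> ?c\<close> by simp
  have "polygon_angle 3 ?a + polygon_angle 11 ?a + polygon_angle 13 ?a
      \<le> polygon_angle 3 ?c + polygon_angle 11 ?c + polygon_angle 13 ?c"
    using \<open>?a \<le> ?c\<close> \<open>0 \<le> ?a\<close> \<open>?c \<le> 2 * pi / real 13\<close>
    by (intro add_mono polygon_angle_mono) (auto intro: hemisphere_side_antimono)
  also have "\<dots> = total_angle ?G ?c ?x" unfolding wedge_total_angle[OF V0] deg0 by simp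
  also have "\<dots> \<le> 2 * pi" using crit(3)[OF x] by (simp add: angle_defect_def)
  finally have "polygon_angle 3 ?a + polygon_angle 11 ?a + polygon_angle 13 ?a \<le> 2 * pi" .
  then have "1 / cos (?a / 2) \<le> 1.00045403" by (rule sec_half_side_le_of_3_11_13[OF \<open>0 \<le> ?a\<close> a])
  note e = corner_excess_le_of_sec[OF \<open>0 \<le> ?a\<close> a this]
  show ?thesis
    unfolding Area_cri_def wedge_Area using e by (simp add: polygon_area_eq_corner_excess)
qed

section \<open>The bounds for the minimal critical area\<close>

theorem theorem1p8:
  "8.3755 / 10 ^ 2 \<le> Area_min \<and> Area_min \<le> 2.0961 / 10"
proof
  show "8.3755 / 10 ^ 2 \<le> Area_min"
    unfolding Area_min_def using wedge_in_PC Area_cri_lower_bound by (intro cINF_greatest) auto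
  have "Area_min \<le> Area_cri wedge.graph"
    unfolding Area_min_def
    by (rule cINF_lower[OF _ wedge_in_PC]) (rule bdd_belowI2, rule Area_cri_lower_bound)
  also note wedge_Area_cri
  finally show "Area_min \<le> 2.0961 / 10" .
qed

end
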